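(* Let $M$ and $M'$ be pure motives over $\mathbb{Q}$ with coefficients in a number field $\mathbb{E}$ such that: (1) the ranks $d(M)$ and $d(M')$ are both odd; (2) all the nonzero Hodge numbers $h^{p,q}_{M}$ and $h^{p,q}_{M'}$ are equal to $1$; (3) the tensor product motive $M\otimes M'$ is critical. (Hypothesis (2) implies that complex conjugation acts by a scalar $\epsilon(M)$, resp. $\epsilon(M')$, on the one-dimensional middle Hodge type of $M$, resp. $M'$.) Then, in $(\mathbb{E}\otimes_{\mathbb{Q}}\mathbb{C})^\times/\mathbb{E}^\times$, \[ \frac{c^{+}(M\otimes M')}{c^{-}(M\otimes M')} = \left( \frac{c^{+}(M)}{c^{-}(M)}\right)^{\epsilon(M')} \left( \frac{c^{+}(M')}{c^{-}(M')}\right)^{\epsilon(M)}. \]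
   Context: For a pure motive $M$ over $\mathbb{Q}$ with coefficients in $\mathbb{E}$: the Betti realization $H_B(M)$ is an $\mathbb{E}$-vector space of dimension $d(M)$ (the rank) with involution $\rho$ (complex conjugation), whose $\pm1$-eigenspaces $H_B^{\pm}(M)$ have dimensions $d^{\pm}(M)$; there is a Hodge decomposition $H_B(M)\otimes_{\mathbb{Q}}\mathbb{C}=\bigoplus_{p+q=w}H^{p,q}(M)$ (purity of weight $w$) with $H^{p,q}$ free $\mathbb{E}\otimes\mathbb{C}$-modules of rank $h^{p,q}_M$ (Hodge numbers) and $\rho(H^{p,q})=H^{q,p}$; the middle Hodge type is $H^{w/2,w/2}(M)$. The de Rham realization $H_{DR}(M)$ is an $\mathbb{E}$-vector space with decreasing Hodge filtration $F^p$ and comparison isomorphism $I:H_B(M)\otimes\mathbb{C}\to H_{DR}(M)\otimes\mathbb{C}$ with $I(\bigoplus_{p'\ge p}H^{p',q})=F^p\otimes\mathbb{C}$. $M$ is critical if there are filtration steps $F^{\pm}(M)$ with $\dim_{\mathbb{E}}H_{DR}(M)/F^{\mp}(M)=d^{\pm}(M)$. Deligne's periods $c^{\pm}(M)\in(\mathbb{E}\otimes_{\mathbb{Q}}\mathbb{C})^\times/\mathbb{E}^\times$ are the determinants, in $\mathbb{E}$-rational bases, of $H_B^{\pm}(M)\otimes\mathbb{C}\to H_{DR}(M)\otimes\mathbb{C}\to (H_{DR}(M)/F^{\mp}(M))\otimes\mathbb{C}$. Tensor products of motives have realizations the tensor products of the realizations. *)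

theory Defs
  imports
    Complex_Main
    "HOL-Library.Poly_Mapping"
    "HOL-Computational_Algebra.Group_Closure"
    "HOL-Algebra.Coset"
    "Jordan_Normal_Form.Determinant"
begin

section \<open>Tensor products of abelian groups\<close>

definition zmult :: "int \<Rightarrow> 'a :: ab_group_add \<Rightarrow> 'a" where
  "zmult n x = (\<Sum>i<nat n. x) - (\<Sum>i<nat (- n). x)"

lemma sum_const_add_nat: "(\<Sum>i<m + n. x) = (\<Sum>i<m. x) + (\<Sum>i<(n::nat). (x :: 'a :: ab_group_add))"
  by (induction n) (auto simp: algebra_simps)

lemma zmult_diff_nat: "zmult (int m - int n) x = (\<Sum>i<m. x) - (\<Sum>i<n. x)"
proof (cases "n \<le> m")
  case True
  then obtain k where "m = n + k" by (auto simp: le_iff_add)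
  then show ?thesis by (simp add: zmult_def sum_const_add_nat)
next
  case False
  then obtain k where "n = m + k" by (metis le_iff_add nat_le_linear)
  then show ?thesis by (simp add: zmult_def sum_const_add_nat)
qed

lemma zmult_add: "zmult (m + n) x = zmult m x + zmult n x"
proof -
  obtain a b where m: "m = int a - int b" by (metis int_diff_cases)
  obtain c d where n: "n = int c - int d" by (metis int_diff_cases)
  have mn: "m + n = int (a + c) - int (b + d)" by (simp add: m n)
  show ?thesis
    unfolding mn zmult_diff_nat sum_const_add_nat
    unfolding m n zmult_diff_nat by (simp add: algebra_simps)
qed

lemma zmult_0 [simp]: "zmult 0 x = 0"
  and zmult_1 [simp]: "zmult 1 x = x"
  by (simp_all add: zmult_def)

definition frag_eval :: "('x \<Rightarrow> 'a :: ab_group_add) \<Rightarrow> ('x \<Rightarrow>\<^sub>0 int) \<Rightarrow> 'a" where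
  "frag_eval f c = (\<Sum>x\<in>Poly_Mapping.keys c. zmult (Poly_Mapping.lookup c x) (f x))"

lemma frag_eval_of [simp]: "frag_eval f (frag_of x) = f x"
  by (simp add: frag_eval_def)

lemma frag_eval_superset:
  assumes "finite S" "Poly_Mapping.keys c \<subseteq> S"
  shows "frag_eval f c = (\<Sum>x\<in>S. zmult (Poly_Mapping.lookup c x) (f x))"
  unfolding frag_eval_def using assms
  by (intro sum.mono_neutral_left) (auto simp: in_keys_iff)

lemma frag_eval_add: "frag_eval f (c + d) = frag_eval f c + frag_eval f d"
proof -
  let ?S = "Poly_Mapping.keys c \<union> Poly_Mapping.keys d"
  have S: "finite ?S" by simp
  show ?thesis
    using Poly_Mapping.keys_add[of c d]
    by (simp add: frag_eval_superset[OF S] lookup_add zmult_add sum.distrib)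
qed

interpretation frag_eval: additive "frag_eval f" for f
  by standard (rule frag_eval_add)

definition bilinear_relations :: "('a :: ab_group_add \<times> 'b :: ab_group_add \<Rightarrow>\<^sub>0 int) set" where
  "bilinear_relations =
     {frag_of (a + a', b) - frag_of (a, b) - frag_of (a', b) | a a' b. True} \<union>
     {frag_of (a, b + b') - frag_of (a, b) - frag_of (a, b') | a b b'. True}"

text \<open>
  The type below is the tensor product over the integers. For vector spaces over the rationals this
  is the same as the tensor product over the rationals, since a biadditive map of such spaces is
  automatically balanced over the rationals (see \<open>pure_tensor_balanced_rat\<close>).
\<close>

quotient_type (overloaded) ('a, 'b) tensor =
  "('a :: ab_group_add \<times> 'b :: ab_group_add) \<Rightarrow>\<^sub>0 int" /
  "\<lambda>c d. c - d \<in> group_closure (bilinear_relations :: ('a \<times> 'b \<Rightarrow>\<^sub>0 int) set)"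
proof (rule equivpI)
  show "reflp (\<lambda>c d. c - d \<in> group_closure (bilinear_relations :: ('a \<times> 'b \<Rightarrow>\<^sub>0 int) set))"
    by (auto intro!: reflpI)
  show "symp (\<lambda>c d. c - d \<in> group_closure (bilinear_relations :: ('a \<times> 'b \<Rightarrow>\<^sub>0 int) set))"
    by (intro sympI) (metis group_closure_minus_iff minus_diff_eq)
  show "transp (\<lambda>c d. c - d \<in> group_closure (bilinear_relations :: ('a \<times> 'b \<Rightarrow>\<^sub>0 int) set))"
  proof (rule transpI)
    fix x y z :: "'a \<times> 'b \<Rightarrow>\<^sub>0 int"
    assume "x - y \<in> group_closure bilinear_relations" "y - z \<in> group_closure bilinear_relations"
    from group_closure_add[OF this] show "x - z \<in> group_closure bilinear_relations" by simp
  qed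
qed

instantiation tensor :: (ab_group_add, ab_group_add) ab_group_add
begin

lift_definition zero_tensor :: "('a, 'b) tensor" is 0 .

lift_definition plus_tensor :: "('a, 'b) tensor \<Rightarrow> ('a, 'b) tensor \<Rightarrow> ('a, 'b) tensor" is "(+)"
  unfolding add_diff_add by (rule group_closure_add)

lift_definition uminus_tensor :: "('a, 'b) tensor \<Rightarrow> ('a, 'b) tensor" is uminus
  by (metis group_closure_minus_iff minus_diff_minus)

definition minus_tensor :: "('a, 'b) tensor \<Rightarrow> ('a, 'b) tensor \<Rightarrow> ('a, 'b) tensor" where
  "minus_tensor x y = x + - y"

instance
proof
  fix a b c :: "('a, 'b) tensor"
  show "a + b + c = a + (b + c)" by transfer (simp add: add.assoc)
  show "a + b = b + a" by transfer (simp add: add.commute)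
  show "0 + a = a" by transfer simp
  show "- a + a = 0" by transfer simp
  show "a - b = a + - b" by (rule minus_tensor_def)
qed

end

lift_definition pure_tensor :: "'a :: ab_group_add \<Rightarrow> 'b :: ab_group_add \<Rightarrow> ('a, 'b) tensor"
    (infixr "\<otimes>\<^sub>t" 75) is "\<lambda>a b. frag_of (a, b)" .

lemma pure_tensor_add_left: "(a + a') \<otimes>\<^sub>t b = a \<otimes>\<^sub>t b + a' \<otimes>\<^sub>t b"
  by transfer
    (rule group_closure.base, simp add: bilinear_relations_def diff_diff_eq[symmetric], blast)

lemma pure_tensor_add_right: "a \<otimes>\<^sub>t (b + b') = a \<otimes>\<^sub>t b + a \<otimes>\<^sub>t b'"
  by transfer
    (rule group_closure.base, simp add: bilinear_relations_def diff_diff_eq[symmetric], blast)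

interpretation pure_tensor_left: additive "\<lambda>a. a \<otimes>\<^sub>t b" for b
  by standard (rule pure_tensor_add_left)

interpretation pure_tensor_right: additive "\<lambda>b. a \<otimes>\<^sub>t b" for a
  by standard (rule pure_tensor_add_right)

lemma tensor_induct [case_names pure diff]:
  assumes pure: "\<And>a b. P (a \<otimes>\<^sub>t b)" and diff: "\<And>x y. P x \<Longrightarrow> P y \<Longrightarrow> P (x - y)"
  shows "P t"
proof -
  have minus: "abs_tensor (c - d) = abs_tensor c - abs_tensor d" for c d :: "'a \<times> 'b \<Rightarrow>\<^sub>0 int"
    by (simp add: minus_tensor_def plus_tensor.abs_eq uminus_tensor.abs_eq)
  have "P (abs_tensor c)" for c :: "'a \<times> 'b \<Rightarrow>\<^sub>0 int"
    using subset_UNIV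
  proof (induction c rule: frag_induction)
    case zero
    have "P (0 \<otimes>\<^sub>t 0)" by (rule pure)
    then show ?case by (simp add: pure_tensor_left.zero zero_tensor.abs_eq)
  next
    case (one x)
    then show ?case using pure[of "fst x" "snd x"] by (simp add: pure_tensor.abs_eq)
  next
    case (diff a b)
    then show ?case using assms(2) by (simp add: minus)
  qed
  then show ?thesis by (rule tensor.abs_induct)
qed

definition biadditive ::
    "('a :: ab_group_add \<Rightarrow> 'b :: ab_group_add \<Rightarrow> 'c :: ab_group_add) \<Rightarrow> bool" where
  "biadditive f \<longleftrightarrow>
     (\<forall>a a' b. f (a + a') b = f a b + f a' b) \<and> (\<forall>a b b'. f a (b + b') = f a b + f a b')"

text \<open>For biadditive \<open>f\<close>, the additive map it induces on the tensor product.\<close>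

definition tensor_lift ::
    "('a \<Rightarrow> 'b \<Rightarrow> 'c) \<Rightarrow> ('a :: ab_group_add, 'b :: ab_group_add) tensor \<Rightarrow> 'c :: ab_group_add" where
  "tensor_lift f t = frag_eval (\<lambda>(a, b). f a b) (rep_tensor t)"

lemma tensor_lift_abs:
  assumes "biadditive f"
  shows "tensor_lift f (abs_tensor c) = frag_eval (\<lambda>(a, b). f a b) c"
proof -
  have *: "frag_eval (\<lambda>(a, b). f a b) d = 0" if "d \<in> group_closure bilinear_relations" for d
    using that
  proof induction
    case (base s)
    then show ?case
      using assms
      by (auto simp: bilinear_relations_def biadditive_def frag_eval.diff frag_eval.zero)
  qed (simp add: frag_eval.diff)
  have "rep_tensor (abs_tensor c) - c \<in> group_closure bilinear_relations"
    using Quotient3_tensor rep_abs_rsp_left[OF Quotient3_tensor, of c c] by simp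
  then show ?thesis
    using *[of "rep_tensor (abs_tensor c) - c"] by (simp add: tensor_lift_def frag_eval.diff)
qed

lemma tensor_lift_pure [simp]: "biadditive f \<Longrightarrow> tensor_lift f (a \<otimes>\<^sub>t b) = f a b"
  by (simp add: pure_tensor.abs_eq tensor_lift_abs)

lemma tensor_lift_add:
  "biadditive f \<Longrightarrow> tensor_lift f (x + y) = tensor_lift f x + tensor_lift f y"
  by (induction x rule: tensor.abs_induct; induction y rule: tensor.abs_induct)
    (simp add: plus_tensor.abs_eq tensor_lift_abs frag_eval_add)

lemma additive_tensor_lift: "biadditive f \<Longrightarrow> additive (tensor_lift f)"
  by standard (rule tensor_lift_add)

lemma biadditive_pure: "biadditive (\<otimes>\<^sub>t)"
  by (simp add: biadditive_def pure_tensor_add_left pure_tensor_add_right)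

definition tensor_map ::
    "('a \<Rightarrow> 'c) \<Rightarrow> ('b \<Rightarrow> 'd) \<Rightarrow> ('a :: ab_group_add, 'b :: ab_group_add) tensor \<Rightarrow>
       ('c :: ab_group_add, 'd :: ab_group_add) tensor" where
  "tensor_map f g = tensor_lift (\<lambda>a b. f a \<otimes>\<^sub>t g b)"

text \<open>
  For biadditive \<open>f\<close> and \<open>g\<close>, the biadditive map with
  \<open>(a \<otimes> b, c \<otimes> d) \<mapsto> f a c \<otimes> g b d\<close>.
\<close>

definition tensor_map2 ::
    "('a \<Rightarrow> 'c \<Rightarrow> 'e) \<Rightarrow> ('b \<Rightarrow> 'd \<Rightarrow> 'f) \<Rightarrow>
       ('a :: ab_group_add, 'b :: ab_group_add) tensor \<Rightarrow>
       ('c :: ab_group_add, 'd :: ab_group_add) tensor \<Rightarrow>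
       ('e :: ab_group_add, 'f :: ab_group_add) tensor" where
  "tensor_map2 f g x y =
     tensor_lift (\<lambda>a b. tensor_lift (\<lambda>c d. f a c \<otimes>\<^sub>t g b d) y) x"

lemma tensor_map2:
  fixes f :: "'a :: ab_group_add \<Rightarrow> 'c :: ab_group_add \<Rightarrow> 'e :: ab_group_add"
    and g :: "'b :: ab_group_add \<Rightarrow> 'd :: ab_group_add \<Rightarrow> 'f :: ab_group_add"
  assumes f: "biadditive f" and g: "biadditive g"
  shows biadditive_tensor_map2: "biadditive (tensor_map2 f g)"
    and tensor_map2_pure: "tensor_map2 f g (a \<otimes>\<^sub>t b) (c \<otimes>\<^sub>t d) = f a c \<otimes>\<^sub>t g b d"
proof -
  have inner: "biadditive (\<lambda>c d. f a c \<otimes>\<^sub>t g b d)" for a b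
    using f g by (simp add: biadditive_def pure_tensor_add_left pure_tensor_add_right)
  have ext: "h t = k t" if "additive h" "additive k" "\<And>c d. h (c \<otimes>\<^sub>t d) = k (c \<otimes>\<^sub>t d)"
    for h k and t :: "('c, 'd) tensor"
    by (induction t rule: tensor_induct) (simp_all add: that additive.diff[OF that(1)] additive.diff[OF that(2)])
  have add: "additive (\<lambda>y. tensor_lift h y + tensor_lift k y)"
    if "biadditive h" "biadditive k" for h k :: "'c \<Rightarrow> 'd \<Rightarrow> ('e, 'f) tensor"
    using that by (intro additive.intro) (simp add: tensor_lift_add)
  have outer: "biadditive (\<lambda>a b. tensor_lift (\<lambda>c d. f a c \<otimes>\<^sub>t g b d) y)" for y
    unfolding biadditive_def
  proof (intro conjI allI)
    fix a a' b b'
    show "tensor_lift (\<lambda>c d. f (a + a') c \<otimes>\<^sub>t g b d) y =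
      tensor_lift (\<lambda>c d. f a c \<otimes>\<^sub>t g b d) y + tensor_lift (\<lambda>c d. f a' c \<otimes>\<^sub>t g b d) y"
      by (rule ext, rule additive_tensor_lift[OF inner], rule add[OF inner inner])
        (simp only: tensor_lift_pure[OF inner], use f in \<open>simp add: biadditive_def pure_tensor_add_left\<close>)
    show "tensor_lift (\<lambda>c d. f a c \<otimes>\<^sub>t g (b + b') d) y =
      tensor_lift (\<lambda>c d. f a c \<otimes>\<^sub>t g b d) y + tensor_lift (\<lambda>c d. f a c \<otimes>\<^sub>t g b' d) y"
      by (rule ext, rule additive_tensor_lift[OF inner], rule add[OF inner inner])
        (simp only: tensor_lift_pure[OF inner], use g in \<open>simp add: biadditive_def pure_tensor_add_right\<close>)
  qed
  show "tensor_map2 f g (a \<otimes>\<^sub>t b) (c \<otimes>\<^sub>t d) = f a c \<otimes>\<^sub>t g b d"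
    unfolding tensor_map2_def tensor_lift_pure[OF outer] by (rule tensor_lift_pure[OF inner])
  have right: "tensor_map2 f g x (y + y') = tensor_map2 f g x y + tensor_map2 f g x y'" for x y y'
  proof (induction x rule: tensor_induct)
    case (pure a b)
    show ?case
      unfolding tensor_map2_def tensor_lift_pure[OF outer] by (rule tensor_lift_add[OF inner])
  next
    case (diff x x')
    then show ?case
      by (simp add: tensor_map2_def additive.diff[OF additive_tensor_lift[OF outer]])
  qed
  show "biadditive (tensor_map2 f g)"
    unfolding biadditive_def using right
    by (simp add: tensor_map2_def tensor_lift_add[OF outer])
qed

lemma biadditive_mult: "biadditive ((*) :: 'a :: ring \<Rightarrow> 'a \<Rightarrow> 'a)"
  by (simp add: biadditive_def distrib_left distrib_right)

lemma pure_tensor_balanced_rat: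
  fixes s :: "'e :: field_char_0 \<Rightarrow> 'v :: ab_group_add \<Rightarrow> 'v" and z :: "'c :: field_char_0"
  assumes "Modules.module s"
  shows "s (of_rat q) v \<otimes>\<^sub>t z = v \<otimes>\<^sub>t (of_rat q * z)"
proof -
  interpret s: Modules.module s by fact
  have nat: "s (of_nat n) v \<otimes>\<^sub>t z = v \<otimes>\<^sub>t (of_nat n * z)" for n v and z :: 'c
    by (induction n)
      (simp_all add: s.scale_left_distrib distrib_right pure_tensor_add_left pure_tensor_add_right
        pure_tensor_left.zero pure_tensor_right.zero)
  have int: "s (of_int n) v \<otimes>\<^sub>t z = v \<otimes>\<^sub>t (of_int n * z)" for n v and z :: 'c
    by (cases n rule: int_cases2)
      (simp_all add: nat pure_tensor_left.minus pure_tensor_right.minus)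
  obtain a b where q: "q = of_int a / of_int b" and b: "b > 0"
    by (metis quotient_of_div quotient_of_denom_pos surj_pair)
  have v: "v = s (of_int b) (s (1 / of_int b) v)" and z: "of_int b * (z / of_int b) = z"
    using b by simp_all
  have "s (of_rat q) v \<otimes>\<^sub>t z = s (of_int a) (s (1 / of_int b) v) \<otimes>\<^sub>t (of_int b * (z / of_int b))"
    unfolding z by (simp add: q of_rat_divide)
  also have "\<dots> = s (of_int b) (s (of_int a) (s (1 / of_int b) v)) \<otimes>\<^sub>t (z / of_int b)"
    by (rule int[symmetric])
  also have "s (of_int b) (s (of_int a) (s (1 / of_int b) v)) = s (of_int a) v"
    using b by simp
  also have "s (of_int a) v \<otimes>\<^sub>t (z / of_int b) = v \<otimes>\<^sub>t (of_rat q * z)"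
    by (simp add: int q of_rat_divide)
  finally show ?thesis .
qed

instantiation tensor :: (field_char_0, field_char_0) comm_ring_1
begin

definition times_tensor :: "('a, 'b) tensor \<Rightarrow> ('a, 'b) tensor \<Rightarrow> ('a, 'b) tensor" where
  "times_tensor = tensor_map2 (*) (*)"

definition one_tensor :: "('a, 'b) tensor" where
  "one_tensor = 1 \<otimes>\<^sub>t 1"

instance
proof
  fix a b c :: "('a, 'b) tensor"
  have bi: "biadditive (times :: ('a, 'b) tensor \<Rightarrow> _)"
    unfolding times_tensor_def by (intro biadditive_tensor_map2 biadditive_mult)
  have mulp: "(p \<otimes>\<^sub>t q) * (r \<otimes>\<^sub>t s) = (p * r) \<otimes>\<^sub>t (q * s)" for p r :: 'a and q s :: 'b
    unfolding times_tensor_def by (intro tensor_map2_pure biadditive_mult)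
  show dr: "(a + b) * c = a * c + b * c" for a b c :: "('a, 'b) tensor"
    using bi by (simp add: biadditive_def)
  have dl: "c * (a + b) = c * a + c * b" for a b c :: "('a, 'b) tensor"
    using bi by (simp add: biadditive_def)
  have diff_r: "(a - b) * c = a * c - b * c" for a b c :: "('a, 'b) tensor"
    by (metis dr add_diff_cancel diff_add_cancel)
  have diff_l: "c * (a - b) = c * a - c * b" for a b c :: "('a, 'b) tensor"
    by (metis dl add_diff_cancel diff_add_cancel)
  show "a * b = b * a"
  proof (induction a rule: tensor_induct)
    case (pure x y)
    then show ?case
      by (induction b rule: tensor_induct) (simp_all add: diff_r diff_l mulp mult.commute)
  qed (simp_all add: diff_r diff_l)
  show "a * b * c = a * (b * c)"
  proof (induction a rule: tensor_induct)
    case a: (pure x y)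
    show ?case
    proof (induction b rule: tensor_induct)
      case (pure z w)
      show ?case
        by (induction c rule: tensor_induct)
          (simp_all add: diff_r diff_l mulp mult.assoc)
    qed (simp_all add: diff_r diff_l)
  qed (simp_all add: diff_r diff_l)
  show "1 * a = a"
    by (induction a rule: tensor_induct) (simp_all add: one_tensor_def mulp diff_l)
  interpret vs: vector_space_pair "\<lambda>q x. of_rat q * (x :: 'a)" "(*) :: rat \<Rightarrow> rat \<Rightarrow> rat"
    by unfold_locales (simp_all add: algebra_simps of_rat_add of_rat_mult)
  have "vs.vs1.independent {1 :: 'a}" by simp
  then obtain g :: "'a \<Rightarrow> rat"
    where g: "Vector_Spaces.linear (\<lambda>q x. of_rat q * (x :: 'a)) (*) g" and g1: "g 1 = 1"
    using vs.linear_independent_extend[of "{1}" "\<lambda>_. 1"] by auto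
  interpret g: Vector_Spaces.linear "\<lambda>q x. of_rat q * (x :: 'a)" "(*)" g by (rule g)
  have f: "biadditive (\<lambda>(x :: 'a) (y :: 'b). of_rat (g x) * y)"
    by (simp add: biadditive_def g.add of_rat_add algebra_simps)
  have "tensor_lift (\<lambda>(x :: 'a) (y :: 'b). of_rat (g x) * y) 1 = 1"
    by (simp add: one_tensor_def f g1)
  moreover have "tensor_lift (\<lambda>(x :: 'a) (y :: 'b). of_rat (g x) * y) 0 = 0"
    by (rule additive.zero[OF additive_tensor_lift[OF f]])
  ultimately show "(0 :: ('a, 'b) tensor) \<noteq> 1" by auto
qed

end


section \<open>Linear algebra over a coefficient ring\<close>

definition free_of_rank :: "('k :: comm_ring_1 \<Rightarrow> 'v :: ab_group_add \<Rightarrow> 'v) \<Rightarrow> 'v set \<Rightarrow> nat \<Rightarrow> bool" where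
  "free_of_rank s S n \<longleftrightarrow>
     (\<exists>B. finite B \<and> card B = n \<and> \<not> Modules.module.dependent s B \<and> Modules.module.span s B = S)"

definition free_rank :: "('k :: comm_ring_1 \<Rightarrow> 'v :: ab_group_add \<Rightarrow> 'v) \<Rightarrow> 'v set \<Rightarrow> nat" where
  "free_rank s S = (THE n. free_of_rank s S n)"

definition lincomb :: "('k :: field \<Rightarrow> 'v :: ab_group_add \<Rightarrow> 'v) \<Rightarrow> 'k list \<Rightarrow> 'v list \<Rightarrow> 'v" where
  "lincomb s cs vs = (\<Sum>i<length vs. s (cs ! i) (vs ! i))"

text \<open>The classes of \<open>vs\<close> form an ordered basis of the quotient space \<open>S / F\<close>, for \<open>F \<subseteq> S\<close>.\<close>

definition ordered_basis_mod ::
    "('k :: field \<Rightarrow> 'v :: ab_group_add \<Rightarrow> 'v) \<Rightarrow> 'v set \<Rightarrow> 'v set \<Rightarrow> 'v list \<Rightarrow> bool" where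
  "ordered_basis_mod s S F vs \<longleftrightarrow> set vs \<subseteq> S \<and>
     (\<forall>x\<in>S. \<exists>!cs. length cs = length vs \<and> x - lincomb s cs vs \<in> F)"

abbreviation ordered_basis ::
    "('k :: field \<Rightarrow> 'v :: ab_group_add \<Rightarrow> 'v) \<Rightarrow> 'v set \<Rightarrow> 'v list \<Rightarrow> bool" where
  "ordered_basis s S vs \<equiv> ordered_basis_mod s S {0} vs"

definition finite_dimensional :: "('k :: field \<Rightarrow> 'v :: ab_group_add \<Rightarrow> 'v) \<Rightarrow> bool" where
  "finite_dimensional s \<longleftrightarrow> (\<exists>B. finite B \<and> Modules.module.span s B = UNIV)"

definition number_field :: "'e :: field_char_0 itself \<Rightarrow> bool" where
  "number_field _ \<longleftrightarrow> finite_dimensional (\<lambda>(q :: rat) (x :: 'e). of_rat q * x)"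

text \<open>
  \<open>\<tau>\<close> exhibits \<open>T\<close> as the tensor product of \<open>V\<close> and \<open>W\<close> over the coefficient field: the induced map
  from the quotient of the tensor product over the integers by the balancing relations
  \<open>e v \<otimes> w = v \<otimes> e w\<close> to \<open>T\<close> is an isomorphism.
\<close>

definition is_tensor_product ::
    "('e :: field \<Rightarrow> 'v :: ab_group_add \<Rightarrow> 'v) \<Rightarrow> ('e \<Rightarrow> 'w :: ab_group_add \<Rightarrow> 'w) \<Rightarrow>
       ('e \<Rightarrow> 't :: ab_group_add \<Rightarrow> 't) \<Rightarrow> ('v \<Rightarrow> 'w \<Rightarrow> 't) \<Rightarrow> bool" where
  "is_tensor_product sV sW sT \<tau> \<longleftrightarrow>
     biadditive \<tau> \<and>
     (\<forall>e v w. \<tau> (sV e v) w = sT e (\<tau> v w)) \<and>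
     (\<forall>e v w. \<tau> v (sW e w) = sT e (\<tau> v w)) \<and>
     surj (tensor_lift \<tau>) \<and>
     {x. tensor_lift \<tau> x = 0} = group_closure {sV e v \<otimes>\<^sub>t w - v \<otimes>\<^sub>t sW e w | e v w. True}"

text \<open>
  Extension of scalars from the rationals to the complex numbers: the module structure of
  \<open>V \<otimes> \<complex>\<close> over the ring \<open>\<bbbE> \<otimes> \<complex>\<close>, and the submodule \<open>F \<otimes> \<complex>\<close> for a subspace \<open>F\<close> of \<open>V\<close>.
\<close>

definition scale_complex ::
    "('e :: field_char_0 \<Rightarrow> 'v :: ab_group_add \<Rightarrow> 'v) \<Rightarrow>
       ('e, complex) tensor \<Rightarrow> ('v, complex) tensor \<Rightarrow> ('v, complex) tensor" where
  "scale_complex s = tensor_map2 s (*)"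

definition subspace_complex ::
    "('e :: field_char_0 \<Rightarrow> 'v :: ab_group_add \<Rightarrow> 'v) \<Rightarrow> 'v set \<Rightarrow> ('v, complex) tensor set" where
  "subspace_complex s F = Modules.module.span (scale_complex s) ((\<lambda>v. v \<otimes>\<^sub>t 1) ` F)"


section \<open>Pure motives through their realizations\<close>

text \<open>
  A motive over the rationals with coefficients in the number field \<open>'e\<close> enters through its system
  of realizations: the Betti realization \<open>'b\<close> with its involution and Hodge decomposition, the
  de Rham realization \<open>'r\<close> with its Hodge filtration, and the comparison isomorphism.
\<close>

record (overloaded) ('e, 'b, 'r) motive =
  weight :: int
  betti_scale :: "'e :: field_char_0 \<Rightarrow> 'b :: ab_group_add \<Rightarrow> 'b"
  rho :: "'b \<Rightarrow> 'b"
  hodge :: "int \<Rightarrow> int \<Rightarrow> ('b, complex) tensor set"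
  dr_scale :: "'e \<Rightarrow> 'r :: ab_group_add \<Rightarrow> 'r"
  fil :: "int \<Rightarrow> 'r set"
  comparison :: "('b, complex) tensor \<Rightarrow> ('r, complex) tensor"

type_synonym 'e coeff = "('e, complex) tensor"

definition betti_scale_complex ::
    "('e :: field_char_0, 'b :: ab_group_add, 'r :: ab_group_add) motive \<Rightarrow>
       'e coeff \<Rightarrow> ('b, complex) tensor \<Rightarrow> ('b, complex) tensor" where
  "betti_scale_complex M = scale_complex (betti_scale M)"

definition dr_scale_complex ::
    "('e :: field_char_0, 'b :: ab_group_add, 'r :: ab_group_add) motive \<Rightarrow>
       'e coeff \<Rightarrow> ('r, complex) tensor \<Rightarrow> ('r, complex) tensor" where
  "dr_scale_complex M = scale_complex (dr_scale M)"

definition rho_complex ::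
    "('e :: field_char_0, 'b :: ab_group_add, 'r :: ab_group_add) motive \<Rightarrow>
       ('b, complex) tensor \<Rightarrow> ('b, complex) tensor" where
  "rho_complex M = tensor_map (rho M) id"

definition fil_complex ::
    "('e :: field_char_0, 'b :: ab_group_add, 'r :: ab_group_add) motive \<Rightarrow>
       int \<Rightarrow> ('r, complex) tensor set" where
  "fil_complex M p = subspace_complex (dr_scale M) (fil M p)"

definition hodge_decomposition ::
    "('e :: field_char_0, 'b :: ab_group_add, 'r :: ab_group_add) motive \<Rightarrow> bool" where
  "hodge_decomposition M \<longleftrightarrow>
     (\<forall>p q. p + q \<noteq> weight M \<longrightarrow> hodge M p q = {0}) \<and>
     (\<forall>p q. \<exists>n. free_of_rank (betti_scale_complex M) (hodge M p q) n) \<and>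
     (\<forall>x. \<exists>!f. finite {p. f p \<noteq> 0} \<and> (\<forall>p. f p \<in> hodge M p (weight M - p)) \<and>
        x = (\<Sum>p | f p \<noteq> 0. f p)) \<and>
     (\<forall>p q. rho_complex M ` hodge M p q = hodge M q p)"

definition pure_motive ::
    "('e :: field_char_0, 'b :: ab_group_add, 'r :: ab_group_add) motive \<Rightarrow> bool" where
  "pure_motive M \<longleftrightarrow>
     vector_space (betti_scale M) \<and> finite_dimensional (betti_scale M) \<and>
     Vector_Spaces.linear (betti_scale M) (betti_scale M) (rho M) \<and> (\<forall>x. rho M (rho M x) = x) \<and>
     hodge_decomposition M \<and>
     vector_space (dr_scale M) \<and> finite_dimensional (dr_scale M) \<and>
     (\<forall>p. Modules.module.subspace (dr_scale M) (fil M p)) \<and> antimono (fil M) \<and>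
     Modules.module_hom (betti_scale_complex M) (dr_scale_complex M) (comparison M) \<and>
     bij (comparison M) \<and>
     (\<forall>p. comparison M `
          Modules.module.span (betti_scale_complex M) (\<Union>p'\<in>{p..}. \<Union>q. hodge M p' q) =
        fil_complex M p)"

definition rank :: "('e :: field_char_0, 'b :: ab_group_add, 'r :: ab_group_add) motive \<Rightarrow> nat" where
  "rank M = vector_space.dim (betti_scale M) (UNIV :: 'b set)"

definition hodge_number ::
    "('e :: field_char_0, 'b :: ab_group_add, 'r :: ab_group_add) motive \<Rightarrow> int \<Rightarrow> int \<Rightarrow> nat" where
  "hodge_number M p q = free_rank (betti_scale_complex M) (hodge M p q)"

text \<open>Signs \<open>\<plusminus>\<close> are the integers \<open>1\<close> and \<open>-1\<close>.\<close>

definition betti_part ::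
    "('e :: field_char_0, 'b :: ab_group_add, 'r :: ab_group_add) motive \<Rightarrow> int \<Rightarrow> 'b set" where
  "betti_part M s = {x. rho M x = betti_scale M (of_int s) x}"

definition betti_part_dim ::
    "('e :: field_char_0, 'b :: ab_group_add, 'r :: ab_group_add) motive \<Rightarrow> int \<Rightarrow> nat" where
  "betti_part_dim M s = vector_space.dim (betti_scale M) (betti_part M s)"

text \<open>
  \<open>is_fil_step M s F\<close>: the subspace \<open>F\<close> is the filtration step \<open>F\<^sup>s(M)\<close>. Its codimension is
  governed by the opposite sign.
\<close>

definition is_fil_step ::
    "('e :: field_char_0, 'b :: ab_group_add, 'r :: ab_group_add) motive \<Rightarrow> int \<Rightarrow> 'r set \<Rightarrow> bool" where
  "is_fil_step M s F \<longleftrightarrow> F \<in> range (fil M) \<and>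
     (\<exists>ws. ordered_basis_mod (dr_scale M) UNIV F ws \<and> length ws = betti_part_dim M (- s))"

definition critical ::
    "('e :: field_char_0, 'b :: ab_group_add, 'r :: ab_group_add) motive \<Rightarrow> bool" where
  "critical M \<longleftrightarrow> (\<exists>F. is_fil_step M 1 F) \<and> (\<exists>F. is_fil_step M (-1) F)"

text \<open>
  The scalar by which \<open>\<rho>\<close> acts on the middle Hodge type; meaningful when that type is nonzero and
  \<open>\<rho>\<close> does act on it by a sign.
\<close>

definition middle_sign ::
    "('e :: field_char_0, 'b :: ab_group_add, 'r :: ab_group_add) motive \<Rightarrow> int" where
  "middle_sign M = (THE s. s \<in> {1, -1} \<and>
     (\<forall>p. 2 * p = weight M \<longrightarrow>
        (\<forall>x\<in>hodge M p p. rho_complex M x = betti_scale_complex M (of_int s) x)))"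

text \<open>
  \<open>A\<close> is the matrix, in bases rational over the coefficient field, of the composite
  \<open>H\<^sub>B\<^sup>s(M) \<otimes> \<complex> \<rightarrow> H\<^sub>D\<^sub>R(M) \<otimes> \<complex> \<rightarrow> (H\<^sub>D\<^sub>R(M) / F) \<otimes> \<complex>\<close>, where \<open>F\<close> is the filtration step of the opposite
  sign; its entries are read off modulo \<open>F \<otimes> \<complex>\<close>.
\<close>

definition is_period_matrix ::
    "('e :: field_char_0, 'b :: ab_group_add, 'r :: ab_group_add) motive \<Rightarrow> int \<Rightarrow>
       'e coeff mat \<Rightarrow> bool" where
  "is_period_matrix M s A \<longleftrightarrow>
     (\<exists>F vs ws. is_fil_step M (- s) F \<and>
        ordered_basis (betti_scale M) (betti_part M s) vs \<and>
        ordered_basis_mod (dr_scale M) UNIV F ws \<and>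
        A \<in> carrier_mat (length ws) (length vs) \<and>
        (\<forall>j<length vs.
           comparison M (vs ! j \<otimes>\<^sub>t 1) -
             (\<Sum>i<length ws. dr_scale_complex M (A $$ (i, j)) (ws ! i \<otimes>\<^sub>t 1))
           \<in> subspace_complex (dr_scale M) F))"

definition coeff_units :: "'e :: field_char_0 coeff monoid" where
  "coeff_units = \<lparr>carrier = {u. u dvd 1}, monoid.mult = (*), one = 1\<rparr>"

definition rational_units :: "'e :: field_char_0 coeff set" where
  "rational_units = {e \<otimes>\<^sub>t 1 | e. e \<noteq> 0}"

definition period_group :: "'e :: field_char_0 coeff set monoid" where
  "period_group = coeff_units Mod rational_units"

text \<open>
  Deligne's period \<open>c\<^sup>s(M)\<close>, as a coset of the unit group of the coefficient field: the union of the
  classes of all period determinants. It is a single coset, since changing rational bases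
  multiplies the determinant by a nonzero element of the coefficient field.
\<close>

definition deligne_period ::
    "('e :: field_char_0, 'b :: ab_group_add, 'r :: ab_group_add) motive \<Rightarrow> int \<Rightarrow> 'e coeff set" where
  "deligne_period M s = (\<Union>A\<in>{A. is_period_matrix M s A}. rational_units #>\<^bsub>coeff_units\<^esub> det A)"

text \<open>
  \<open>N\<close> is the tensor product of \<open>M\<close> and \<open>M'\<close>: its realizations are, through \<open>\<beta>\<close> and \<open>\<delta>\<close>, the tensor
  products over the coefficient field of the realizations of \<open>M\<close> and \<open>M'\<close>.
\<close>

definition is_tensor_motive ::
    "('e :: field_char_0, 'b :: ab_group_add, 'r :: ab_group_add) motive \<Rightarrow>
       ('e, 'b' :: ab_group_add, 'r' :: ab_group_add) motive \<Rightarrow>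
       ('e, 'b'' :: ab_group_add, 'r'' :: ab_group_add) motive \<Rightarrow> bool" where
  "is_tensor_motive M M' N \<longleftrightarrow>
     pure_motive N \<and>
     weight N = weight M + weight M' \<and>
     (\<exists>(\<beta> :: 'b \<Rightarrow> 'b' \<Rightarrow> 'b'') (\<delta> :: 'r \<Rightarrow> 'r' \<Rightarrow> 'r'').
        is_tensor_product (betti_scale M) (betti_scale M') (betti_scale N) \<beta> \<and>
        is_tensor_product (dr_scale M) (dr_scale M') (dr_scale N) \<delta> \<and>
        (\<forall>x y. rho N (\<beta> x y) = \<beta> (rho M x) (rho M' y)) \<and>
        (\<forall>p q. hodge N p q = Modules.module.span (betti_scale_complex N)
           {tensor_map2 \<beta> (*) x y | x y a b. x \<in> hodge M a b \<and> y \<in> hodge M' (p - a) (q - b)}) \<and>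
        (\<forall>p. fil N p = Modules.module.span (dr_scale N)
           {\<delta> x y | x y a. x \<in> fil M a \<and> y \<in> fil M' (p - a)}) \<and>
        (\<forall>x y. comparison N (tensor_map2 \<beta> (*) x y) =
           tensor_map2 \<delta> (*) (comparison M x) (comparison M' y)))"

end

theory Submission
  imports Defs
begin

text \<open>
  For one motive \<open>X\<close>, choose a basis \<open>e\<^sub>h\<close> of \<open>H\<^sub>B \<otimes> \<complex>\<close> adapted to the Hodge decomposition with
  \<open>\<rho> e\<^sub>h = eps e\<^bsub>\<iota> h\<^esub>\<close>, where the involution \<open>\<iota>\<close> reverses Hodge types and fixes only the middle
  index, and normalize the middle vector to be rational modulo \<open>F\<^sup>>\<close>. Since \<open>\<rho>\<close> has rational trace,
  \<open>eps\<close> is a sign, and \<open>d\<^sup>eps = d\<^bsup>-eps\<^esup> + 1\<close>. A vector of \<open>H\<^sub>B\<^sup>s \<otimes> \<complex>\<close> is determined by its coordinates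
  at the indices above the middle (and the middle one if \<open>s = eps\<close>); let \<open>P\<^sub>s\<close> be the matrix of these
  coordinates for a rational basis of \<open>H\<^sub>B\<^sup>s\<close>. Folding the period matrix along \<open>\<iota>\<close> gives
  \<open>c\<^sup>s = b det P\<^sub>s\<close> up to rational factors, with the same unit \<open>b\<close> for both signs, so only
  \<open>det P\<^sub>eps / det P\<^bsub>-eps\<^esub>\<close> matters.

  Criticality of \<open>M \<otimes> M'\<close> says that \<open>(mid, mid')\<close> is the only pair of indices of middle type, so the
  same applies to the basis \<open>e\<^sub>h \<otimes> e'\<^sub>k\<close>. With respect to products of rational bases its minor
  of sign \<open>t\<close> is an integer matrix times the direct sum of the Kronecker products \<open>P\<^sub>s \<otimes> P'\<^sub>u\<close>
  over \<open>s u = t\<close>. Hence the ratio of the minors of signs \<open>eps eps'\<close> and \<open>- eps eps'\<close> is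
  multiplicative, because \<open>d\<^sup>eps - d\<^bsup>-eps\<^esup> = 1\<close>; in terms of the signs \<open>\<plusminus>1\<close> this is the theorem.
\<close>

section \<open>Determinants over finite index sets\<close>

text \<open>The obstacle is that E \<otimes> \<complex>, for the coefficient field E, is in general
  not a domain: k * k = 1 does not make k a sign, a nonzero vector need not generate freely, and
  dimension theory over fields does not apply. Traces replace it: they give ranks in characteristic
  zero, and they show that \<rho> acts on the middle line by an integer. Units are certified by
  inverse matrices. Moreover, a matrix over E has nonzero determinant as soon as that determinant is
  a unit of E \<otimes> \<complex>, so correction factors such as the integer matrix of the overview
  are never evaluated. The normalization of the middle vector is what makes b common to both signs.
  The two quotients of H_DR differ by the line F^m / F^(m+1); if the middle Hodge vector is
  congruent to a vector of H_DR there, the additional row and column contribute only a factor from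
  E. Otherwise the scale of that vector, which has no reason to lie in E, would enter the ratio.
  Products of Hodge bases are again of the same shape, so the argument for one motive is made over
  abstract index sets and serves M, M' and the product alike.\<close>

definition det_on :: "'i set \<Rightarrow> ('i \<Rightarrow> 'i \<Rightarrow> 'a :: comm_ring_1) \<Rightarrow> 'a" where
  "det_on I A = (let f = (SOME f. bij_betw f {0..<card I} I)
     in det (mat (card I) (card I) (\<lambda>(i, j). A (f i) (f j))))"

text \<open>The sign of \<open>p\<close> enters once through the rows and once through the columns,
  so it squares to one.\<close>

lemma det_permute_rows_cols:
  fixes A :: "nat \<Rightarrow> nat \<Rightarrow> 'a :: comm_ring_1"
  assumes p: "p permutes {0..<n}"
  shows "det (mat n n (\<lambda>(i, j). A (p i) (p j))) = det (mat n n (\<lambda>(i, j). A i j))"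
proof -
  have p_less: "p i < n" if "i < n" for i
    using permutes_in_image[OF p, of i] that by simp
  define B where "B = mat n n (\<lambda>(i, j). A i (p j))"
  have B: "B \<in> carrier_mat n n" by (simp add: B_def)
  have 1: "mat n n (\<lambda>(i, j). A (p i) (p j)) = mat n n (\<lambda>(i, j). B $$ (p i, j))"
    by (rule eq_matI) (auto simp: B_def p_less)
  define D where "D = transpose_mat (mat n n (\<lambda>(i, j). A i j))"
  have D: "D \<in> carrier_mat n n" by (simp add: D_def)
  have 2: "transpose_mat B = mat n n (\<lambda>(i, j). D $$ (p i, j))"
    by (rule eq_matI) (auto simp: B_def D_def p_less)
  have "det B = signof p * det D"
    by (metis 2 B D det_permute_rows det_transpose p)
  moreover have "det D = det (mat n n (\<lambda>(i, j). A i j))"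
    unfolding D_def by (rule det_transpose[of _ n]) simp
  ultimately show ?thesis
    unfolding 1 det_permute_rows[OF B p] by (simp add: sign_def)
qed

text \<open>Hodge types, and pairs of them, have no preferred order. Since rows and columns share
  one index set, two enumerations differ by a simultaneous permutation of both, so the one picked by
  \<open>SOME\<close> is immaterial.\<close>

lemma det_on_enum:
  assumes f: "bij_betw f {0..<n} I"
  shows "det_on I A = det (mat n n (\<lambda>(i, j). A (f i) (f j)))"
proof -
  have n: "card I = n" using bij_betw_same_card[OF f] by simp
  define g where "g = (SOME f. bij_betw f {0..<n} I)"
  have g: "bij_betw g {0..<n} I"
    unfolding g_def by (rule someI[of _ f]) (rule f)
  define p where "p i = (if i \<in> {0..<n} then inv_into {0..<n} f (g i) else i)" for i
  have "bij_betw p {0..<n} {0..<n}"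
    using bij_betw_trans[OF g bij_betw_inv_into[OF f]]
    by (subst bij_betw_cong[where g = "inv_into {0..<n} f \<circ> g"]) (auto simp: p_def)
  then have p: "p permutes {0..<n}"
    by (rule bij_imp_permutes) (auto simp: p_def)
  have fp: "f (p i) = g i" if "i < n" for i
    using that g f by (auto simp: p_def bij_betw_def intro!: f_inv_into_f)
  have "det_on I A = det (mat n n (\<lambda>(i, j). A (g i) (g j)))"
    by (simp add: det_on_def n g_def Let_def)
  also have "mat n n (\<lambda>(i, j). A (g i) (g j)) = mat n n (\<lambda>(i, j). A (f (p i)) (f (p j)))"
    by (rule eq_matI) (auto simp: fp)
  also have "det \<dots> = det (mat n n (\<lambda>(i, j). A (f i) (f j)))"
    by (rule det_permute_rows_cols[OF p, of "\<lambda>i j. A (f i) (f j)"])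
  finally show ?thesis .
qed

lemma det_on_reindex:
  assumes f: "bij_betw f I J" and I: "finite I"
  shows "det_on J A = det_on I (\<lambda>i j. A (f i) (f j))"
proof -
  obtain g where g: "bij_betw g {0..<card I} I" using ex_bij_betw_nat_finite[OF I] by blast
  show ?thesis
    using det_on_enum[OF bij_betw_trans[OF g f], of A] det_on_enum[OF g, of "\<lambda>i j. A (f i) (f j)"] by simp
qed

lemma det_on_cong:
  assumes "finite I" "\<And>i j. i \<in> I \<Longrightarrow> j \<in> I \<Longrightarrow> A i j = B i j"
  shows "det_on I A = det_on I B"
proof -
  obtain g where g: "bij_betw g {0..<card I} I" using ex_bij_betw_nat_finite[OF assms(1)] by blast
  have "mat (card I) (card I) (\<lambda>(i, j). A (g i) (g j)) = mat (card I) (card I) (\<lambda>(i, j). B (g i) (g j))"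
    using g by (intro eq_matI) (auto simp: bij_betw_def intro!: assms(2))
  then show ?thesis unfolding det_on_enum[OF g] by simp
qed

lemma det_on_mult:
  assumes I: "finite I"
  shows "det_on I (\<lambda>i j. \<Sum>k\<in>I. A i k * B k j) = det_on I A * det_on I B"
proof -
  obtain g where g: "bij_betw g {0..<card I} I" using ex_bij_betw_nat_finite[OF I] by blast
  have "(\<Sum>k\<in>I. A i k * B k j) = (\<Sum>k\<in>{0..<card I}. A i (g k) * B (g k) j)" for i j
    by (rule sum.reindex_bij_betw[OF g, symmetric])
  then have "mat (card I) (card I) (\<lambda>(i, j). \<Sum>k\<in>I. A (g i) k * B k (g j)) =
     mat (card I) (card I) (\<lambda>(i, j). A (g i) (g j)) * mat (card I) (card I) (\<lambda>(i, j). B (g i) (g j))"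
    by (intro eq_matI) (auto simp: scalar_prod_def)
  then show ?thesis
    unfolding det_on_enum[OF g] by (simp add: det_mult[of _ "card I"])
qed

lemma det_on_one:
  assumes I: "finite I" "\<And>i j. i \<in> I \<Longrightarrow> j \<in> I \<Longrightarrow> A i j = (if i = j then 1 else 0)"
  shows "det_on I A = 1"
proof -
  obtain g where g: "bij_betw g {0..<card I} I" using ex_bij_betw_nat_finite[OF I(1)] by blast
  have "A (g i) (g j) = (if i = j then 1 else 0)" if "i < card I" "j < card I" for i j
    using g that by (subst I(2)) (auto simp: bij_betw_def inj_on_def)
  then have "mat (card I) (card I) (\<lambda>(i, j). A (g i) (g j)) = 1\<^sub>m (card I)"
    by (intro eq_matI) auto
  then show ?thesis unfolding det_on_enum[OF g] by simp
qed

lemma det_on_empty [simp]: "det_on {} A = 1"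
  by (rule det_on_one) auto

text \<open>Over a ring with zero divisors invertibility cannot be tested by nonvanishing. A
  one-sided inverse matrix suffices, because the determinant is multiplicative.\<close>

lemma det_on_dvd_one:
  assumes I: "finite I"
    and "\<And>i j. i \<in> I \<Longrightarrow> j \<in> I \<Longrightarrow> (\<Sum>k\<in>I. A i k * B k j) = (if i = j then 1 else 0)"
  shows "det_on I A dvd 1"
proof -
  have "det_on I A * det_on I B = 1"
    unfolding det_on_mult[OF I, symmetric] by (rule det_on_one[OF I]) (rule assms(2))
  then show ?thesis by (metis dvd_triv_left)
qed

lemma (in comm_ring_hom) hom_det_on:
  assumes "finite I"
  shows "hom (det_on I A) = det_on I (\<lambda>i j. hom (A i j))"
proof -
  obtain g where g: "bij_betw g {0..<card I} I" using ex_bij_betw_nat_finite[OF assms] by blast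
  have "map_mat hom (mat (card I) (card I) (\<lambda>(i, j). A (g i) (g j))) =
    mat (card I) (card I) (\<lambda>(i, j). hom (A (g i) (g j)))"
    by (rule eq_matI) auto
  then show ?thesis unfolding det_on_enum[OF g] hom_det[symmetric] by simp
qed

lemma det_on_scale:
  assumes I: "finite I"
  shows "det_on I (\<lambda>i j. c * A i j) = c ^ card I * det_on I A"
proof -
  obtain g where g: "bij_betw g {0..<card I} I" using ex_bij_betw_nat_finite[OF I] by blast
  have "mat (card I) (card I) (\<lambda>(i, j). c * A (g i) (g j)) =
    c \<cdot>\<^sub>m mat (card I) (card I) (\<lambda>(i, j). A (g i) (g j))"
    by (rule eq_matI) auto
  then show ?thesis unfolding det_on_enum[OF g] by simp
qed

lemma det_on_insert:
  assumes I: "finite I" "x \<notin> I" and 0: "\<And>i. i \<in> I \<Longrightarrow> A i x = 0"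
  shows "det_on (insert x I) A = det_on I A * A x x"
proof -
  let ?n = "card I"
  obtain g where g: "bij_betw g {0..<?n} I" using ex_bij_betw_nat_finite[OF I(1)] by blast
  define h where "h i = (if i < ?n then g i else x)" for i
  have "bij_betw h {0..<?n} I"
    using g by (subst bij_betw_cong[where g = g]) (auto simp: h_def)
  moreover have "bij_betw h {?n} {x}" by (simp add: h_def bij_betw_def)
  ultimately have "bij_betw h ({0..<?n} \<union> {?n}) (I \<union> {x})"
    by (rule bij_betw_combine) (use I in auto)
  moreover have "{0..<?n} \<union> {?n} = {0..<Suc ?n}" by auto
  ultimately have h: "bij_betw h {0..<Suc ?n} (insert x I)" by simp
  have gI: "g i \<in> I" if "i < ?n" for i using g that by (auto simp: bij_betw_def)
  have eq: "mat (Suc ?n) (Suc ?n) (\<lambda>(i, j). A (h i) (h j)) =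
    four_block_mat (mat ?n ?n (\<lambda>(i, j). A (g i) (g j))) (0\<^sub>m ?n 1)
      (mat 1 ?n (\<lambda>(i, j). A x (g j))) (mat 1 1 (\<lambda>(i, j). A x x))"
    by (rule eq_matI) (auto simp: h_def 0 gI)
  show ?thesis
    unfolding det_on_enum[OF h] det_on_enum[OF g] eq
    by (subst det_four_block_mat_upper_right_zero_col[of _ ?n]) (auto simp: det_single)
qed

lemma det_on_union:
  assumes I: "finite I" and J: "finite J" and IJ: "I \<inter> J = {}"
    and 0: "\<And>i j. i \<in> I \<Longrightarrow> j \<in> J \<Longrightarrow> A i j = 0" "\<And>i j. i \<in> I \<Longrightarrow> j \<in> J \<Longrightarrow> A j i = 0"
  shows "det_on (I \<union> J) A = det_on I A * det_on J A"
proof -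
  \<comment> \<open>\<open>E S\<close> is \<open>A\<close> on the block \<open>S\<close> and the
    identity elsewhere. A block diagonal \<open>A\<close> is the product of \<open>E I\<close> and
    \<open>E J\<close>, so no enumeration compatible with the blocks is needed.\<close>
  define E where "E S i j = (if i \<in> S \<and> j \<in> S then A i j else if i = j then 1 else 0)" for S i j
  have E: "det_on (S \<union> T) (E S) = det_on S A" if "finite S" "finite T" "S \<inter> T = {}" for S T
    using that(2,3)
  proof (induction T)
    case empty
    show ?case unfolding Un_empty_right by (rule det_on_cong) (auto simp: that(1) E_def)
  next
    case (insert x T)
    then have "det_on (insert x (S \<union> T)) (E S) = det_on (S \<union> T) (E S) * E S x x"
      by (intro det_on_insert) (auto simp: E_def that(1))
    moreover have "E S x x = 1" using insert by (simp add: E_def)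
    ultimately show ?case using insert by simp
  qed
  have "det_on (I \<union> J) A = det_on (I \<union> J) (\<lambda>i j. \<Sum>k\<in>I \<union> J. E I i k * E J k j)"
  proof (rule det_on_cong)
    fix i j assume ij: "i \<in> I \<union> J" "j \<in> I \<union> J"
    show "A i j = (\<Sum>k\<in>I \<union> J. E I i k * E J k j)"
    proof (cases "i \<in> I")
      case True
      then have "i \<notin> J" using IJ by auto
      have "(\<Sum>k\<in>I \<union> J. E I i k * E J k j) = (\<Sum>k\<in>I \<union> J. if k = j then E I i j * E J j j else 0)"
        using True IJ \<open>i \<notin> J\<close> by (intro sum.cong) (auto simp: E_def)
      also have "\<dots> = A i j" using True ij IJ 0 I J by (auto simp: E_def)
      finally show ?thesis by simp
    next
      case False
      then have "(\<Sum>k\<in>I \<union> J. E I i k * E J k j) = (\<Sum>k\<in>I \<union> J. if k = i then E J i j else 0)"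
        by (intro sum.cong) (auto simp: E_def)
      also have "\<dots> = A i j" using False ij IJ 0 I J by (auto simp: E_def)
      finally show ?thesis by simp
    qed
  qed (use I J in auto)
  also have "\<dots> = det_on (I \<union> J) (E I) * det_on (I \<union> J) (E J)"
    using I J by (intro det_on_mult) auto
  also have "det_on (I \<union> J) (E I) = det_on I A" by (intro E I J IJ)
  also have "det_on (I \<union> J) (E J) = det_on J A" using E[OF J I] IJ by (simp add: Un_commute Int_commute)
  finally show ?thesis .
qed

lemma det_on_kronecker_one:
  assumes I: "finite I" and J: "finite J"
  shows "det_on (I \<times> J) (\<lambda>p q. A (fst p) (fst q) * (if snd p = snd q then 1 else 0)) = det_on I A ^ card J"
  using J
proof (induction J)
  case empty
  show ?case by simp
next
  case (insert x J)
  let ?K = "\<lambda>p q. A (fst p) (fst q) * (if snd p = snd q then 1 else 0)"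
  have eq: "I \<times> insert x J = (\<lambda>i. (i, x)) ` I \<union> I \<times> J" by auto
  have "det_on (I \<times> insert x J) ?K = det_on ((\<lambda>i. (i, x)) ` I) ?K * det_on (I \<times> J) ?K"
    unfolding eq using insert I by (intro det_on_union) auto
  also have "det_on ((\<lambda>i. (i, x)) ` I) ?K = det_on I A"
    by (subst det_on_reindex[of "\<lambda>i. (i, x)" I]) (auto simp: bij_betw_def inj_on_def I)
  finally show ?case using insert by simp
qed

text \<open>A \<otimes> B = (A \<otimes> 1)(1 \<otimes> B), and each factor is, up to reindexing,
  block diagonal with equal blocks, as many as the other index set has elements.\<close>

lemma det_on_kronecker:
  assumes I: "finite I" and J: "finite J"
  shows "det_on (I \<times> J) (\<lambda>p q. A (fst p) (fst q) * B (snd p) (snd q)) = det_on I A ^ card J * det_on J B ^ card I"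
proof -
  let ?A = "\<lambda>p q. A (fst p) (fst q) * (if snd p = snd q then 1 else 0)"
  let ?B = "\<lambda>p q. B (snd p) (snd q) * (if fst p = fst q then 1 else 0)"
  have "det_on (I \<times> J) (\<lambda>p q. A (fst p) (fst q) * B (snd p) (snd q)) =
    det_on (I \<times> J) (\<lambda>p q. \<Sum>r\<in>I \<times> J. ?A p r * ?B r q)"
  proof (rule det_on_cong)
    fix p q assume "p \<in> I \<times> J" "q \<in> I \<times> J"
    then have mem: "(fst q, snd p) \<in> I \<times> J" by auto
    have "(\<Sum>r\<in>I \<times> J. ?A p r * ?B r q) =
      (\<Sum>r\<in>I \<times> J. if r = (fst q, snd p) then A (fst p) (fst q) * B (snd p) (snd q) else 0)"
      by (rule sum.cong) auto
    also have "\<dots> = A (fst p) (fst q) * B (snd p) (snd q)" using mem I J by simp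
    finally show "A (fst p) (fst q) * B (snd p) (snd q) = (\<Sum>r\<in>I \<times> J. ?A p r * ?B r q)" by simp
  qed (use I J in auto)
  also have "\<dots> = det_on (I \<times> J) ?A * det_on (I \<times> J) ?B" using I J by (intro det_on_mult) auto
  also have "det_on (I \<times> J) ?B = det_on (J \<times> I) (\<lambda>p q. ?B (prod.swap p) (prod.swap q))"
    using I J by (intro det_on_reindex) (auto simp: bij_betw_def product_swap)
  also have "\<dots> = det_on J B ^ card I"
    using det_on_kronecker_one[OF J I, of B] by simp
  finally show ?thesis using det_on_kronecker_one[OF I J, of A] by simp
qed

section \<open>Modules after extension of scalars\<close>

lemma tensor_ext:
  assumes "additive h" "additive k" "\<And>a b. h (a \<otimes>\<^sub>t b) = k (a \<otimes>\<^sub>t b)"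
  shows "h t = k t"
  by (induction t rule: tensor_induct)
    (simp_all add: assms additive.diff[OF assms(1)] additive.diff[OF assms(2)])

lemma biadditive_scale: "Modules.module s \<Longrightarrow> biadditive s"
  by (simp add: biadditive_def module.scale_left_distrib module.scale_right_distrib)

lemma times_pure_tensor:
  fixes p r :: "'a :: field_char_0" and q t :: "'b :: field_char_0"
  shows "(p \<otimes>\<^sub>t q) * (r \<otimes>\<^sub>t t) = (p * r) \<otimes>\<^sub>t (q * t)"
  unfolding times_tensor_def by (intro tensor_map2_pure biadditive_mult)

lemma scale_complex_pure:
  assumes "Modules.module s"
  shows "scale_complex s (e \<otimes>\<^sub>t z) (v \<otimes>\<^sub>t z') = s e v \<otimes>\<^sub>t (z * z')"
  unfolding scale_complex_def by (intro tensor_map2_pure biadditive_mult biadditive_scale assms)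

lemma biadditive_scale_complex: "Modules.module s \<Longrightarrow> biadditive (scale_complex s)"
  unfolding scale_complex_def by (intro biadditive_tensor_map2 biadditive_mult biadditive_scale)

lemma scale_complex_times [simp]: "scale_complex (*) = ((*) :: 'e :: field_char_0 coeff \<Rightarrow> _)"
  by (simp add: scale_complex_def times_tensor_def)

lemma module_mult: "Modules.module ((*) :: 'k :: comm_ring_1 \<Rightarrow> _)"
  by unfold_locales (simp_all add: algebra_simps)

lemma additive_biadditive:
  assumes "biadditive f"
  shows "additive (f a)" "additive (\<lambda>a. f a b)"
  using assms by (auto simp: biadditive_def additive_def)

lemma module_scale_complex:
  assumes s: "Modules.module s"
  shows "Modules.module (scale_complex s)"
proof -
  note bi = biadditive_scale_complex[OF s]
  note left = additive.diff[OF additive_biadditive(2)[OF bi]]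
  note right = additive.diff[OF additive_biadditive(1)[OF bi]]
  interpret s: Modules.module s by fact
  show ?thesis
  proof
    fix a b :: "'a coeff" and x y :: "('b, complex) tensor"
    show "scale_complex s a (x + y) = scale_complex s a x + scale_complex s a y"
      and "scale_complex s (a + b) x = scale_complex s a x + scale_complex s b x"
      using bi by (auto simp: biadditive_def)
    show "scale_complex s 1 x = x"
      by (induction x rule: tensor_induct)
        (simp_all add: one_tensor_def scale_complex_pure[OF s] right)
    show "scale_complex s a (scale_complex s b x) = scale_complex s (a * b) x"
    proof (induction a rule: tensor_induct)
      case a: (pure p q)
      show ?case
      proof (induction b rule: tensor_induct)
        case (pure p' q')
        show ?case
          by (induction x rule: tensor_induct)
            (simp_all add: scale_complex_pure[OF s] right times_pure_tensor mult.assoc)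
      qed (simp_all add: left right right_diff_distrib)
    qed (simp_all add: left left_diff_distrib)
  qed
qed

lemma biadditive_tensor_map:
  assumes "additive f" "additive g"
  shows "biadditive (\<lambda>a b. f a \<otimes>\<^sub>t g b)"
  by (simp add: biadditive_def additive.add[OF assms(1)] additive.add[OF assms(2)]
      pure_tensor_add_left pure_tensor_add_right)

lemma tensor_map_pure:
  assumes "additive f" "additive g"
  shows "tensor_map f g (a \<otimes>\<^sub>t b) = f a \<otimes>\<^sub>t g b"
  unfolding tensor_map_def by (intro tensor_lift_pure biadditive_tensor_map assms)

lemma additive_tensor_map:
  assumes "additive f" "additive g"
  shows "additive (tensor_map f g)"
  unfolding tensor_map_def by (intro additive_tensor_lift biadditive_tensor_map assms)

lemma additive_id: "additive id"
  by (simp add: additive_def)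

lemma additive_module_hom: "Modules.module_hom s s' f \<Longrightarrow> additive f"
  by (simp add: additive_def module_hom.add)

lemma module_hom_tensor_map:
  assumes f: "Modules.module_hom s s' f"
  shows "Modules.module_hom (scale_complex s) (scale_complex s') (tensor_map f id)"
proof -
  interpret f: Modules.module_hom s s' f by fact
  have s: "Modules.module s" and s': "Modules.module s'" by unfold_locales
  note ad = additive_module_hom[OF f]
  note left = additive.diff[OF additive_biadditive(2)[OF biadditive_scale_complex[OF s]]]
    additive.diff[OF additive_biadditive(2)[OF biadditive_scale_complex[OF s']]]
  note right = additive.diff[OF additive_biadditive(1)[OF biadditive_scale_complex[OF s]]]
    additive.diff[OF additive_biadditive(1)[OF biadditive_scale_complex[OF s']]]
  define g where "g = (id :: complex \<Rightarrow> complex)"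
  have g: "additive g" and g_mult: "g (x * y) = x * g y" for x y
    by (simp_all add: g_def additive_def)
  note diff = additive.diff[OF additive_tensor_map[OF ad g]]
  show ?thesis
    unfolding g_def[symmetric]
  proof (intro module_hom.intro module_hom_axioms.intro module_scale_complex s s')
    fix x y
    show "tensor_map f g (x + y) = tensor_map f g x + tensor_map f g y"
      by (rule additive.add[OF additive_tensor_map[OF ad g]])
  next
    fix r x
    show "tensor_map f g (scale_complex s r x) = scale_complex s' r (tensor_map f g x)"
    proof (induction r rule: tensor_induct)
      case (pure a b)
      show ?case
        by (induction x rule: tensor_induct)
          (simp_all add: scale_complex_pure[OF s] scale_complex_pure[OF s']
            tensor_map_pure[OF ad g] right diff f.scale g_mult)
    qed (simp add: left diff)
  qed
qed

lemma comm_ring_hom_pure_tensor_one: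
  "comm_ring_hom (\<lambda>e :: 'e :: field_char_0. e \<otimes>\<^sub>t (1 :: complex))"
proof
  fix x y :: 'e
  show "(x * y) \<otimes>\<^sub>t (1 :: complex) = (x \<otimes>\<^sub>t 1) * (y \<otimes>\<^sub>t 1)"
    by (simp only: times_pure_tensor mult_1_right)
qed (simp_all only: pure_tensor_add_left pure_tensor_left.zero one_tensor_def)

lemma pure_tensor_one_dvd_one:
  "e \<noteq> 0 \<Longrightarrow> (e :: 'e :: field_char_0) \<otimes>\<^sub>t (1 :: complex) dvd 1"
  by (rule dvdI[of _ _ "inverse e \<otimes>\<^sub>t 1"]) (simp add: times_pure_tensor one_tensor_def)

lemma of_int_tensor: "(of_int n :: 'e :: field_char_0 coeff) = of_int n \<otimes>\<^sub>t 1"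
proof -
  have "(of_nat k :: 'e coeff) = of_nat k \<otimes>\<^sub>t 1" for k
    by (induction k) (simp_all add: pure_tensor_left.zero pure_tensor_add_left one_tensor_def)
  then show ?thesis
    by (cases n rule: int_diff_cases) (simp add: pure_tensor_left.diff)
qed

text \<open>Characteristic zero allows integers to be recovered from their images, so that ranks and
  traces computed in E \<otimes> \<complex> can be compared as numbers.\<close>

instance tensor :: (field_char_0, field_char_0) ring_char_0
proof
  have "(of_nat n :: ('a, 'b) tensor) = of_nat n \<otimes>\<^sub>t 1" for n
    by (induction n) (simp_all add: pure_tensor_left.zero pure_tensor_add_left one_tensor_def)
  moreover have "of_nat n \<otimes>\<^sub>t 1 \<noteq> (0 :: ('a, 'b) tensor)" if "n \<noteq> 0" for n
  proof
    assume "of_nat n \<otimes>\<^sub>t 1 = (0 :: ('a, 'b) tensor)"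
    then have "(inverse (of_nat n) \<otimes>\<^sub>t 1) * (of_nat n \<otimes>\<^sub>t 1) = (0 :: ('a, 'b) tensor)"
      by simp
    then show False using that by (simp add: times_pure_tensor one_tensor_def[symmetric])
  qed
  ultimately have *: "(of_nat n :: ('a, 'b) tensor) \<noteq> 0" if "n \<noteq> 0" for n
    using that by simp
  show "inj (of_nat :: nat \<Rightarrow> ('a, 'b) tensor)"
  proof (rule linorder_injI)
    fix m n :: nat assume "m < n"
    then have "(of_nat n :: ('a, 'b) tensor) = of_nat (n - m) + of_nat m"
      by (simp flip: of_nat_add)
    then show "(of_nat m :: ('a, 'b) tensor) \<noteq> of_nat n"
      using *[of "n - m"] \<open>m < n\<close> by simp
  qed
qed

text \<open>Two is a unit of E \<otimes> \<complex>, with inverse 1/2 \<otimes> 1. This separates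
  the two eigenspaces of complex conjugation although the scalars are not a field.\<close>

lemma coeff_module_double_eq_0:
  fixes s :: "'e :: field_char_0 coeff \<Rightarrow> 'v :: ab_group_add \<Rightarrow> 'v" and u :: 'v
  assumes "Modules.module s" "u + u = 0"
  shows "u = 0"
proof -
  interpret Modules.module s by fact
  have "(1 / 2 :: 'e) \<otimes>\<^sub>t (1 :: complex) + (1 / 2) \<otimes>\<^sub>t 1 = 1"
    by (simp add: pure_tensor_left.add[symmetric] one_tensor_def)
  then have "u = s ((1 / 2) \<otimes>\<^sub>t 1 + (1 / 2) \<otimes>\<^sub>t 1) u" by simp
  also have "\<dots> = s ((1 / 2) \<otimes>\<^sub>t 1) (u + u)"
    by (simp only: scale_left_distrib scale_right_distrib)
  finally show ?thesis using assms(2) by simp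
qed

section \<open>Bases of quotients\<close>

text \<open>A basis of the module modulo \<open>F\<close>, given together with coordinate functions
  on the whole module. Taking \<open>F\<close> to be zero, a filtration step, or the opposite
  eigenspace of complex conjugation covers Hodge bases, bases of H_DR / F and bases of H_B^s by one
  notion, which is stable under extension of scalars. \<open>F\<close> is automatically a submodule,
  being the common kernel of the coordinates.\<close>

locale quotient_basis = Modules.module s
  for s :: "'k :: comm_ring_1 \<Rightarrow> 'v :: ab_group_add \<Rightarrow> 'v" +
  fixes F :: "'v set" and I :: "'i set" and b :: "'i \<Rightarrow> 'v" and c :: "'v \<Rightarrow> 'i \<Rightarrow> 'k"
  assumes finite_index: "finite I"
    and coord_add: "i \<in> I \<Longrightarrow> c (x + y) i = c x i + c y i"
    and coord_scale: "i \<in> I \<Longrightarrow> c (s r x) i = r * c x i"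
    and coord_vanish: "i \<in> I \<Longrightarrow> x \<in> F \<Longrightarrow> c x i = 0"
    and coord_approx: "x - (\<Sum>i\<in>I. s (c x i) (b i)) \<in> F"
    and coord_basis: "i \<in> I \<Longrightarrow> j \<in> I \<Longrightarrow> c (b i) j = (if i = j then 1 else 0)"
begin

lemma coord_hom: "i \<in> I \<Longrightarrow> Modules.module_hom s (*) (\<lambda>x. c x i)"
  by (intro module_hom.intro module_mult module_hom_axioms.intro coord_add coord_scale)
    (unfold_locales)

lemma coord_0: "i \<in> I \<Longrightarrow> c 0 i = 0"
  using coord_add[of i 0 0] by simp

lemma coord_diff: "i \<in> I \<Longrightarrow> c (x - y) i = c x i - c y i"
  using coord_add[of i "x - y" y] by simp

lemma coord_sum: "i \<in> I \<Longrightarrow> c (\<Sum>j\<in>J. g j) i = (\<Sum>j\<in>J. c (g j) i)"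
  by (induction J rule: infinite_finite_induct) (simp_all add: coord_0 coord_add)

lemma coord_lincomb: "i \<in> I \<Longrightarrow> c (\<Sum>j\<in>J. s (r j) (g j)) i = (\<Sum>j\<in>J. r j * c (g j) i)"
  by (simp add: coord_sum coord_scale)

lemma coord_lincomb_basis:
  assumes "i \<in> I"
  shows "c (\<Sum>j\<in>I. s (r j) (b j)) i = r i"
proof -
  have "c (\<Sum>j\<in>I. s (r j) (b j)) i = (\<Sum>j\<in>I. if j = i then r j else 0)"
    unfolding coord_lincomb[OF assms] using assms by (intro sum.cong) (auto simp: coord_basis)
  then show ?thesis using assms finite_index by simp
qed

lemma mem_iff: "x \<in> F \<longleftrightarrow> (\<forall>i\<in>I. c x i = 0)"
  using coord_approx[of x] coord_vanish by force

lemma coord_unique: "x - (\<Sum>j\<in>I. s (r j) (b j)) \<in> F \<Longrightarrow> i \<in> I \<Longrightarrow> c x i = r i"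
  using coord_vanish[of i "x - (\<Sum>j\<in>I. s (r j) (b j))"]
  by (simp add: coord_diff coord_lincomb_basis)

lemma reindex:
  assumes "bij_betw f J I"
  shows "quotient_basis s F J (\<lambda>j. b (f j)) (\<lambda>x j. c x (f j))"
proof unfold_locales
  have fJ: "f j \<in> I" if "j \<in> J" for j using assms that by (auto simp: bij_betw_def)
  show "finite J" using assms finite_index bij_betw_finite by blast
  show "x - (\<Sum>j\<in>J. s (c x (f j)) (b (f j))) \<in> F" for x
    using coord_approx[of x] sum.reindex_bij_betw[OF assms, of "\<lambda>i. s (c x i) (b i)"] by simp
  show "c (b (f i)) (f j) = (if i = j then 1 else 0)" if "i \<in> J" "j \<in> J" for i j
    using that assms by (auto simp: coord_basis fJ bij_betw_def inj_on_def)
qed (use assms in \<open>auto simp: bij_betw_def intro: coord_add coord_scale coord_vanish\<close>)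

lemma coord_expand:
  assumes F: "\<And>x. x \<in> F \<Longrightarrow> f x = 0" and f: "Modules.module_hom s (*) f"
  shows "f x = (\<Sum>i\<in>I. c x i * f (b i))"
proof -
  interpret f: Modules.module_hom s "(*)" f by fact
  have "f (x - (\<Sum>i\<in>I. s (c x i) (b i))) = 0" by (rule F[OF coord_approx])
  then show ?thesis by (simp add: f.diff f.sum f.scale)
qed

text \<open>With the comparison isomorphism as \<open>T\<close>, this moves de Rham bases to the
  Betti side, where they meet the Hodge bases.\<close>

lemma pullback:
  assumes T: "Modules.module_hom s' s T" and g: "\<And>i. i \<in> I \<Longrightarrow> T (g i) = b i"
  shows "quotient_basis s' {x. T x \<in> F} I g (\<lambda>x. c (T x))"
proof -
  interpret T: Modules.module_hom s' s T by fact
  show ?thesis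
    by unfold_locales
      (use coord_approx in \<open>auto simp: finite_index T.add T.scale coord_add coord_scale
        coord_vanish T.diff T.sum g coord_basis\<close>)
qed

end

section \<open>Independence of the chosen basis: transition matrices, traces and ranks\<close>

lemma quotient_basis_matrix:
  assumes "quotient_basis s F I b c" "quotient_basis s F J b' c'" "i \<in> I" "k \<in> I"
  shows "(\<Sum>j\<in>J. c' (b i) j * c (b' j) k) = (if i = k then 1 else 0)"
proof -
  interpret B: quotient_basis s F I b c by fact
  interpret B': quotient_basis s F J b' c' by fact
  have "c (b i) k = (\<Sum>j\<in>J. c' (b i) j * c (b' j) k)"
    using assms by (intro B'.coord_expand B.coord_hom B.coord_vanish)
  then show ?thesis using assms by (simp add: B.coord_basis)
qed

text \<open>Expanding each coordinate function in the other basis turns both sides into the same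
  double sum. The two index sets are not assumed to have the same size, so the equality of ranks can
  be deduced from this.\<close>

lemma quotient_basis_trace:
  assumes B: "quotient_basis s F I b c" and B': "quotient_basis s F J b' c'"
    and f: "Modules.module_hom s s f" and F: "\<And>x. x \<in> F \<Longrightarrow> f x \<in> F"
  shows "(\<Sum>i\<in>I. c (f (b i)) i) = (\<Sum>j\<in>J. c' (f (b' j)) j)"
proof -
  interpret B: quotient_basis s F I b c by fact
  interpret B': quotient_basis s F J b' c' by fact
  interpret f: Modules.module_hom s s f by fact
  have "c (f (b i)) i = (\<Sum>j\<in>J. c' (b i) j * c (f (b' j)) i)" if "i \<in> I" for i
  proof (rule B'.coord_expand[where f = "\<lambda>x. c (f x) i"])
    show "Modules.module_hom s (*) (\<lambda>x. c (f x) i)"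
      using f.module_hom_axioms B.coord_hom[OF that] by (rule module_hom_compose[unfolded o_def])
  qed (intro B.coord_vanish that F)
  then have "(\<Sum>i\<in>I. c (f (b i)) i) = (\<Sum>i\<in>I. \<Sum>j\<in>J. c' (b i) j * c (f (b' j)) i)"
    by simp
  also have "\<dots> = (\<Sum>j\<in>J. \<Sum>i\<in>I. c (f (b' j)) i * c' (b i) j)"
    by (subst sum.swap) (simp add: mult.commute)
  also have "\<dots> = (\<Sum>j\<in>J. c' (f (b' j)) j)"
    by (intro sum.cong refl B.coord_expand[symmetric] B'.coord_hom B'.coord_vanish)
  finally show ?thesis .
qed

text \<open>The trace of the identity counts the basis vectors, and characteristic zero makes this
  number visible in the ring.\<close>

lemma quotient_basis_card:
  fixes s :: "'k :: {comm_ring_1, ring_char_0} \<Rightarrow> 'v :: ab_group_add \<Rightarrow> 'v"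
  assumes B: "quotient_basis s F I b c" and B': "quotient_basis s F J b' c'"
  shows "card I = card J"
proof -
  interpret B: quotient_basis s F I b c by fact
  interpret B': quotient_basis s F J b' c' by fact
  have "(\<Sum>i\<in>I. c (b i) i) = (\<Sum>j\<in>J. c' (b' j) j)"
    by (rule quotient_basis_trace[OF B B' B.module_hom_ident])
  then show ?thesis by (simp add: B.coord_basis B'.coord_basis)
qed

abbreviation cext :: "('v :: ab_group_add \<Rightarrow> 'i \<Rightarrow> 'k :: ab_group_add) \<Rightarrow> 'i \<Rightarrow>
    ('v, complex) tensor \<Rightarrow> ('k, complex) tensor" where
  "cext c i \<equiv> tensor_map (\<lambda>x. c x i) id"

text \<open>The remainder is checked on pure tensors x \<otimes> z, where it is 1 \<otimes> z times
  the image of the remainder of x over the coefficient field.\<close>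

lemma quotient_basis_complex:
  fixes s :: "'e :: field_char_0 \<Rightarrow> 'v :: ab_group_add \<Rightarrow> 'v"
  assumes "quotient_basis s F I b c"
  shows "quotient_basis (scale_complex s) (subspace_complex s F) I (\<lambda>i. b i \<otimes>\<^sub>t 1)
    (\<lambda>u i. cext c i u)"
proof -
  interpret B: quotient_basis s F I b c by fact
  interpret C: Modules.module "scale_complex s"
    by (intro module_scale_complex) unfold_locales
  have hom: "Modules.module_hom (scale_complex s) (*) (cext c i)" if "i \<in> I" for i
    using module_hom_tensor_map[OF B.coord_hom[OF that]] by simp
  have coord_pure: "cext c i (x \<otimes>\<^sub>t z) = c x i \<otimes>\<^sub>t z"
    if "i \<in> I" for i x and z :: complex
    by (subst tensor_map_pure[OF additive_module_hom[OF B.coord_hom[OF that]] additive_id]) simp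
  note ad = biadditive_scale_complex[OF B.module_axioms]
  have scale: "scale_complex s (e \<otimes>\<^sub>t z) (v \<otimes>\<^sub>t z') = s e v \<otimes>\<^sub>t (z * z')" for e z v z'
    by (rule scale_complex_pure) unfold_locales
  show ?thesis
  proof (rule quotient_basis.intro[OF C.module_axioms], rule quotient_basis_axioms.intro)
    show "finite I" by (rule B.finite_index)
    fix i assume i: "i \<in> I"
    interpret h: Modules.module_hom "scale_complex s" "(*)" "cext c i"
      by (rule hom[OF i])
    show "cext c i (x + y) = cext c i x + cext c i y"
      for x y :: "('v, complex) tensor"
      by (rule h.add)
    show "cext c i (scale_complex s r x) = r * cext c i x"
      for r and x :: "('v, complex) tensor"
      by (rule h.scale)
    show "cext c i x = 0" if "x \<in> subspace_complex s F" for x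
    proof (rule h.eq_0_on_span)
      show "x \<in> C.span ((\<lambda>v. v \<otimes>\<^sub>t 1) ` F)" using that by (simp add: subspace_complex_def)
    qed (auto simp: coord_pure[OF i] B.coord_vanish[OF i] pure_tensor_left.zero)
    show "cext c j (b i \<otimes>\<^sub>t (1 :: complex)) = (if i = j then 1 else 0)" if "j \<in> I" for j
      using i that by (simp add: coord_pure B.coord_basis one_tensor_def pure_tensor_left.zero)
  next
    fix u :: "('v, complex) tensor"
    show "u - (\<Sum>i\<in>I. scale_complex s (cext c i u) (b i \<otimes>\<^sub>t 1)) \<in> subspace_complex s F"
    proof (induction u rule: tensor_induct)
      case (pure x z)
      have "x \<otimes>\<^sub>t z - (\<Sum>i\<in>I. scale_complex s (cext c i (x \<otimes>\<^sub>t z)) (b i \<otimes>\<^sub>t 1)) =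
         x \<otimes>\<^sub>t z - (\<Sum>i\<in>I. s (c x i) (b i) \<otimes>\<^sub>t z)"
        by (intro arg_cong2[where f = "(-)"] refl sum.cong) (simp_all add: coord_pure scale)
      also have "\<dots> = scale_complex s (1 \<otimes>\<^sub>t z) ((x - (\<Sum>i\<in>I. s (c x i) (b i))) \<otimes>\<^sub>t 1)"
        unfolding scale by (simp add: pure_tensor_left.diff pure_tensor_left.sum)
      also have "\<dots> \<in> subspace_complex s F"
        unfolding subspace_complex_def
        by (intro C.span_scale C.span_base imageI B.coord_approx)
      finally show ?case .
    next
      case (diff x y)
      have "x - y - (\<Sum>i\<in>I. scale_complex s (cext c i (x - y)) (b i \<otimes>\<^sub>t 1)) =
        x - y - (\<Sum>i\<in>I. scale_complex s (cext c i x) (b i \<otimes>\<^sub>t 1)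
           - scale_complex s (cext c i y) (b i \<otimes>\<^sub>t 1))"
        by (intro arg_cong2[where f = "(-)"] refl sum.cong)
          (simp_all add: module_hom.diff[OF hom] C.scale_left_diff_distrib)
      also have "\<dots> = (x - (\<Sum>i\<in>I. scale_complex s (cext c i x) (b i \<otimes>\<^sub>t 1))) -
         (y - (\<Sum>i\<in>I. scale_complex s (cext c i y) (b i \<otimes>\<^sub>t 1)))"
        by (simp add: sum_subtractf)
      also have "\<dots> \<in> subspace_complex s F"
        using diff unfolding subspace_complex_def by (rule C.span_diff)
      finally show ?case .
    qed
  qed
qed

section \<open>Ordered bases as quotient bases, and the existence of bases\<close>

lemma ordered_basis_mod_imp_quotient_basis:
  assumes s: "Modules.module s" and F: "Modules.module.subspace s F"
    and vs: "ordered_basis_mod s UNIV F vs"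
  shows "\<exists>c. quotient_basis s F {..<length vs} (nth vs) c"
proof -
  interpret s: Modules.module s by fact
  let ?n = "length vs"
  define C where "C x = (THE cs. length cs = ?n \<and> x - lincomb s cs vs \<in> F)" for x
  have ex1: "\<exists>!cs. length cs = ?n \<and> x - lincomb s cs vs \<in> F" for x
    using vs by (simp add: ordered_basis_mod_def)
  have C: "length (C x) = ?n" "x - lincomb s (C x) vs \<in> F" for x
    using theI'[OF ex1[of x]] by (auto simp: C_def)
  \<comment> \<open>Uniqueness of the coefficient list reduces every law of the coordinates to a
    membership check for a proposed list.\<close>
  have C_eq: "C x ! i = r i" if "x - (\<Sum>i<?n. s (r i) (vs ! i)) \<in> F" "i < ?n" for x r i
  proof -
    have "lincomb s (map r [0..<?n]) vs = (\<Sum>i<?n. s (r i) (vs ! i))"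
      by (simp add: lincomb_def)
    then have "C x = map r [0..<?n]"
      using that(1) unfolding C_def by (intro the1_equality ex1) simp
    then show ?thesis using that(2) by simp
  qed
  have *: "x - (\<Sum>i<?n. s (C x ! i) (vs ! i)) \<in> F" for x
    using C(2) by (simp add: lincomb_def)
  have "quotient_basis s F {..<?n} (nth vs) (\<lambda>x i. C x ! i)"
  proof unfold_locales
    fix i assume i: "i \<in> {..<?n}"
    show "C (x + y) ! i = C x ! i + C y ! i" for x y
    proof (rule C_eq)
      show "x + y - (\<Sum>i<?n. s (C x ! i + C y ! i) (vs ! i)) \<in> F"
        using s.subspace_add[OF F *[of x] *[of y]]
        by (simp add: s.scale_left_distrib sum.distrib algebra_simps)
    qed (use i in simp)
    show "C (s r x) ! i = r * C x ! i" for r x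
    proof (rule C_eq)
      show "s r x - (\<Sum>i<?n. s (r * C x ! i) (vs ! i)) \<in> F"
        using s.subspace_scale[OF F *[of x], of r]
        by (simp add: s.scale_right_diff_distrib s.scale_sum_right)
    qed (use i in simp)
    show "C x ! i = 0" if "x \<in> F" for x
      by (rule C_eq) (use i that in simp_all)
    show "C (vs ! i) ! j = (if i = j then 1 else 0)" if "j \<in> {..<?n}" for j
    proof (rule C_eq)
      have "(\<Sum>j<?n. s (if i = j then 1 else 0) (vs ! j)) = (\<Sum>j<?n. if i = j then vs ! j else 0)"
        by (rule sum.cong) auto
      then show "vs ! i - (\<Sum>j<?n. s (if i = j then 1 else 0) (vs ! j)) \<in> F"
        using i s.subspace_0[OF F] by simp
    qed (use that in simp)
  qed (use * in simp_all)
  then show ?thesis by blast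
qed

lemma quotient_basis_imp_ordered_basis_mod:
  assumes B: "quotient_basis s F {..<length vs} (nth vs) c"
  shows "ordered_basis_mod s UNIV F vs"
  unfolding ordered_basis_mod_def
proof (intro conjI ballI)
  interpret quotient_basis s F "{..<length vs}" "nth vs" c by fact
  fix x
  show "\<exists>!cs. length cs = length vs \<and> x - lincomb s cs vs \<in> F"
  proof (rule ex1I)
    show "length (map (c x) [0..<length vs]) = length vs \<and>
        x - lincomb s (map (c x) [0..<length vs]) vs \<in> F"
      using coord_approx[of x] by (simp add: lincomb_def)
  next
    fix cs assume cs: "length cs = length vs \<and> x - lincomb s cs vs \<in> F"
    show "cs = map (c x) [0..<length vs]"
    proof (rule nth_equalityI)
      fix i assume "i < length cs"
      then have "c x i = cs ! i"
        using cs by (intro coord_unique) (auto simp: lincomb_def)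
      then show "cs ! i = map (c x) [0..<length vs] ! i"
        using \<open>i < length cs\<close> cs by simp
    qed (use cs in simp)
  qed
qed simp

text \<open>Since \<open>S'\<close> is a complement, \<open>S\<close> maps isomorphically onto the
  quotient by \<open>S'\<close>. In this way H_B^s is treated as the quotient of H_B by the opposite
  eigenspace.\<close>

lemma ordered_basis_iff_complement:
  assumes s: "Modules.module s"
    and S: "Modules.module.subspace s S" "Modules.module.subspace s S'"
    and inter: "S \<inter> S' = {0}" and sum: "\<And>x. \<exists>y\<in>S. x - y \<in> S'"
  shows "ordered_basis s S vs \<longleftrightarrow> set vs \<subseteq> S \<and> ordered_basis_mod s UNIV S' vs"
proof (cases "set vs \<subseteq> S")
  case True
  interpret s: Modules.module s by fact
  have lin: "lincomb s cs vs \<in> S" for cs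
    unfolding lincomb_def using True by (intro s.subspace_sum S s.subspace_scale) auto
  have *: "x - lincomb s cs vs \<in> S' \<longleftrightarrow> y - lincomb s cs vs = 0" if "y \<in> S" "x - y \<in> S'" for x y cs
  proof
    assume "x - lincomb s cs vs \<in> S'"
    from s.subspace_diff[OF S(2) this that(2)] have "y - lincomb s cs vs \<in> S'" by simp
    moreover have "y - lincomb s cs vs \<in> S" by (intro s.subspace_diff S that lin)
    ultimately show "y - lincomb s cs vs = 0" using inter by blast
  qed (use that in simp)
  have 0: "0 \<in> S'" by (rule s.subspace_0[OF S(2)])
  show ?thesis
  proof
    assume "ordered_basis s S vs"
    then have "\<exists>!cs. length cs = length vs \<and> x - lincomb s cs vs \<in> S'" for x
      using sum[of x] by (auto simp: ordered_basis_mod_def *)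
    then show "set vs \<subseteq> S \<and> ordered_basis_mod s UNIV S' vs"
      using True by (simp add: ordered_basis_mod_def)
  next
    assume "set vs \<subseteq> S \<and> ordered_basis_mod s UNIV S' vs"
    moreover have "x - lincomb s cs vs \<in> S' \<longleftrightarrow> x - lincomb s cs vs \<in> {0}" if "x \<in> S" for x cs
      using *[OF that] 0 by simp
    ultimately show "ordered_basis s S vs"
      unfolding ordered_basis_mod_def by (metis (no_types, lifting) UNIV_I)
  qed
qed (auto simp: ordered_basis_mod_def)

lemma (in quotient_basis) inj_on_basis: "inj_on b I"
proof (rule inj_onI, rule ccontr)
  fix i j assume ij: "i \<in> I" "j \<in> I" "b i = b j" "i \<noteq> j"
  have "c (b i) i = 1" using coord_basis[OF ij(1,1)] by simp
  moreover have "c (b i) i = 0" unfolding ij(3) using coord_basis[OF ij(2,1)] ij(4) by simp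
  ultimately show False by simp
qed

lemma (in quotient_basis) independent_basis: "independent (b ` I)"
proof
  note inj = inj_on_basis
  assume "dependent (b ` I)"
  then obtain u v where v: "v \<in> b ` I" "u v \<noteq> 0" "(\<Sum>v\<in>b ` I. s (u v) v) = 0"
    unfolding dependent_finite[OF finite_imageI[OF finite_index]] by auto
  then obtain i where i: "i \<in> I" "v = b i" by auto
  have "c (\<Sum>i\<in>I. s (u (b i)) (b i)) i = u (b i)" by (rule coord_lincomb_basis) (rule i)
  moreover have "(\<Sum>i\<in>I. s (u (b i)) (b i)) = 0"
    using v(3) by (simp add: sum.reindex[OF inj])
  ultimately show False using v i by (simp add: coord_0)
qed

text \<open>The remainder of a vector of \<open>S\<close> lies in both \<open>S\<close> and
  \<open>F\<close>, hence vanishes; so the basis modulo \<open>F\<close> spans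
  \<open>S\<close>.\<close>

lemma dim_eq_card_index:
  fixes s :: "'k :: field \<Rightarrow> 'v :: ab_group_add \<Rightarrow> 'v"
  assumes "quotient_basis s F I b c" and S: "Modules.module.subspace s S"
    and inter: "S \<inter> F = {0}" and b: "b ` I \<subseteq> S"
  shows "vector_space.dim s S = card I"
proof -
  interpret quotient_basis s F I b c by fact
  interpret vector_space s by (simp add: module_iff_vector_space[symmetric] module_axioms)
  have "S \<subseteq> span (b ` I)"
  proof
    fix x assume x: "x \<in> S"
    have "(\<Sum>i\<in>I. s (c x i) (b i)) \<in> S" using b S by (intro subspace_sum subspace_scale) auto
    then have "x - (\<Sum>i\<in>I. s (c x i) (b i)) \<in> S \<inter> F"
      using x S coord_approx by (auto intro: subspace_diff)
    then have "x = (\<Sum>i\<in>I. s (c x i) (b i))" using inter by auto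
    also have "\<dots> \<in> span (b ` I)" by (intro span_sum span_scale span_base imageI)
    finally show "x \<in> span (b ` I)" .
  qed
  then have "dim S = card (b ` I)"
    using b independent_basis by (intro dim_unique) auto
  also have "\<dots> = card I" by (intro card_image inj_on_basis)
  finally show ?thesis .
qed

text \<open>A basis of \<open>F\<close> is extended by vectors of \<open>S\<close> to a basis of the
  whole space. The added vectors represent the quotient, and their coordinates are those of the full
  basis. Choosing an eigenspace for \<open>S\<close> yields representatives that are eigenvectors of
  complex conjugation.\<close>

lemma ex_quotient_basis:
  fixes s :: "'k :: field \<Rightarrow> 'v :: ab_group_add \<Rightarrow> 'v"
  assumes s: "vector_space s" and fd: "finite_dimensional s" and F: "Modules.module.subspace s F"
    and S: "Modules.module.subspace s S" and FS: "\<And>x. \<exists>y\<in>S. x - y \<in> F"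
  shows "\<exists>vs c. set vs \<subseteq> S \<and> quotient_basis s F {..<length vs} (nth vs) c"
proof -
  interpret vector_space s by fact
  obtain B0 where B0: "finite B0" "span B0 = UNIV" 
    using fd unfolding finite_dimensional_def by (elim exE conjE) rule
  obtain A where A: "A \<subseteq> F" "independent A" "F \<subseteq> span A"
    by (rule basis_exists[of F])
  obtain B where B: "A \<subseteq> B" "B \<subseteq> A \<union> S" "independent B" "A \<union> S \<subseteq> span B"
    by (rule maximal_independent_subset_extend[of A "A \<union> S"]) (use A in auto)
  have finB: "finite B" using independent_span_bound[OF B0(1) B(3)] B0 by auto
  have spanA: "span A = F" using A F by (simp add: span_subspace)
  have span: "x \<in> span B" for x
  proof -
    obtain y where y: "y \<in> S" "x - y \<in> F" using FS by blast
    have "y \<in> span B" "x - y \<in> span B" using y B spanA span_mono[OF B(1)] by auto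
    then have "y + (x - y) \<in> span B" by (rule span_add)
    then show ?thesis by simp
  qed
  obtain vs where vs: "set vs = B - A" "distinct vs"
    using finite_distinct_list[of "B - A"] finB by auto
  let ?n = "length vs"
  let ?r = "representation B"
  have vsB: "vs ! i \<in> B" if "i < ?n" for i using vs that nth_mem[of i vs] by auto
  have zero: "?r x (vs ! i) = 0" if "x \<in> F" "i < ?n" for x i
  proof -
    have "vs ! i \<notin> A" using vs that nth_mem[of i vs] by auto
    moreover have "?r x = representation A x"
      using that spanA by (intro representation_extend) (use B in auto)
    ultimately show ?thesis using representation_ne_zero[of A x "vs ! i"] by auto
  qed
  have "quotient_basis s F {..<?n} (nth vs) (\<lambda>x i. ?r x (vs ! i))"
  proof unfold_locales
    fix x
    have "x = (\<Sum>v\<in>B. s (?r x v) v)"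
      by (rule sum_representation_eq[symmetric]) (use B finB span in auto)
    also have "\<dots> = (\<Sum>v\<in>A. s (?r x v) v) + (\<Sum>v\<in>B - A. s (?r x v) v)"
      using sum.subset_diff[OF B(1) finB] by (metis add.commute)
    also have "(\<Sum>v\<in>B - A. s (?r x v) v) = (\<Sum>i<?n. s (?r x (vs ! i)) (vs ! i))"
      by (rule sum.reindex_bij_betw[OF bij_betw_nth[OF vs(2) refl vs(1)[symmetric]], symmetric])
    finally have "x - (\<Sum>i<?n. s (?r x (vs ! i)) (vs ! i)) = (\<Sum>v\<in>A. s (?r x v) v)"
      by (simp add: algebra_simps)
    also have "\<dots> \<in> F" unfolding spanA[symmetric] by (intro span_sum span_scale span_base)
    finally show "x - (\<Sum>i\<in>{..<?n}. s (?r x (vs ! i)) (vs ! i)) \<in> F" by simp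
  next
    show "?r (vs ! i) (vs ! j) = (if i = j then 1 else 0)" if "i \<in> {..<?n}" "j \<in> {..<?n}" for i j
      using that vs B by (simp add: representation_basis[OF _ vsB] nth_eq_iff_index_eq)
  qed (use B span zero in \<open>auto simp: representation_add representation_scale\<close>)
  moreover have "set vs \<subseteq> S" using vs B by auto
  ultimately show ?thesis by blast
qed

text \<open>The diagonal of the product of the two transition matrices sums to \<open>m\<close> in
  one order and to \<open>n\<close> in the other, and the double sum is the same.\<close>

lemma free_of_rank_unique:
  fixes s :: "'k :: {comm_ring_1, ring_char_0} \<Rightarrow> 'v :: ab_group_add \<Rightarrow> 'v"
  assumes s: "Modules.module s" and "free_of_rank s S m" "free_of_rank s S n"
  shows "m = n"
proof -
  interpret Modules.module s by fact
  obtain B where B: "finite B" "card B = m" "independent B" "span B = S"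
    using assms(2) by (auto simp: free_of_rank_def)
  obtain D where D: "finite D" "card D = n" "independent D" "span D = S"
    using assms(3) by (auto simp: free_of_rank_def)
  have *: "of_nat (card X) = (\<Sum>x\<in>X. \<Sum>y\<in>Y. representation Y x y * representation X y x)"
    if X: "finite X" "independent X" "span X = S" and Y: "finite Y" "independent Y" "span Y = S" for X Y
  proof -
    have "(\<Sum>y\<in>Y. representation Y x y * representation X y x) = 1" if "x \<in> X" for x
    proof -
      have "x \<in> span Y" using X Y that span_base by auto
      then have "x = (\<Sum>y\<in>Y. s (representation Y x y) y)"
        by (intro sum_representation_eq[symmetric] Y) auto
      then have "representation X x x = representation X (\<Sum>y\<in>Y. s (representation Y x y) y) x"
        by simp
      also have "\<dots> = (\<Sum>y\<in>Y. representation X (s (representation Y x y) y) x)"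
        by (subst representation_sum) (use X Y span_base in \<open>auto intro!: span_scale\<close>)
      also have "\<dots> = (\<Sum>y\<in>Y. representation Y x y * representation X y x)"
        by (intro sum.cong refl, subst representation_scale) (use X Y span_base in auto)
      finally show ?thesis using that X by (simp add: representation_basis)
    qed
    then show ?thesis by simp
  qed
  have "(of_nat m :: 'k) = of_nat n"
    using *[OF B(1,3,4) D(1,3,4)] *[OF D(1,3,4) B(1,3,4)] B(2) D(2)
    by (subst (asm) (2) sum.swap) (simp add: mult.commute)
  then show ?thesis by simp
qed

lemma free_rank_eq:
  fixes s :: "'k :: {comm_ring_1, ring_char_0} \<Rightarrow> 'v :: ab_group_add \<Rightarrow> 'v"
  assumes "Modules.module s" "free_of_rank s S n"
  shows "free_rank s S = n"
  unfolding free_rank_def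
  by (rule the_equality, rule assms(2)) (rule free_of_rank_unique[OF assms(1) _ assms(2)])

section \<open>Tensor products of vector spaces\<close>

text \<open>The biadditive map f x * g y respects the balancing relations, and these generate the
  kernel of \<open>tensor_lift \<tau>\<close>; so it descends along any choice of preimages. Such
  products become the coordinate functions on the realizations of the tensor motive.\<close>

lemma tensor_product_functional:
  fixes sT :: "'e :: field_char_0 \<Rightarrow> 't :: ab_group_add \<Rightarrow> 't"
  assumes T: "is_tensor_product sV sW sT \<tau>" and sT: "Modules.module sT"
    and f: "Modules.module_hom sV (*) f" and g: "Modules.module_hom sW (*) g"
  shows "\<exists>h. Modules.module_hom sT (*) h \<and> (\<forall>x y. h (\<tau> x y) = f x * g y)"
proof -
  interpret sT: Modules.module sT by fact
  interpret f: Modules.module_hom sV "(*)" f by fact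
  interpret g: Modules.module_hom sW "(*)" g by fact
  have bi: "biadditive \<tau>" and surj: "surj (tensor_lift \<tau>)"
    and left: "\<And>e v w. \<tau> (sV e v) w = sT e (\<tau> v w)"
    and ker: "{x. tensor_lift \<tau> x = 0} =
      group_closure {sV e v \<otimes>\<^sub>t w - v \<otimes>\<^sub>t sW e w | e v w. True}"
    using T by (auto simp: is_tensor_product_def)
  define p where "p x y = f x * g y" for x y
  have p: "biadditive p"
    by (simp add: biadditive_def p_def f.add g.add algebra_simps)
  have p_balanced: "p (sV e v) w = p v (sW e w)" and p_left: "p (sV e v) w = e * p v w" for e v w
    by (simp_all add: p_def f.scale g.scale)
  note ad\<tau> = additive_tensor_lift[OF bi] and adp = additive_tensor_lift[OF p]
  have closure: "tensor_lift p x = 0"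
    if "x \<in> group_closure {sV e v \<otimes>\<^sub>t w - v \<otimes>\<^sub>t sW e w | e v w. True}" for x
    using that
  proof induction
    case (base x)
    then show ?case
      by (auto simp: additive.diff[OF adp] additive.zero[OF adp] tensor_lift_pure[OF p] p_balanced)
  qed (simp_all add: additive.diff[OF adp] additive.zero[OF adp])
  have *: "tensor_lift p x = tensor_lift p y" if "tensor_lift \<tau> x = tensor_lift \<tau> y" for x y
  proof -
    have "x - y \<in> {x. tensor_lift \<tau> x = 0}" using that by (simp add: additive.diff[OF ad\<tau>])
    then have "tensor_lift p (x - y) = 0" unfolding ker by (rule closure)
    then show ?thesis by (simp add: additive.diff[OF adp])
  qed
  define r where "r t = (SOME x. tensor_lift \<tau> x = t)" for t
  have r: "tensor_lift \<tau> (r t) = t" for t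
  proof -
    obtain x where "t = tensor_lift \<tau> x" using surj by (rule surjE)
    then have "tensor_lift \<tau> x = t" by simp
    then show ?thesis unfolding r_def by (rule someI)
  qed
  define h where "h t = tensor_lift p (r t)" for t
  have h: "h (tensor_lift \<tau> x) = tensor_lift p x" for x
    unfolding h_def by (intro * r)
  have h_pure: "h (\<tau> x y) = p x y" for x y
    using h[of "x \<otimes>\<^sub>t y"] by (simp add: tensor_lift_pure[OF bi] tensor_lift_pure[OF p])
  have h_add: "h (x + y) = h x + h y" for x y
    using h[of "r x + r y"] by (simp add: additive.add[OF ad\<tau>] additive.add[OF adp] r) (simp add: h_def)
  have h_diff: "h (x - y) = h x - h y" for x y
    using h_add[of "x - y" y] by simp
  have "h (sT e (tensor_lift \<tau> x)) = e * h (tensor_lift \<tau> x)" for e x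
  proof (induction x rule: tensor_induct)
    case (pure a b)
    show ?case
      by (simp add: tensor_lift_pure[OF bi] left[symmetric] h_pure p_left)
  qed (simp add: additive.diff[OF ad\<tau>] sT.scale_right_diff_distrib h_diff right_diff_distrib)
  from this[of _ "r t" for t] have h_scale: "h (sT e t) = e * h t" for e t
    unfolding r .
  have "Modules.module_hom sT (*) h"
    by (intro module_hom.intro module_hom_axioms.intro sT module_mult h_add h_scale)
  then show ?thesis using h_pure unfolding p_def by blast
qed

lemma tensor_product_ext:
  assumes T: "is_tensor_product sV sW sT \<tau>" and "additive f" "additive g"
    and fg: "\<And>x y. f (\<tau> x y) = g (\<tau> x y)"
  shows "f t = g t"
proof -
  have bi: "biadditive \<tau>" and surj: "surj (tensor_lift \<tau>)"
    using T by (auto simp: is_tensor_product_def)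
  note ad\<tau> = additive_tensor_lift[OF bi]
  obtain x where x: "t = tensor_lift \<tau> x" using surj by (rule surjE)
  show ?thesis unfolding x
    by (induction x rule: tensor_induct)
      (simp_all add: tensor_lift_pure[OF bi] fg additive.diff[OF ad\<tau>] additive.diff[OF assms(2)]
        additive.diff[OF assms(3)])
qed

lemma tensor_map2_scale:
  assumes V: "Modules.module sV" and W: "Modules.module sW" and T: "Modules.module sT"
    and bi: "biadditive \<tau>"
    and left: "\<And>e v w. \<tau> (sV e v) w = sT e (\<tau> v w)"
    and right: "\<And>e v w. \<tau> v (sW e w) = sT e (\<tau> v w)"
  shows "tensor_map2 \<tau> (*) (scale_complex sV r x) y = scale_complex sT r (tensor_map2 \<tau> (*) x y)"
    and "tensor_map2 \<tau> (*) x (scale_complex sW r y) = scale_complex sT r (tensor_map2 \<tau> (*) x y)"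
proof -
  let ?t = "tensor_map2 \<tau> ((*) :: complex \<Rightarrow> _)"
  have bt: "biadditive ?t" by (intro biadditive_tensor_map2 bi biadditive_mult)
  have pure: "?t (a \<otimes>\<^sub>t z) (b \<otimes>\<^sub>t w) = \<tau> a b \<otimes>\<^sub>t (z * w)" for a b z w
    by (intro tensor_map2_pure bi biadditive_mult)
  note d = additive.diff[OF additive_biadditive(1)[OF bt]] additive.diff[OF additive_biadditive(2)[OF bt]]
    additive.diff[OF additive_biadditive(1)[OF biadditive_scale_complex[OF V]]]
    additive.diff[OF additive_biadditive(2)[OF biadditive_scale_complex[OF V]]]
    additive.diff[OF additive_biadditive(1)[OF biadditive_scale_complex[OF W]]]
    additive.diff[OF additive_biadditive(2)[OF biadditive_scale_complex[OF W]]]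
    additive.diff[OF additive_biadditive(1)[OF biadditive_scale_complex[OF T]]]
    additive.diff[OF additive_biadditive(2)[OF biadditive_scale_complex[OF T]]]
  note p = scale_complex_pure[OF V] scale_complex_pure[OF W] scale_complex_pure[OF T]
  have *: "?t (scale_complex sV (e \<otimes>\<^sub>t q) (a \<otimes>\<^sub>t z)) (b \<otimes>\<^sub>t w) =
        scale_complex sT (e \<otimes>\<^sub>t q) (?t (a \<otimes>\<^sub>t z) (b \<otimes>\<^sub>t w)) \<and>
     ?t (a \<otimes>\<^sub>t z) (scale_complex sW (e \<otimes>\<^sub>t q) (b \<otimes>\<^sub>t w)) =
        scale_complex sT (e \<otimes>\<^sub>t q) (?t (a \<otimes>\<^sub>t z) (b \<otimes>\<^sub>t w))" for e q a z b w
    by (simp add: pure p left right mult_ac)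
  have **: "?t (scale_complex sV (e \<otimes>\<^sub>t q) (a \<otimes>\<^sub>t z)) y = scale_complex sT (e \<otimes>\<^sub>t q) (?t (a \<otimes>\<^sub>t z) y) \<and>
     ?t (a \<otimes>\<^sub>t z) (scale_complex sW (e \<otimes>\<^sub>t q) y) = scale_complex sT (e \<otimes>\<^sub>t q) (?t (a \<otimes>\<^sub>t z) y)"
    for e q a z y
    by (induction y rule: tensor_induct) (use * in \<open>simp_all add: d\<close>)
  have ***: "?t (scale_complex sV (e \<otimes>\<^sub>t q) x) y = scale_complex sT (e \<otimes>\<^sub>t q) (?t x y) \<and>
     ?t x (scale_complex sW (e \<otimes>\<^sub>t q) y) = scale_complex sT (e \<otimes>\<^sub>t q) (?t x y)" for e q x y
    by (induction x rule: tensor_induct) (use ** in \<open>simp_all add: d\<close>)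
  have "?t (scale_complex sV r x) y = scale_complex sT r (?t x y) \<and>
     ?t x (scale_complex sW r y) = scale_complex sT r (?t x y)"
    by (induction r rule: tensor_induct) (use *** in \<open>simp_all add: d\<close>)
  then show "?t (scale_complex sV r x) y = scale_complex sT r (?t x y)"
    and "?t x (scale_complex sW r y) = scale_complex sT r (?t x y)" by auto
qed

lemma det_on_base:
  fixes A :: "'i \<Rightarrow> 'i \<Rightarrow> 'e :: field_char_0"
  assumes "finite I"
  shows "det_on I (\<lambda>i j. A i j \<otimes>\<^sub>t (1 :: complex)) = det_on I A \<otimes>\<^sub>t 1"
  by (rule comm_ring_hom.hom_det_on[OF comm_ring_hom_pure_tensor_one assms, symmetric])

text \<open>The determinant comes from the coefficient field, and zero is not a unit there. A matrix
  over the coefficient field is thus recognised as invertible by an argument over E \<otimes>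
  \<complex>, which is how correction factors turn out to be rational.\<close>

lemma det_on_base_unit:
  fixes A :: "'i \<Rightarrow> 'i \<Rightarrow> 'e :: field_char_0"
  assumes "finite I" "det_on I (\<lambda>i j. A i j \<otimes>\<^sub>t (1 :: complex)) dvd 1"
  shows "det_on I (\<lambda>i j. A i j \<otimes>\<^sub>t (1 :: complex)) \<in> rational_units"
proof -
  have "det_on I A \<noteq> 0"
  proof
    assume "det_on I A = 0"
    then show False
      using assms(2) unfolding det_on_base[OF assms(1)] by (simp add: pure_tensor_left.zero)
  qed
  then show ?thesis unfolding det_on_base[OF assms(1)] rational_units_def by blast
qed

section \<open>Realizations\<close>

lemma quotient_basis_matrix_dvd_one:
  assumes B: "quotient_basis s F I b c" and B': "quotient_basis s F I b' c'"
  shows "det_on I (\<lambda>i j. c (b' j) i) dvd 1"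
proof -
  have I: "finite I" by (rule quotient_basis.finite_index[OF B])
  have "det_on I (\<lambda>i j. c' (b j) i) * det_on I (\<lambda>i j. c (b' j) i) =
      det_on I (\<lambda>i j. \<Sum>k\<in>I. c' (b k) i * c (b' j) k)"
    by (rule det_on_mult[OF I, symmetric])
  also have "\<dots> = 1"
    using quotient_basis_matrix[OF B' B] by (intro det_on_one I) (auto simp: mult.commute)
  finally show ?thesis by (metis dvd_triv_right)
qed

section \<open>The eigenspaces of complex conjugation and their rational bases\<close>

locale realization =
  fixes X :: "('e :: field_char_0, 'b :: ab_group_add, 'r :: ab_group_add) motive"
  assumes pure: "pure_motive X"
begin

abbreviation "sB \<equiv> betti_scale X"
abbreviation "sU \<equiv> betti_scale_complex X"
abbreviation "sD \<equiv> dr_scale X"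
abbreviation "sW \<equiv> dr_scale_complex X"
abbreviation "T \<equiv> comparison X"

sublocale B: vector_space "betti_scale X"
  using pure by (simp add: pure_motive_def)

sublocale D: vector_space "dr_scale X"
  using pure by (simp add: pure_motive_def)

lemma module_B: "Modules.module sB" by unfold_locales
lemma module_D: "Modules.module sD" by unfold_locales

sublocale U: Modules.module "betti_scale_complex X"
  unfolding betti_scale_complex_def by (rule module_scale_complex[OF module_B])

sublocale W: Modules.module "dr_scale_complex X"
  unfolding dr_scale_complex_def by (rule module_scale_complex[OF module_D])

sublocale T: Modules.module_hom "betti_scale_complex X" "dr_scale_complex X" "comparison X"
  using pure by (simp add: pure_motive_def)

lemma linear_rho: "Vector_Spaces.linear sB sB (rho X)"
  using pure by (simp add: pure_motive_def)

sublocale rho: Modules.module_hom "betti_scale X" "betti_scale X" "rho X"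
  using linear_rho by (rule Vector_Spaces.linear.axioms(3))

sublocale rhoc: Modules.module_hom "betti_scale_complex X" "betti_scale_complex X" "rho_complex X"
  unfolding betti_scale_complex_def rho_complex_def
  by (rule module_hom_tensor_map) (rule rho.module_hom_axioms)

lemma rho_rho: "rho X (rho X x) = x"
  using pure by (simp add: pure_motive_def)

lemma rho_complex_pure: "rho_complex X (x \<otimes>\<^sub>t z) = rho X x \<otimes>\<^sub>t z"
  unfolding rho_complex_def
  by (subst tensor_map_pure[OF additive_module_hom[OF rho.module_hom_axioms] additive_id]) simp

lemma rho_complex_rho_complex: "rho_complex X (rho_complex X u) = u"
  by (induction u rule: tensor_induct) (simp_all add: rho_complex_pure rho_rho rhoc.diff)

lemma bij_comparison: "bij T"
  using pure by (simp add: pure_motive_def)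

lemma comparison_inv: "T (inv_into UNIV T w) = w"
  using bij_comparison by (simp add: bij_def f_inv_into_f)

lemma subspace_fil: "D.subspace (fil X p)"
  using pure by (simp add: pure_motive_def)

lemma subspace_betti_part: "B.subspace (betti_part X t)"
  by (rule B.subspaceI)
    (auto simp: betti_part_def rho.zero rho.add rho.scale B.scale_right_distrib B.scale_left_commute)

lemma betti_part_Int:
  assumes "t \<in> {1, -1}"
  shows "betti_part X t \<inter> betti_part X (- t) = {0}"
proof -
  have "x = 0" if "x \<in> betti_part X t" "x \<in> betti_part X (- t)" for x
  proof -
    have "sB (of_int t) x = sB (- of_int t) x" using that by (simp add: betti_part_def)
    then have "of_int t = (- of_int t :: 'e) \<or> x = 0" by (simp only: B.scale_cancel_right)
    then show "x = 0" using assms by auto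
  qed
  moreover have "0 \<in> betti_part X t" for t
    by (rule B.subspace_0[OF subspace_betti_part])
  ultimately show ?thesis by blast
qed

lemma betti_part_sum:
  assumes "t \<in> {1, -1}"
  shows "\<exists>y\<in>betti_part X t. x - y \<in> betti_part X (- t)"
proof
  \<comment> \<open>The projector (1 + t \<rho>) / 2 onto the eigenspace of sign t.\<close>
  let ?y = "sB (1 / 2) (x + sB (of_int t) (rho X x))"
  have t: "of_int t * of_int t = (1 :: 'e)" using assms by auto
  have tt: "sB (of_int t) (sB (of_int t) y) = y" for y by (simp add: t)
  have "rho X ?y = sB (1 / 2) (rho X x + sB (of_int t) x)"
    by (simp only: rho.scale rho.add rho_rho)
  also have "\<dots> = sB (1 / 2) (sB (of_int t) (x + sB (of_int t) (rho X x)))"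
    by (simp only: B.scale_right_distrib[of "of_int t"] tt add.commute)
  also have "\<dots> = sB (of_int t) ?y" by (rule B.scale_left_commute)
  finally show "?y \<in> betti_part X t" by (simp add: betti_part_def)
  have "x - ?y = sB (1 / 2) (x - sB (of_int t) (rho X x))"
  proof -
    have "sB (1 / 2) x + sB (1 / 2) x = x"
      by (simp add: B.scale_left_distrib[symmetric])
    moreover have "sB (1 / 2) (x - z) + sB (1 / 2) (x + z) = sB (1 / 2) x + sB (1 / 2) x" for z
      by (simp add: B.scale_right_distrib B.scale_right_diff_distrib)
    ultimately show ?thesis by (metis add_diff_cancel_right')
  qed
  moreover have "rho X (sB (1 / 2) (x - sB (of_int t) (rho X x))) =
    sB (- of_int t) (sB (1 / 2) (x - sB (of_int t) (rho X x)))"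
  proof -
    have "rho X (sB (1 / 2) (x - sB (of_int t) (rho X x))) = sB (1 / 2) (rho X x - sB (of_int t) x)"
      by (simp only: rho.scale rho.diff rho_rho)
    also have "\<dots> = sB (1 / 2) (sB (- of_int t) (x - sB (of_int t) (rho X x)))"
    proof -
      have "sB (- of_int t) (x - sB (of_int t) (rho X x)) = rho X x - sB (of_int t) x"
        by (simp add: B.scale_right_diff_distrib t)
      then show ?thesis by (simp only:)
    qed
    also have "\<dots> = sB (- of_int t) (sB (1 / 2) (x - sB (of_int t) (rho X x)))"
      by (rule B.scale_left_commute)
    finally show ?thesis .
  qed
  ultimately show "x - ?y \<in> betti_part X (- t)" by (simp only: betti_part_def mem_Collect_eq of_int_minus)
qed

lemma ordered_basis_betti_part_iff:
  assumes "t \<in> {1, -1}"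
  shows "ordered_basis sB (betti_part X t) vs \<longleftrightarrow>
    set vs \<subseteq> betti_part X t \<and> ordered_basis_mod sB UNIV (betti_part X (- t)) vs"
  by (rule ordered_basis_iff_complement[OF module_B subspace_betti_part subspace_betti_part
        betti_part_Int[OF assms] betti_part_sum[OF assms]])

text \<open>The vectors lie in the eigenspace of sign \<open>t\<close>, but the coordinates are
  defined on all of H_B and vanish on the opposite eigenspace. The index set is free, so that the
  basis can later be indexed by Hodge types and a square matrix results.\<close>

definition betti_basis :: "int \<Rightarrow> 'i set \<Rightarrow> ('i \<Rightarrow> 'b) \<Rightarrow> ('b \<Rightarrow> 'i \<Rightarrow> 'e) \<Rightarrow> bool" where
  "betti_basis t I v c \<longleftrightarrow> v ` I \<subseteq> betti_part X t \<and> quotient_basis sB (betti_part X (- t)) I v c"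

lemma betti_part_dim_eq:
  assumes "t \<in> {1, -1}" "betti_basis t I v c"
  shows "betti_part_dim X t = card I"
  unfolding betti_part_dim_def
  using assms(2) by (intro dim_eq_card_index[OF _ subspace_betti_part betti_part_Int[OF assms(1)]])
    (auto simp: betti_basis_def)

lemma ex_betti_basis_nat:
  assumes "t \<in> {1, -1}"
  shows "\<exists>vs c. betti_basis t {..<length vs} (nth vs) c \<and> ordered_basis sB (betti_part X t) vs"
proof -
  have "finite_dimensional sB" using pure by (simp add: pure_motive_def)
  then obtain vs c where vs: "set vs \<subseteq> betti_part X t"
      "quotient_basis sB (betti_part X (- t)) {..<length vs} (nth vs) c"
    using ex_quotient_basis[OF B.vector_space_axioms _ subspace_betti_part subspace_betti_part
        betti_part_sum[OF assms]] by blast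
  then have "ordered_basis sB (betti_part X t) vs"
    using quotient_basis_imp_ordered_basis_mod[OF vs(2)]
    by (simp add: ordered_basis_betti_part_iff[OF assms])
  moreover have "nth vs ` {..<length vs} \<subseteq> betti_part X t" using vs(1) by auto
  ultimately show ?thesis using vs(2) unfolding betti_basis_def by blast
qed

lemma betti_basis_reindex:
  "betti_basis t I v c \<Longrightarrow> bij_betw f J I \<Longrightarrow> betti_basis t J (\<lambda>j. v (f j)) (\<lambda>x j. c x (f j))"
  unfolding betti_basis_def by (auto intro: quotient_basis.reindex simp: bij_betw_def)

lemma ex_betti_basis:
  assumes t: "t \<in> {1, -1}" and I: "finite I" "card I = betti_part_dim X t"
  shows "\<exists>v c. betti_basis t I v c"
proof -
  obtain vs c where vs: "betti_basis t {..<length vs} (nth vs) c"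
    using ex_betti_basis_nat[OF t] by blast
  have "card I = card {..<length vs}" using betti_part_dim_eq[OF t vs] I by simp
  then obtain f where "bij_betw f I {..<length vs}"
    using finite_same_card_bij[OF I(1) finite_lessThan] by blast
  from betti_basis_reindex[OF vs this] show ?thesis by blast
qed

lemma betti_basis_coord_eq:
  assumes "t \<in> {1, -1}" "betti_basis t I v c" "x \<in> betti_part X t"
  shows "x = (\<Sum>i\<in>I. sB (c x i) (v i))"
proof -
  have "x - (\<Sum>i\<in>I. sB (c x i) (v i)) \<in> betti_part X (- t)"
    using assms(2) by (auto simp: betti_basis_def intro: quotient_basis.coord_approx)
  moreover have "x - (\<Sum>i\<in>I. sB (c x i) (v i)) \<in> betti_part X t"
    using assms by (intro B.subspace_diff B.subspace_sum B.subspace_scale subspace_betti_part)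
      (auto simp: betti_basis_def)
  ultimately have "x - (\<Sum>i\<in>I. sB (c x i) (v i)) \<in> betti_part X t \<inter> betti_part X (- t)"
    by blast
  then show ?thesis unfolding betti_part_Int[OF assms(1)] by simp
qed

lemma rho_complex_betti_part:
  assumes "u \<in> subspace_complex sB (betti_part X t)"
  shows "rho_complex X u = sU (of_int t) u"
proof -
  have "u \<in> U.span ((\<lambda>v. v \<otimes>\<^sub>t 1) ` betti_part X t)"
    using assms by (simp add: subspace_complex_def betti_scale_complex_def)
  then show ?thesis
  proof (induction rule: U.span_induct)
    case base
    show ?case
      by (rule U.subspaceI)
        (auto simp: rhoc.add rhoc.scale rhoc.zero U.scale_right_distrib mult.commute)
  next
    case (step u)
    then show ?case
      by (auto simp: rho_complex_pure betti_part_def betti_scale_complex_def of_int_tensor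
          scale_complex_pure[OF module_B])
  qed
qed

lemma betti_basis_complex:
  "betti_basis t I v c \<Longrightarrow> quotient_basis sU (subspace_complex sB (betti_part X (- t))) I
     (\<lambda>i. v i \<otimes>\<^sub>t 1) (\<lambda>u i. cext c i u)"
  unfolding betti_basis_def betti_scale_complex_def by (blast intro: quotient_basis_complex)

text \<open>The difference of the two sides is an eigenvector both for \<open>t\<close> and for
  \<open>- t\<close>, hence zero because two is invertible. So a rational basis of H_B^t generates
  the whole \<open>t\<close>-eigenspace after extension of scalars.\<close>

lemma betti_basis_coord_complex_eq:
  assumes t: "t \<in> {1, -1}" and v: "betti_basis t I v c"
    and u: "rho_complex X u = sU (of_int t) u"
  shows "u = (\<Sum>i\<in>I. sU (cext c i u) (v i \<otimes>\<^sub>t 1))"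
proof -
  define y where "y = (\<Sum>i\<in>I. sU (cext c i u) (v i \<otimes>\<^sub>t 1))"
  have "u - y \<in> subspace_complex sB (betti_part X (- t))"
    unfolding y_def by (rule quotient_basis.coord_approx[OF betti_basis_complex[OF v]])
  then have "rho_complex X (u - y) = - sU (of_int t) (u - y)"
    by (simp add: rho_complex_betti_part)
  moreover have "v i \<otimes>\<^sub>t 1 \<in> subspace_complex sB (betti_part X t)" if "i \<in> I" for i
    unfolding subspace_complex_def betti_scale_complex_def[symmetric] using v that
    by (intro U.span_base imageI) (auto simp: betti_basis_def)
  then have "y \<in> subspace_complex sB (betti_part X t)"
    unfolding y_def subspace_complex_def betti_scale_complex_def[symmetric]
    by (intro U.span_sum U.span_scale)
  then have "rho_complex X (u - y) = sU (of_int t) (u - y)"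
    by (simp add: rho_complex_betti_part rhoc.diff u U.scale_right_diff_distrib)
  ultimately have "sU (of_int t) (u - y) + sU (of_int t) (u - y) = 0"
    by (metis add.left_inverse)
  then have "sU (of_int t) (u - y) = 0" by (rule coeff_module_double_eq_0[OF U.module_axioms])
  then have "sU (of_int t) (sU (of_int t) (u - y)) = 0" by simp
  then have "u - y = 0" using t by auto
  then show ?thesis by (simp add: y_def)
qed

lemma betti_basis_sum:
  assumes v: "betti_basis 1 I v c" and v': "betti_basis (-1) J v' c'"
  shows "quotient_basis sB {0} (I <+> J) (case_sum v v') (\<lambda>x. case_sum (c x) (c' x))"
proof -
  interpret v: quotient_basis sB "betti_part X (-1)" I v c
    using v by (simp add: betti_basis_def)
  interpret v': quotient_basis sB "betti_part X 1" J v' c'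
    using v' by (simp add: betti_basis_def)
  have sub: "v i \<in> betti_part X 1" if "i \<in> I" for i using v that by (auto simp: betti_basis_def)
  have sub': "v' j \<in> betti_part X (-1)" if "j \<in> J" for j using v' that by (auto simp: betti_basis_def)
  show ?thesis
  proof unfold_locales
    show "finite (I <+> J)" by (simp add: v.finite_index v'.finite_index)
    fix x
    define y where "y = (\<Sum>i\<in>I. sB (c x i) (v i))"
    define z where "z = (\<Sum>j\<in>J. sB (c' x j) (v' j))"
    have y: "y \<in> betti_part X 1" and z: "z \<in> betti_part X (-1)"
      unfolding y_def z_def
      by (intro B.subspace_sum B.subspace_scale subspace_betti_part sub sub'; assumption)+
    have "x - y \<in> betti_part X (-1)" "x - z \<in> betti_part X 1"
      unfolding y_def z_def by (rule v.coord_approx v'.coord_approx)+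
    then have "x - y - z \<in> betti_part X 1 \<inter> betti_part X (-1)"
      using B.subspace_diff[OF subspace_betti_part _ z, of "x - y"]
        B.subspace_diff[OF subspace_betti_part _ y, of "x - z"] by (simp add: algebra_simps)
    then have "x - y - z = 0" using betti_part_Int[of 1] by simp
    moreover have "(\<Sum>k\<in>I <+> J. sB (case_sum (c x) (c' x) k) (case_sum v v' k)) = y + z"
      unfolding y_def z_def by (simp add: sum.Plus v.finite_index v'.finite_index)
    ultimately show "x - (\<Sum>k\<in>I <+> J. sB (case_sum (c x) (c' x) k) (case_sum v v' k)) \<in> {0}"
      by (simp add: algebra_simps)
  qed (auto simp: v.coord_add v'.coord_add v.coord_scale v'.coord_scale v.coord_0 v'.coord_0
      v.coord_basis v'.coord_basis sub sub' v.coord_vanish v'.coord_vanish split: if_splits)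
qed

end

section \<open>Hodge bases\<close>

context realization
begin

text \<open>In a rational basis adapted to the two eigenspaces, \<rho> is diagonal with trace d^+ -
  d^-. Ranks and traces do not depend on the basis, so the same integers are obtained from any basis
  over E \<otimes> \<complex>, in particular from a Hodge basis.\<close>

lemma
  assumes basis: "quotient_basis sU {0} H e C"
  shows card_basis: "card H = betti_part_dim X 1 + betti_part_dim X (-1)"
    and trace_rho: "(\<Sum>h\<in>H. C (rho_complex X (e h)) h) =
      of_int (int (betti_part_dim X 1) - int (betti_part_dim X (-1)))"
proof -
  obtain vs c where v: "betti_basis 1 {..<length vs} (nth vs) c"
    using ex_betti_basis_nat[of 1] by auto
  obtain vs' c' where v': "betti_basis (-1) {..<length vs'} (nth vs') c'"
    using ex_betti_basis_nat[of "-1"] by auto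
  let ?I = "{..<length vs}" and ?J = "{..<length vs'}"
  have d: "betti_part_dim X 1 = card ?I" "betti_part_dim X (-1) = card ?J"
    using betti_part_dim_eq[OF _ v] betti_part_dim_eq[OF _ v'] by auto
  have "quotient_basis sU (subspace_complex sB {0}) (?I <+> ?J)
      (\<lambda>i. case_sum (nth vs) (nth vs') i \<otimes>\<^sub>t 1)
      (\<lambda>u i. tensor_map (\<lambda>x. case_sum (c x) (c' x) i) id u)" (is "quotient_basis _ _ _ ?v ?C")
    unfolding betti_scale_complex_def by (rule quotient_basis_complex[OF betti_basis_sum[OF v v']])
  moreover have "subspace_complex sB {0} = {0}"
    by (simp add: subspace_complex_def betti_scale_complex_def[symmetric] pure_tensor_left.zero
        U.span_singleton image_constant_conv)
  ultimately have V: "quotient_basis sU {0} (?I <+> ?J) ?v ?C" by simp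
  interpret V: quotient_basis sU "{0}" "?I <+> ?J" ?v ?C by (rule V)
  show "card H = betti_part_dim X 1 + betti_part_dim X (-1)"
    using quotient_basis_card[OF basis V] by (simp add: d card_Plus)
  have vsB: "vs ! i \<in> betti_part X 1" if "i \<in> ?I" for i
    using v that by (auto simp: betti_basis_def)
  have vsB': "vs' ! i \<in> betti_part X (-1)" if "i \<in> ?J" for i
    using v' that by (auto simp: betti_basis_def)
  have "(\<Sum>h\<in>H. C (rho_complex X (e h)) h) = (\<Sum>i\<in>?I <+> ?J. ?C (rho_complex X (?v i)) i)"
    by (rule quotient_basis_trace[OF basis V rhoc.module_hom_axioms]) (simp add: rhoc.zero)
  also have "\<dots> = (\<Sum>i\<in>?I <+> ?J. case_sum (\<lambda>_. 1) (\<lambda>_. -1) i)"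
  proof (rule sum.cong)
    fix i assume i: "i \<in> ?I <+> ?J"
    have "rho_complex X (?v i) = sU (case_sum (\<lambda>_. 1) (\<lambda>_. -1) i) (?v i)"
      using i
    proof (elim PlusE)
      fix a assume "a \<in> ?I" "i = Inl a"
      then show ?thesis using vsB[of a] by (simp add: rho_complex_pure betti_part_def)
    next
      fix a assume "a \<in> ?J" "i = Inr a"
      then show ?thesis using vsB'[of a]
        by (simp add: rho_complex_pure betti_part_def pure_tensor_left.minus)
    qed
    then have "?C (rho_complex X (?v i)) i = case_sum (\<lambda>_. 1) (\<lambda>_. -1) i * ?C (?v i) i"
      using V.coord_scale[OF i] by (simp only:)
    also have "\<dots> = case_sum (\<lambda>_. 1) (\<lambda>_. -1) i" unfolding V.coord_basis[OF i i] by simp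
    finally show "?C (rho_complex X (?v i)) i = case_sum (\<lambda>_. 1) (\<lambda>_. -1) i" .
  qed simp
  also have "\<dots> = of_int (int (card ?I) - int (card ?J))"
    by (simp add: sum.Plus)
  finally show "(\<Sum>h\<in>H. C (rho_complex X (e h)) h) =
      of_int (int (betti_part_dim X 1) - int (betti_part_dim X (-1)))"
    unfolding d .
qed

end

text \<open>The index set is abstract, so that pairs of Hodge types are allowed too;
  \<open>dg\<close> is the Hodge degree p of an index. Several indices may have the middle degree
  \<open>m\<close>: \<open>mid\<close> is only required to be the one fixed point of
  \<open>\<iota>\<close>. That no other index has degree \<open>m\<close> is a separate condition,
  which for the tensor product comes from criticality. \<open>wm\<close> is the rational vector to
  which the image of \<open>e mid\<close> is congruent modulo F^(m+1).\<close>

locale hodge_basis = realization X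
  for X :: "('e :: field_char_0, 'b :: ab_group_add, 'r :: ab_group_add) motive" +
  fixes H :: "'i set" and dg :: "'i \<Rightarrow> int" and \<iota> :: "'i \<Rightarrow> 'i"
    and e :: "'i \<Rightarrow> ('b, complex) tensor" and C :: "('b, complex) tensor \<Rightarrow> 'i \<Rightarrow> 'e coeff"
    and mid :: 'i and m :: int and eps :: int and wm :: 'r
  assumes basis: "quotient_basis (betti_scale_complex X) {0} H e C"
    and \<iota>_in: "h \<in> H \<Longrightarrow> \<iota> h \<in> H"
    and \<iota>_\<iota>: "h \<in> H \<Longrightarrow> \<iota> (\<iota> h) = h"
    and dg_\<iota>: "h \<in> H \<Longrightarrow> dg (\<iota> h) = 2 * m - dg h"
    and \<iota>_fix: "h \<in> H \<Longrightarrow> \<iota> h = h \<longleftrightarrow> h = mid"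
    and mid_in: "mid \<in> H"
    and eps: "eps \<in> {1, -1}"
    and rho_basis: "h \<in> H \<Longrightarrow> rho_complex X (e h) = betti_scale_complex X (of_int eps) (e (\<iota> h))"
    and fil_iff: "comparison X u \<in> fil_complex X p \<longleftrightarrow> (\<forall>h\<in>H. dg h < p \<longrightarrow> C u h = 0)"
    and wm_in: "wm \<in> fil X m"
    and wm: "comparison X (e mid) - wm \<otimes>\<^sub>t 1 \<in> fil_complex X (m + 1)"
begin

sublocale E: quotient_basis "betti_scale_complex X" "{0}" H e C
  by (rule basis)

lemma expand: "u = (\<Sum>h\<in>H. sU (C u h) (e h))"
  using E.coord_approx[of u] by simp

lemma \<iota>_mid: "\<iota> mid = mid"
  using \<iota>_fix mid_in by blast

lemma dg_mid: "dg mid = m"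
  using dg_\<iota>[OF mid_in] \<iota>_mid by simp

lemma bij_\<iota>: "bij_betw \<iota> H H"
  by (rule bij_betw_byWitness[where f' = \<iota>]) (auto simp: \<iota>_in \<iota>_\<iota>)

lemma coord_rho:
  assumes h: "h \<in> H"
  shows "C (rho_complex X u) h = of_int eps * C u (\<iota> h)"
proof -
  have "rho_complex X u = (\<Sum>g\<in>H. sU (C u g) (sU (of_int eps) (e (\<iota> g))))"
    by (subst expand) (simp add: rhoc.sum rhoc.scale rho_basis)
  then have "C (rho_complex X u) h = (\<Sum>g\<in>H. C u g * (of_int eps * C (e (\<iota> g)) h))"
    using h by (simp only: E.coord_sum E.coord_scale)
  also have "\<dots> = (\<Sum>g\<in>H. if g = \<iota> h then of_int eps * C u g else 0)"
    using h by (intro sum.cong refl) (auto simp: E.coord_basis \<iota>_in \<iota>_\<iota>)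
  also have "\<dots> = of_int eps * C u (\<iota> h)"
    using h by (simp add: E.finite_index \<iota>_in)
  finally show ?thesis .
qed

text \<open>\<rho> permutes the basis up to the factor \<open>eps\<close>, and \<open>mid\<close> is
  the only index left in place, so its trace is \<open>eps\<close>. The trace formula turns this
  into the difference of the two dimensions.\<close>

lemma betti_part_dims:
  "card H = betti_part_dim X 1 + betti_part_dim X (-1)"
  "int (betti_part_dim X 1) - int (betti_part_dim X (-1)) = eps"
proof -
  show "card H = betti_part_dim X 1 + betti_part_dim X (-1)" by (rule card_basis[OF basis])
  have "C (rho_complex X (e h)) h = (if h = mid then of_int eps else 0)" if h: "h \<in> H" for h
  proof -
    have "C (rho_complex X (e h)) h = of_int eps * C (e h) (\<iota> h)" using h by (rule coord_rho)
    also have "\<dots> = (if h = mid then of_int eps else 0)"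
      using h \<iota>_fix[OF h] by (auto simp: E.coord_basis \<iota>_in)
    finally show ?thesis .
  qed
  then have "(\<Sum>h\<in>H. C (rho_complex X (e h)) h) = of_int eps"
    using mid_in E.finite_index by simp
  then show "int (betti_part_dim X 1) - int (betti_part_dim X (-1)) = eps"
    unfolding trace_rho[OF basis] by (simp only: of_int_eq_iff)
qed

lemma dim_eps: "betti_part_dim X eps = betti_part_dim X (- eps) + 1"
  using eps betti_part_dims(2) by auto

lemma card_H: "card H = 2 * betti_part_dim X (- eps) + 1"
  using eps betti_part_dims by auto

lemma basis_fil:
  "quotient_basis sU {u. T u \<in> fil_complex X p} {h \<in> H. dg h < p} e C"
proof unfold_locales
  fix x
  have "C (x - (\<Sum>h\<in>{h \<in> H. dg h < p}. sU (C x h) (e h))) g = 0" if g: "g \<in> H" "dg g < p" for g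
  proof -
    have "C (\<Sum>h\<in>{h \<in> H. dg h < p}. sU (C x h) (e h)) g =
        (\<Sum>h\<in>{h \<in> H. dg h < p}. C x h * C (e h) g)"
      by (simp only: E.coord_lincomb[OF g(1)])
    also have "\<dots> = (\<Sum>h\<in>{h \<in> H. dg h < p}. if h = g then C x h else 0)"
      using g by (intro sum.cong refl) (simp add: E.coord_basis)
    also have "\<dots> = C x g" using g E.finite_index by simp
    finally show ?thesis using g by (simp add: E.coord_diff)
  qed
  then show "x - (\<Sum>h\<in>{h \<in> H. dg h < p}. sU (C x h) (e h)) \<in> {u. T u \<in> fil_complex X p}"
    by (simp add: fil_iff)
qed (auto simp: E.finite_index E.coord_add E.coord_scale E.coord_basis fil_iff)

lemma basis_de_rham:
  assumes "quotient_basis sD (fil X p) I w c"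
  shows "quotient_basis sW (fil_complex X p) I (\<lambda>i. w i \<otimes>\<^sub>t 1) (\<lambda>u i. cext c i u)"
    and "quotient_basis sU {u. T u \<in> fil_complex X p} I (\<lambda>i. inv_into UNIV T (w i \<otimes>\<^sub>t 1))
       (\<lambda>u i. cext c i (T u))"
proof -
  show *: "quotient_basis sW (fil_complex X p) I (\<lambda>i. w i \<otimes>\<^sub>t 1) (\<lambda>u i. cext c i u)"
    unfolding dr_scale_complex_def fil_complex_def by (rule quotient_basis_complex[OF assms])
  show "quotient_basis sU {u. T u \<in> fil_complex X p} I (\<lambda>i. inv_into UNIV T (w i \<otimes>\<^sub>t 1))
       (\<lambda>u i. cext c i (T u))"
    by (rule quotient_basis.pullback[OF * T.module_hom_axioms]) (rule comparison_inv)
qed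

text \<open>Over E \<otimes> \<complex> and through the comparison isomorphism, a basis of H_DR
  modulo F^p and the Hodge vectors of degree below \<open>p\<close> are bases of the same
  quotient.\<close>

lemma codim_fil:
  assumes "quotient_basis sD (fil X p) I w c"
  shows "card I = card {h \<in> H. dg h < p}"
  by (rule quotient_basis_card[OF basis_de_rham(2)[OF assms] basis_fil])

lemma codim_fil_ordered:
  assumes "ordered_basis_mod sD UNIV (fil X p) ws"
  shows "length ws = card {h \<in> H. dg h < p}"
  using ordered_basis_mod_imp_quotient_basis[OF module_D subspace_fil assms] codim_fil by fastforce

definition positive :: "'i set" where
  "positive = {h \<in> H. dg h > m}"

lemma bij_\<iota>_positive: "bij_betw \<iota> positive {h \<in> H. dg h < m}"
  by (rule bij_betw_byWitness[where f' = \<iota>]) (auto simp: positive_def \<iota>_in \<iota>_\<iota> dg_\<iota>)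

lemma finite_positive: "finite positive"
  by (simp add: positive_def E.finite_index)

lemma card_H_eq: "card H = 2 * card positive + card {h \<in> H. dg h = m}"
proof -
  have "H = positive \<union> ({h \<in> H. dg h < m} \<union> {h \<in> H. dg h = m})" by (auto simp: positive_def)
  then have "card H = card (positive \<union> ({h \<in> H. dg h < m} \<union> {h \<in> H. dg h = m}))" by simp
  also have "\<dots> = card positive + (card {h \<in> H. dg h < m} + card {h \<in> H. dg h = m})"
    by (subst card_Un_disjoint, use E.finite_index in \<open>auto simp: positive_def\<close>)+
  finally show ?thesis using bij_betw_same_card[OF bij_\<iota>_positive] by simp
qed

text \<open>
  If \<open>z\<close> indices have degree \<open>m\<close>, then no filtration step has codimension strictly between
  \<open>(d - z) / 2\<close> and \<open>(d + z) / 2\<close>, but one of codimension \<open>(d + 1) / 2\<close> must exist.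
\<close>

lemma critical_imp_middle:
  assumes "critical X" and h: "h \<in> H" "dg h = m"
  shows "h = mid"
proof -
  let ?Z = "{h \<in> H. dg h = m}"
  have finZ: "finite ?Z" by (simp add: E.finite_index)
  have "\<exists>F. is_fil_step X (- eps) F" using assms(1) eps by (auto simp: critical_def)
  then obtain p ws where ws: "ordered_basis_mod sD UNIV (fil X p) ws" "length ws = betti_part_dim X eps"
    by (auto simp: is_fil_step_def)
  then have p: "card {h \<in> H. dg h < p} = betti_part_dim X (- eps) + 1"
    using codim_fil_ordered dim_eps by simp
  have neg: "card {h \<in> H. dg h < m} = card positive"
    using bij_betw_same_card[OF bij_\<iota>_positive] by simp
  have Z: "card ?Z \<ge> 1"
    using card_mono[OF finZ, of "{mid}"] mid_in dg_mid by simp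
  have "m < p"
  proof (rule ccontr)
    assume "\<not> m < p"
    then have "card {h \<in> H. dg h < p} \<le> card {h \<in> H. dg h < m}"
      by (intro card_mono) (auto simp: E.finite_index)
    then show False using p neg card_H card_H_eq Z by linarith
  qed
  then have "card ({h \<in> H. dg h < m} \<union> ?Z) \<le> card {h \<in> H. dg h < p}"
    by (intro card_mono) (auto simp: E.finite_index)
  moreover have "card ({h \<in> H. dg h < m} \<union> ?Z) = card {h \<in> H. dg h < m} + card ?Z"
    by (rule card_Un_disjoint) (auto simp: E.finite_index)
  ultimately have "card ?Z \<le> 1" using p neg card_H card_H_eq Z by linarith
  then show ?thesis
    using h mid_in dg_mid finZ by (auto simp: card_le_Suc0_iff_eq)
qed

end

section \<open>Period determinants\<close>

lemma rational_units_mult: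
  "a \<in> rational_units \<Longrightarrow> b \<in> rational_units \<Longrightarrow> a * b \<in> rational_units"
  by (auto simp: rational_units_def times_pure_tensor)

lemma rational_units_power: "a \<in> rational_units \<Longrightarrow> a ^ n \<in> rational_units"
proof (induction n)
  case 0
  have "(1 :: 'a coeff) = 1 \<otimes>\<^sub>t 1" by (simp add: one_tensor_def)
  then show ?case unfolding rational_units_def by auto
qed (simp add: rational_units_mult)

lemma of_int_rational_unit: "n \<noteq> 0 \<Longrightarrow> (of_int n :: 'e :: field_char_0 coeff) \<in> rational_units"
  unfolding of_int_tensor rational_units_def by auto

lemma rational_units_dvd_one: "a \<in> rational_units \<Longrightarrow> a dvd 1"
  by (auto simp: rational_units_def pure_tensor_one_dvd_one)

lemma det_on_eq_det:
  assumes "A \<in> carrier_mat n n"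
  shows "det_on {..<n} (\<lambda>i j. A $$ (i, j)) = det A"
proof -
  have "bij_betw id {0..<n} {..<n}" by (auto simp: bij_betw_def)
  from det_on_enum[OF this, of "\<lambda>i j. A $$ (i, j)"] show ?thesis
    using assms by (simp add: mat_eq_iff) (metis (no_types, lifting) assms case_prod_conv carrier_matD
      dim_col_mat(1) dim_row_mat(1) eq_matI index_mat(1))
qed

locale critical_hodge_basis = hodge_basis X H dg \<iota> e C mid m eps wm
  for X :: "('e :: field_char_0, 'b :: ab_group_add, 'r :: ab_group_add) motive"
    and H :: "'i set" and dg \<iota> e C mid m eps wm +
  assumes middle: "h \<in> H \<Longrightarrow> dg h = m \<Longrightarrow> h = mid"
begin

definition Pos :: "int \<Rightarrow> 'i set" where
  "Pos t = (if t = eps then insert mid positive else positive)"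

lemma mid_notin_positive: "mid \<notin> positive"
  by (simp add: positive_def dg_mid)

lemma finite_Pos: "finite (Pos t)"
  by (simp add: Pos_def finite_positive)

lemma Pos_subset: "Pos t \<subseteq> H"
  by (auto simp: Pos_def positive_def mid_in)

lemma Pos_cases:
  assumes "h \<in> Pos t"
  obtains "h = mid" "t = eps" | "h \<in> positive" "h \<noteq> mid"
  using assms mid_notin_positive by (auto simp: Pos_def split: if_splits)

lemma card_positive: "card positive = betti_part_dim X (- eps)"
proof -
  have "{h \<in> H. dg h = m} = {mid}" using mid_in dg_mid by (auto intro: middle)
  then have "card {h \<in> H. dg h = m} = 1" by simp
  then show ?thesis using card_H card_H_eq by linarith
qed

lemma card_Pos: "t \<in> {1, -1} \<Longrightarrow> card (Pos t) = betti_part_dim X t"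
  using eps dim_eps card_positive mid_notin_positive finite_positive by (auto simp: Pos_def)

text \<open>The Hodge degree at which the filtration step of sign \<open>- t\<close> starts.\<close>

definition step :: "int \<Rightarrow> int" where
  "step t = (if t = eps then m + 1 else m)"

lemma \<iota>_Pos: "\<iota> ` Pos t = {h \<in> H. dg h < step t}"
proof -
  have "\<iota> ` positive = {h \<in> H. dg h < m}" using bij_\<iota>_positive by (simp add: bij_betw_def)
  moreover have "{h \<in> H. dg h < m + 1} = insert mid {h \<in> H. dg h < m}"
    using mid_in dg_mid by (auto intro: middle simp: zless_add1_eq)
  ultimately show ?thesis by (simp add: Pos_def step_def \<iota>_mid)
qed

lemma bij_\<iota>_Pos: "bij_betw \<iota> (Pos t) {h \<in> H. dg h < step t}"
  unfolding \<iota>_Pos[symmetric]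
  using bij_betw_subset[OF bij_\<iota> Pos_subset] by (simp add: bij_betw_def inj_on_subset)

text \<open>The sets of indices below a bound are nested, so their size determines them. The
  codimension alone therefore identifies the filtration step, even though several values of
  \<open>p\<close> may define it.\<close>

lemma degrees_below_eq:
  assumes "card {h \<in> H. dg h < p} = card (Pos t)"
  shows "{h \<in> H. dg h < p} = {h \<in> H. dg h < step t}"
proof -
  have card: "card {h \<in> H. dg h < p} = card {h \<in> H. dg h < step t}"
    using assms bij_betw_same_card[OF bij_\<iota>_Pos] by simp
  show ?thesis
  proof (cases "p \<le> step t")
    case True
    then show ?thesis using card by (intro card_subset_eq) (auto simp: E.finite_index)
  next
    case False
    then show ?thesis using card by (intro card_subset_eq[symmetric]) (auto simp: E.finite_index)
  qed
qed

lemma fil_complex_eq: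
  assumes "{h \<in> H. dg h < p} = {h \<in> H. dg h < p'}"
  shows "fil_complex X p = fil_complex X p'"
proof -
  have "T u \<in> fil_complex X p \<longleftrightarrow> T u \<in> fil_complex X p'" for u
    unfolding fil_iff using assms by blast
  then show ?thesis by (metis comparison_inv subsetI subset_antisym)
qed

text \<open>The determinant of P_t in the overview, where \<open>v\<close> is meant to be a rational
  basis of H_B^t indexed by \<open>Pos t\<close>.\<close>

definition minor :: "int \<Rightarrow> ('i \<Rightarrow> 'b) \<Rightarrow> 'e coeff" where
  "minor t v = det_on (Pos t) (\<lambda>h i. C (v i \<otimes>\<^sub>t 1) h)"

lemma coord_betti_part:
  assumes "h \<in> H" "x \<in> betti_part X t"
  shows "C (x \<otimes>\<^sub>t 1) (\<iota> h) = of_int (t * eps) * C (x \<otimes>\<^sub>t 1) h"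
proof -
  have "rho_complex X (x \<otimes>\<^sub>t 1) = sU (of_int t) (x \<otimes>\<^sub>t 1)"
    using assms(2) by (simp add: rho_complex_pure betti_part_def betti_scale_complex_def
        scale_complex_pure[OF module_B] of_int_tensor)
  then have "of_int t * C (x \<otimes>\<^sub>t 1) h = of_int eps * C (x \<otimes>\<^sub>t 1) (\<iota> h)"
    using coord_rho[OF assms(1), of "x \<otimes>\<^sub>t 1"] by (simp add: E.coord_scale[OF assms(1)])
  then have "of_int eps * (of_int t * C (x \<otimes>\<^sub>t 1) h) = of_int (eps * eps) * C (x \<otimes>\<^sub>t 1) (\<iota> h)"
    by (simp add: mult.assoc)
  then show ?thesis using eps by (auto simp: mult_ac)
qed

text \<open>The symmetrized Hodge vectors lie in the \<open>t\<close>-eigenspace and are dual to the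
  coordinates at \<open>Pos t\<close>. Their expansions in the rational basis \<open>v\<close> form
  the inverse of the matrix in question.\<close>

lemma minor_dvd_one:
  assumes t: "t \<in> {1, -1}" and v: "betti_basis t (Pos t) v c"
  shows "minor t v dvd 1"
proof -
  \<comment> \<open>\<open>e mid\<close> is already an eigenvector of sign \<open>eps\<close>;
    symmetrizing it would count it twice.\<close>
  define f where "f g = e g + (if g = mid then 0 else sU (of_int (t * eps)) (e (\<iota> g)))" for g
  have f: "rho_complex X (f g) = sU (of_int t) (f g)" if g: "g \<in> Pos t" for g
    using g
  proof (cases rule: Pos_cases)
    case 1
    then show ?thesis by (simp add: f_def rho_basis[OF mid_in] \<iota>_mid)
  next
    case 2
    have gH: "g \<in> H" using g Pos_subset by blast
    have "t * eps * eps = t" "t * (t * eps) = eps" using t eps by auto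
    then have "of_int (t * eps) * of_int eps = (of_int t :: 'e coeff)"
      "of_int t * of_int (t * eps) = (of_int eps :: 'e coeff)"
      by (metis of_int_mult)+
    then show ?thesis using 2 gH
      by (simp add: f_def rhoc.add rhoc.scale rho_basis \<iota>_in \<iota>_\<iota> U.scale_right_distrib add.commute
          del: of_int_mult)
  qed
  have Cf: "C (f g) h = (if g = h then 1 else 0)" if g: "g \<in> Pos t" and h: "h \<in> Pos t" for g h
    using g
  proof (cases rule: Pos_cases)
    case 1
    then show ?thesis using h Pos_subset by (simp add: f_def E.coord_basis mid_in subset_iff)
  next
    case 2
    have H: "g \<in> H" "h \<in> H" "\<iota> g \<in> H" using g h Pos_subset \<iota>_in by auto
    \<comment> \<open>The partner of an index above the middle lies below it, where
      \<open>Pos t\<close> has no elements, so it leaves the coordinates at \<open>Pos t\<close>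
      alone.\<close>
    have "dg (\<iota> g) < m" using 2 H by (simp add: dg_\<iota> positive_def)
    moreover have "dg h \<ge> m" using h by (auto simp: Pos_def positive_def dg_mid split: if_splits)
    ultimately have "\<iota> g \<noteq> h" by auto
    then show ?thesis using 2 H
      by (simp add: f_def E.coord_add E.coord_scale E.coord_basis)
  qed
  have "(\<Sum>i\<in>Pos t. C (v i \<otimes>\<^sub>t 1) h * cext c i (f g)) = (if h = g then 1 else 0)"
    if g: "g \<in> Pos t" and h: "h \<in> Pos t" for g h
  proof -
    have hH: "h \<in> H" using h Pos_subset by blast
    have "C (f g) h = C (\<Sum>i\<in>Pos t. sU (cext c i (f g)) (v i \<otimes>\<^sub>t 1)) h"
      using betti_basis_coord_complex_eq[OF t v f[OF g]] by simp
    then have "(\<Sum>i\<in>Pos t. C (v i \<otimes>\<^sub>t 1) h * cext c i (f g)) = C (f g) h"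
      by (simp add: E.coord_lincomb[OF hH] mult.commute)
    then show ?thesis unfolding Cf[OF g h] by (simp add: eq_commute[of g])
  qed
  then show ?thesis
    unfolding minor_def
    by (intro det_on_dvd_one[where B = "\<lambda>i g. cext c i (f g)"] finite_Pos)
qed

text \<open>This is the transition matrix between two bases of one quotient: the pullback of
  \<open>w\<close>, and the Hodge vectors of degree below \<open>step t\<close>, which \<iota>
  identifies with \<open>Pos t\<close>.\<close>

lemma de_rham_matrix_dvd_one:
  assumes w: "quotient_basis sD (fil X p) (Pos t) w c"
  shows "det_on (Pos t) (\<lambda>i h. cext c i (T (e (\<iota> h)))) dvd 1"
proof -
  have "{h \<in> H. dg h < p} = {h \<in> H. dg h < step t}"
    using codim_fil[OF w] by (intro degrees_below_eq) simp
  then have "quotient_basis sU {u. T u \<in> fil_complex X p} {h \<in> H. dg h < step t} e C"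
    using basis_fil[of p] by simp
  from quotient_basis_matrix_dvd_one[OF basis_de_rham(2)[OF w] quotient_basis.reindex[OF this bij_\<iota>_Pos]]
  show ?thesis .
qed

text \<open>For the sign \<open>- eps\<close> both determinants belong to the quotient by F^m, and a
  change of basis over the coefficient field relates them. For the sign \<open>eps\<close> the
  quotient by F^(m+1) has one more dimension. There the rational vectors \<open>w0\<close> and
  \<open>wm\<close> serve as an intermediate family, with respect to which the column of
  \<open>mid\<close> is zero except for a one on the diagonal; so the additional dimension does not
  change the determinant beyond a rational factor.\<close>

lemma de_rham_matrix_eq:
  assumes t: "t \<in> {1, -1}" and w0: "quotient_basis sD (fil X m) positive w0 c0"
    and w: "quotient_basis sD (fil X p) (Pos t) w c"
  shows "\<exists>r\<in>rational_units. det_on (Pos t) (\<lambda>i h. cext c i (T (e (\<iota> h)))) =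
    r * det_on positive (\<lambda>i h. cext c0 i (T (e (\<iota> h))))"
proof -
  define B where "B i h = cext c i (T (e (\<iota> h)))" for i h
  define B0 where "B0 i h = cext c0 i (T (e (\<iota> h)))" for i h
  define w1 where "w1 k = (if k = mid then wm else w0 k)" for k
  interpret W: quotient_basis sW "fil_complex X p" "Pos t" "\<lambda>i. w i \<otimes>\<^sub>t 1"
    "\<lambda>u i. cext c i u"
    by (rule basis_de_rham(1)[OF w])
  interpret W0: quotient_basis sW "fil_complex X m" positive "\<lambda>i. w0 i \<otimes>\<^sub>t 1"
    "\<lambda>u i. cext c0 i u"
    by (rule basis_de_rham(1)[OF w0])
  interpret w: quotient_basis sD "fil X p" "Pos t" w c by (rule w)
  have p: "fil_complex X p = fil_complex X (step t)"
    using codim_fil[OF w] by (intro fil_complex_eq degrees_below_eq) simp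
  \<comment> \<open>Once its \<open>w0\<close> part is subtracted, the vector lies in F^m. Modulo
    F^(m+1) it is then a multiple of the image of \<open>e mid\<close>, hence of \<open>wm\<close>,
    and \<open>r h\<close> is the multiplier.\<close>
  define r where "r h = C (inv_into UNIV T
    (T (e (\<iota> h)) - (\<Sum>i\<in>positive. sW (B0 i h) (w0 i \<otimes>\<^sub>t 1)))) mid" for h
  define B1 where "B1 k h = (if k = mid then r h else B0 k h)" for k h
  have B_eq: "B i h = (\<Sum>k\<in>Pos t. (c (w1 k) i \<otimes>\<^sub>t 1) * B1 k h)" if i: "i \<in> Pos t" for i h
  proof -
    let ?c = "\<lambda>u. cext c i u"
    interpret c: Modules.module_hom sW "(*)" ?c by (rule W.coord_hom[OF i])
    have c_pure: "?c (x \<otimes>\<^sub>t 1) = c x i \<otimes>\<^sub>t 1" for x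
      by (subst tensor_map_pure[OF additive_module_hom[OF w.coord_hom[OF i]] additive_id]) simp
    define y where "y = T (e (\<iota> h)) - (\<Sum>i\<in>positive. sW (B0 i h) (w0 i \<otimes>\<^sub>t 1))"
    have "y \<in> fil_complex X m" unfolding y_def B0_def by (rule W0.coord_approx)
    moreover define u where "u = inv_into UNIV T y"
    ultimately have Tu: "T u = y" "T u \<in> fil_complex X m" by (simp_all add: comparison_inv)
    have "?c y = (if t = eps then r h * (c wm i \<otimes>\<^sub>t 1) else 0)"
    proof (cases "t = eps")
      case True
      then have p': "fil_complex X p = fil_complex X (m + 1)" by (simp add: p step_def)
      have "T (u - sU (C u mid) (e mid)) \<in> fil_complex X (m + 1)"
        unfolding fil_iff
      proof (intro ballI impI)
        fix g assume g: "g \<in> H" "dg g < m + 1"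
        show "C (u - sU (C u mid) (e mid)) g = 0"
        proof (cases "g = mid")
          case False
          then have "dg g < m" using g middle[of g] by (cases "dg g = m") auto
          then have "C u g = 0" using g Tu(2) by (simp add: fil_iff)
          then show ?thesis using False g by (simp add: E.coord_diff E.coord_scale E.coord_basis mid_in)
        qed (simp add: E.coord_diff E.coord_scale E.coord_basis mid_in)
      qed
      then have 1: "?c (T (u - sU (C u mid) (e mid))) = 0" using W.coord_vanish[OF i] p' by simp
      have 2: "?c (T (e mid) - wm \<otimes>\<^sub>t 1) = 0" using W.coord_vanish[OF i] p' wm by simp
      have "?c (T u) = C u mid * ?c (T (e mid))"
        using 1 by (simp add: T.diff T.scale c.diff c.scale)
      also have "?c (T (e mid)) = c wm i \<otimes>\<^sub>t 1" using 2 by (simp add: c.diff c_pure)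
      also have "C u mid = r h" by (simp add: r_def u_def y_def)
      finally show ?thesis unfolding Tu(1) using True by (simp only: simp_thms if_True)
    next
      case False
      then have "fil_complex X p = fil_complex X m" by (simp add: p step_def)
      then have "?c y = 0" using W.coord_vanish[OF i] Tu by (simp only:)
      then show ?thesis using False by (simp only: if_False)
    qed
    moreover have "?c y = B i h - (\<Sum>k\<in>positive. B0 k h * (c (w0 k) i \<otimes>\<^sub>t 1))"
      by (simp add: y_def c.diff c.sum c.scale c_pure B_def)
    moreover have "(\<Sum>k\<in>positive. (c (w1 k) i \<otimes>\<^sub>t 1) * B1 k h) =
        (\<Sum>k\<in>positive. B0 k h * (c (w0 k) i \<otimes>\<^sub>t 1))"
      using mid_notin_positive by (intro sum.cong) (auto simp: w1_def B1_def mult.commute)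
    ultimately show ?thesis
      using finite_positive mid_notin_positive
      by (simp add: Pos_def w1_def B1_def mult.commute algebra_simps split: if_splits)
  qed
  have B1: "det_on (Pos t) B1 = det_on positive B0"
  proof -
    have B1_positive: "det_on positive B1 = det_on positive B0"
      using mid_notin_positive by (intro det_on_cong finite_positive) (auto simp: B1_def)
    show ?thesis
    proof (cases "t = eps")
      case True
      \<comment> \<open>The image of \<open>e mid\<close> lies in F^m and has no \<open>w0\<close>
        part, so nothing is subtracted from it and its own multiplier is one.\<close>
      have B0_mid: "B0 i mid = 0" if "i \<in> positive" for i
        unfolding B0_def \<iota>_mid
      proof (rule W0.coord_vanish[OF that])
        show "T (e mid) \<in> fil_complex X m"
          unfolding fil_iff using dg_mid by (auto simp: E.coord_basis mid_in)
      qed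
      then have "(\<Sum>i\<in>positive. sW (B0 i mid) (w0 i \<otimes>\<^sub>t 1)) = 0" by simp
      then have "r mid = C (e mid) mid"
        using bij_comparison by (simp add: r_def \<iota>_mid bij_def)
      then have "B1 mid mid = 1" by (simp add: B1_def E.coord_basis mid_in)
      moreover have "det_on (insert mid positive) B1 = det_on positive B1 * B1 mid mid"
        using B0_mid mid_notin_positive by (intro det_on_insert finite_positive) (auto simp: B1_def)
      ultimately show ?thesis using True B1_positive by (simp add: Pos_def)
    qed (simp add: Pos_def B1_positive)
  qed
  have "det_on (Pos t) B = det_on (Pos t) (\<lambda>i h. \<Sum>k\<in>Pos t. (c (w1 k) i \<otimes>\<^sub>t 1) * B1 k h)"
    by (intro det_on_cong finite_Pos B_eq)
  also have "\<dots> = det_on (Pos t) (\<lambda>i k. c (w1 k) i \<otimes>\<^sub>t 1) * det_on positive B0"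
    unfolding B1[symmetric] by (rule det_on_mult[OF finite_Pos])
  finally have eq: "det_on (Pos t) B = det_on (Pos t) (\<lambda>i k. c (w1 k) i \<otimes>\<^sub>t 1) * det_on positive B0" .
  \<comment> \<open>A factor of a unit is a unit; this makes the determinant of the change of basis
    nonzero in the coefficient field.\<close>
  moreover have "det_on (Pos t) B dvd 1"
    unfolding B_def by (rule de_rham_matrix_dvd_one[OF w])
  ultimately have "det_on (Pos t) (\<lambda>i k. c (w1 k) i \<otimes>\<^sub>t (1 :: complex)) dvd 1"
    by (metis dvd_mult_left)
  then have "det_on (Pos t) (\<lambda>i k. c (w1 k) i \<otimes>\<^sub>t (1 :: complex)) \<in> rational_units"
    by (rule det_on_base_unit[OF finite_Pos])
  with eq show ?thesis unfolding B_def B0_def by blast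
qed

end

section \<open>Period classes and the factorization of period matrices\<close>

abbreviation period_class :: "'e :: field_char_0 coeff \<Rightarrow> 'e coeff set" where
  "period_class x \<equiv> rational_units #>\<^bsub>coeff_units\<^esub> x"

lemma period_class_eq:
  "period_class x = (\<lambda>h. h * x) ` rational_units"
  by (auto simp: r_coset_def coeff_units_def)

lemma period_class_rational_mult:
  assumes "r \<in> rational_units"
  shows "period_class (r * x) = period_class x"
proof -
  obtain a where a: "r = a \<otimes>\<^sub>t 1" "a \<noteq> 0" using assms by (auto simp: rational_units_def)
  define q where "q = inverse a \<otimes>\<^sub>t (1 :: complex)"
  have q: "q \<in> rational_units" using a by (auto simp: q_def rational_units_def)
  have qr: "q * r = 1" using a by (simp add: q_def times_pure_tensor one_tensor_def)
  show ?thesis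
    unfolding period_class_eq
  proof (intro equalityI subsetI; elim imageE)
    fix y h assume h: "y = h * (r * x)" "h \<in> rational_units"
    then have "y = (h * r) * x" "h * r \<in> rational_units"
      using assms by (simp_all add: mult.assoc rational_units_mult)
    then show "y \<in> (\<lambda>h. h * x) ` rational_units" by blast
  next
    fix y h assume h: "y = h * x" "h \<in> rational_units"
    have "(h * q) * (r * x) = h * (q * r) * x" by (simp only: mult.assoc)
    then have "y = (h * q) * (r * x)" "h * q \<in> rational_units"
      using h q by (simp_all add: qr rational_units_mult)
    then show "y \<in> (\<lambda>h. h * (r * x)) ` rational_units" by blast
  qed
qed

context critical_hodge_basis
begin

lemma coord_betti_basis:
  assumes t: "t \<in> {1, -1}" and v: "betti_basis t I v c" and x: "x \<in> betti_part X t" and h: "h \<in> H"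
  shows "C (x \<otimes>\<^sub>t 1) h = (\<Sum>i\<in>I. C (v i \<otimes>\<^sub>t 1) h * (c x i \<otimes>\<^sub>t 1))"
proof -
  have "x \<otimes>\<^sub>t (1 :: complex) = (\<Sum>i\<in>I. sB (c x i) (v i)) \<otimes>\<^sub>t 1"
    using betti_basis_coord_eq[OF t v x] by simp
  also have "\<dots> = (\<Sum>i\<in>I. sU (c x i \<otimes>\<^sub>t 1) (v i \<otimes>\<^sub>t 1))"
    by (simp add: pure_tensor_left.sum betti_scale_complex_def scale_complex_pure[OF module_B])
  finally show ?thesis by (simp add: E.coord_lincomb[OF h] mult.commute)
qed

text \<open>Modulo the filtration step only the Hodge vectors at \<iota> g with g in
  \<open>Pos t\<close> survive, and the coordinate at \<iota> g is t * eps times the one at g. So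
  the period matrix is the product of the de Rham matrix, the scalar t * eps, the matrix of
  \<open>minor t v\<close> and a change of basis over the coefficient field. The factor
  \<open>r\<close> collects the scalar, the change of basis and the passage from the de Rham matrix
  to the fixed one over \<open>positive\<close>.\<close>

lemma period_matrix_det:
  assumes t: "t \<in> {1, -1}" and v: "betti_basis t (Pos t) v c"
    and w0: "quotient_basis sD (fil X m) positive w0 c0"
    and A: "is_period_matrix X t A"
  shows "\<exists>r\<in>rational_units. det A =
    r * (det_on positive (\<lambda>i h. cext c0 i (T (e (\<iota> h)))) * minor t v)"
proof -
  obtain p vs ws where F: "is_fil_step X (- t) (fil X p)"
    and vs: "ordered_basis sB (betti_part X t) vs"
    and ws: "ordered_basis_mod sD UNIV (fil X p) ws"
    and A_carrier: "A \<in> carrier_mat (length ws) (length vs)"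
    and A_eq: "\<And>j. j < length vs \<Longrightarrow> T (vs ! j \<otimes>\<^sub>t 1) -
      (\<Sum>i<length ws. sW (A $$ (i, j)) (ws ! i \<otimes>\<^sub>t 1)) \<in> fil_complex X p"
    using A unfolding is_period_matrix_def is_fil_step_def fil_complex_def by blast
  define n where "n = card (Pos t)"
  obtain ws' where "ordered_basis_mod sD UNIV (fil X p) ws'" "length ws' = betti_part_dim X t"
    using F by (auto simp: is_fil_step_def)
  then have n_ws: "length ws = n"
    using codim_fil_ordered[of p ws] codim_fil_ordered[of p ws'] ws card_Pos[OF t] by (simp add: n_def)
  have vs': "set vs \<subseteq> betti_part X t" "ordered_basis_mod sB UNIV (betti_part X (- t)) vs"
    using vs by (simp_all add: ordered_basis_betti_part_iff[OF t])
  then obtain cv where "quotient_basis sB (betti_part X (- t)) {..<length vs} (nth vs) cv"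
    using ordered_basis_mod_imp_quotient_basis[OF module_B subspace_betti_part] by blast
  then have cv: "betti_basis t {..<length vs} (nth vs) cv"
    using vs'(1) by (auto simp: betti_basis_def)
  have n_vs: "length vs = n"
    using betti_part_dim_eq[OF t cv] card_Pos[OF t] by (simp add: n_def)
  obtain cw where cw: "quotient_basis sD (fil X p) {..<length ws} (nth ws) cw"
    using ordered_basis_mod_imp_quotient_basis[OF module_D subspace_fil ws] by blast
  \<comment> \<open>The lists behind the period matrix are reindexed by \<open>Pos t\<close>, so
    that all factors become square matrices over one index set.\<close>
  obtain \<psi> where \<psi>: "bij_betw \<psi> (Pos t) {..<n}"
    using finite_same_card_bij[OF finite_Pos finite_lessThan] by (metis card_lessThan n_def)
  have \<psi>_less: "\<psi> x < n" if "x \<in> Pos t" for x using \<psi> that by (auto simp: bij_betw_def)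
  define v' where "v' y = vs ! \<psi> y" for y
  define cw' where "cw' x k = cw x (\<psi> k)" for x k
  have v': "betti_basis t (Pos t) v' (\<lambda>x k. cv x (\<psi> k))"
    unfolding v'_def using betti_basis_reindex[OF cv] \<psi> n_vs by blast
  have w': "quotient_basis sD (fil X p) (Pos t) (\<lambda>x. ws ! \<psi> x) cw'"
    unfolding cw'_def by (rule quotient_basis.reindex[OF cw]) (use \<psi> n_ws in simp)
  define B where "B i h = cext cw' i (T (e (\<iota> h)))" for i h
  have v'_in: "v' y \<in> betti_part X t" if "y \<in> Pos t" for y
    using v' that by (auto simp: betti_basis_def)
  have entry: "A $$ (\<psi> x, \<psi> y) =
      (\<Sum>g\<in>Pos t. B x g * (of_int (t * eps) * (\<Sum>k\<in>Pos t. C (v k \<otimes>\<^sub>t 1) g * (c (v' y) k \<otimes>\<^sub>t 1))))"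
    if x: "x \<in> Pos t" and y: "y \<in> Pos t" for x y
  proof -
    interpret W: quotient_basis sW "fil_complex X p" "{..<length ws}" "\<lambda>i. ws ! i \<otimes>\<^sub>t 1"
      "\<lambda>u i. cext cw i u"
      by (rule basis_de_rham(1)[OF cw])
    have \<psi>x: "\<psi> x \<in> {..<length ws}" using \<psi>_less[OF x] n_ws by simp
    interpret c: Modules.module_hom sW "(*)" "cext cw (\<psi> x)"
      by (rule W.coord_hom[OF \<psi>x])
    have B: "B x g = cext cw (\<psi> x) (T (e (\<iota> g)))" for g
      by (simp only: B_def cw'_def)
    have "cext cw (\<psi> x) (T (v' y \<otimes>\<^sub>t 1)) = A $$ (\<psi> x, \<psi> y)"
      unfolding v'_def using A_eq[of "\<psi> y"] \<psi>_less[OF y] n_vs \<psi>x by (intro W.coord_unique) simp_all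
    moreover have "cext cw (\<psi> x) (T (v' y \<otimes>\<^sub>t 1)) =
        (\<Sum>h\<in>H. C (v' y \<otimes>\<^sub>t 1) h * cext cw (\<psi> x) (T (e h)))"
      by (subst expand[of "v' y \<otimes>\<^sub>t 1"]) (simp only: T.sum T.scale c.sum c.scale)
    moreover have "\<dots> = (\<Sum>h\<in>{h \<in> H. dg h < step t}.
        C (v' y \<otimes>\<^sub>t 1) h * cext cw (\<psi> x) (T (e h)))"
    proof (rule sum.mono_neutral_right)
      show "\<forall>h\<in>H - {h \<in> H. dg h < step t}.
        C (v' y \<otimes>\<^sub>t 1) h * cext cw (\<psi> x) (T (e h)) = 0"
      proof
        fix h assume h: "h \<in> H - {h \<in> H. dg h < step t}"
        have "fil_complex X p = fil_complex X (step t)"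
          using codim_fil[OF w'] by (intro fil_complex_eq degrees_below_eq) simp
        moreover have "T (e h) \<in> fil_complex X (step t)"
          unfolding fil_iff using h by (auto simp: E.coord_basis)
        ultimately show "C (v' y \<otimes>\<^sub>t 1) h * cext cw (\<psi> x) (T (e h)) = 0"
          using W.coord_vanish[OF \<psi>x, of "T (e h)"] by (simp only: mult_zero_right)
      qed
    qed (auto simp: E.finite_index)
    moreover have "\<dots> = (\<Sum>g\<in>Pos t. C (v' y \<otimes>\<^sub>t 1) (\<iota> g) * B x g)"
      unfolding B by (rule sum.reindex_bij_betw[OF bij_\<iota>_Pos, symmetric])
    moreover have "\<dots> = (\<Sum>g\<in>Pos t. B x g * (of_int (t * eps) *
        (\<Sum>k\<in>Pos t. C (v k \<otimes>\<^sub>t 1) g * (c (v' y) k \<otimes>\<^sub>t 1))))"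
    proof (intro sum.cong refl)
      fix g assume "g \<in> Pos t"
      then have g: "g \<in> H" using Pos_subset by blast
      show "C (v' y \<otimes>\<^sub>t 1) (\<iota> g) * B x g = B x g * (of_int (t * eps) *
        (\<Sum>k\<in>Pos t. C (v k \<otimes>\<^sub>t 1) g * (c (v' y) k \<otimes>\<^sub>t 1)))"
        unfolding coord_betti_part[OF g v'_in[OF y]] coord_betti_basis[OF t v v'_in[OF y] g]
        by (rule mult.commute)
    qed
    ultimately show ?thesis by (simp only:)
  qed
  define K where "K k y = c (v' y) k \<otimes>\<^sub>t (1 :: complex)" for k y
  have "det A = det_on {..<n} (\<lambda>i j. A $$ (i, j))"
    using A_carrier n_ws n_vs by (simp add: det_on_eq_det)
  also have "\<dots> = det_on (Pos t) (\<lambda>x y. A $$ (\<psi> x, \<psi> y))"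
    by (rule det_on_reindex[OF \<psi> finite_Pos])
  also have "\<dots> = det_on (Pos t) (\<lambda>x y. \<Sum>g\<in>Pos t. B x g *
      (of_int (t * eps) * (\<Sum>k\<in>Pos t. C (v k \<otimes>\<^sub>t 1) g * K k y)))"
    unfolding K_def by (intro det_on_cong finite_Pos entry)
  also have "\<dots> = det_on (Pos t) B * (of_int (t * eps) ^ card (Pos t) * (minor t v * det_on (Pos t) K))"
    by (simp only: det_on_mult[OF finite_Pos] det_on_scale[OF finite_Pos] minor_def)
  finally have det_eq: "det A =
    det_on (Pos t) B * (of_int (t * eps) ^ card (Pos t) * (minor t v * det_on (Pos t) K))" .
  obtain r where r: "r \<in> rational_units"
      "det_on (Pos t) B = r * det_on positive (\<lambda>i h. cext c0 i (T (e (\<iota> h))))"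
    using de_rham_matrix_eq[OF t w0 w'] unfolding B_def by blast
  have "det_on (Pos t) (\<lambda>i j. c (v' j) i) dvd 1"
    using v v' unfolding betti_basis_def by (blast intro: quotient_basis_matrix_dvd_one)
  then have "det_on (Pos t) K dvd 1"
    unfolding K_def det_on_base[OF finite_Pos]
    by (intro pure_tensor_one_dvd_one) auto
  then have K: "det_on (Pos t) K \<in> rational_units"
    unfolding K_def by (rule det_on_base_unit[OF finite_Pos])
  have "t * eps \<noteq> 0" using t eps by auto
  then have "of_int (t * eps) ^ card (Pos t) \<in> (rational_units :: 'e coeff set)"
    by (intro rational_units_power of_int_rational_unit)
  then have "r * of_int (t * eps) ^ card (Pos t) * det_on (Pos t) K \<in> rational_units"
    using r K by (intro rational_units_mult)
  then show ?thesis
    by (rule bexI[rotated]) (simp only: det_eq r(2) mult_ac)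
qed

lemma ex_de_rham_basis: "\<exists>ws c. quotient_basis sD (fil X p) {..<length ws} (nth ws) c"
proof -
  have "finite_dimensional sD" using pure by (simp add: pure_motive_def)
  then show ?thesis
    using ex_quotient_basis[OF D.vector_space_axioms _ subspace_fil D.subspace_UNIV, of p]
      D.subspace_0[OF subspace_fil] by (metis UNIV_I diff_self)
qed

text \<open>A period is a union over all period matrices, which would be empty without one. The
  filtration step at \<open>step t\<close> has the required codimension because \<iota> matches the
  degrees below it with \<open>Pos t\<close>.\<close>

lemma ex_period_matrix:
  assumes t: "t \<in> {1, -1}"
  shows "\<exists>A. is_period_matrix X t A"
proof -
  obtain vs where vs: "ordered_basis sB (betti_part X t) vs"
    using ex_betti_basis_nat[OF t] by blast
  obtain ws c where ws: "quotient_basis sD (fil X (step t)) {..<length ws} (nth ws) c"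
    using ex_de_rham_basis by blast
  have "length ws = betti_part_dim X t"
    using codim_fil[OF ws] bij_betw_same_card[OF bij_\<iota>_Pos, of t] card_Pos[OF t] by simp
  then have "is_fil_step X (- t) (fil X (step t))"
    using quotient_basis_imp_ordered_basis_mod[OF ws] by (auto simp: is_fil_step_def)
  moreover define A where "A = mat (length ws) (length vs)
    (\<lambda>(i, j). cext c i (T (vs ! j \<otimes>\<^sub>t 1)))"
  have "T (vs ! j \<otimes>\<^sub>t 1) - (\<Sum>i<length ws. sW (A $$ (i, j)) (ws ! i \<otimes>\<^sub>t 1)) \<in> fil_complex X (step t)"
    if "j < length vs" for j
    using quotient_basis.coord_approx[OF basis_de_rham(1)[OF ws], of "T (vs ! j \<otimes>\<^sub>t 1)"] that
    by (simp add: A_def)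
  moreover have "A \<in> carrier_mat (length ws) (length vs)" by (simp add: A_def)
  ultimately show ?thesis
    using vs quotient_basis_imp_ordered_basis_mod[OF ws]
    unfolding is_period_matrix_def fil_complex_def by blast
qed

lemma deligne_period_eq:
  "\<exists>b. b dvd 1 \<and> (\<forall>t\<in>{1, -1}. \<forall>v c. betti_basis t (Pos t) v c \<longrightarrow>
     deligne_period X t = period_class (b * minor t v))"
proof -
  obtain ws c where ws: "quotient_basis sD (fil X m) {..<length ws} (nth ws) c"
    using ex_de_rham_basis by blast
  \<comment> \<open>The sign \<open>- eps\<close> omits the middle index, so \<open>b\<close> is
    itself a de Rham determinant for an actual sign, and thereby a unit.\<close>
  have "positive = Pos (- eps)" using eps by (auto simp: Pos_def)
  moreover have "step (- eps) = m" using eps by (auto simp: step_def)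
  ultimately have "card positive = card {..<length ws}"
    using codim_fil[OF ws] bij_betw_same_card[OF bij_\<iota>_Pos, of "- eps"] by simp
  then obtain f where "bij_betw f positive {..<length ws}"
    using finite_same_card_bij[OF finite_positive finite_lessThan] by blast
  from quotient_basis.reindex[OF ws this]
  obtain w0 c0 where w0: "quotient_basis sD (fil X m) positive w0 c0" by blast
  define b where "b = det_on positive (\<lambda>i h. cext c0 i (T (e (\<iota> h))))"
  have "b dvd 1"
    using de_rham_matrix_dvd_one[of m "- eps" w0 c0] w0 \<open>positive = Pos (- eps)\<close>
    unfolding b_def by simp
  moreover have "deligne_period X t = period_class (b * minor t v)"
    if t: "t \<in> {1, -1}" and v: "betti_basis t (Pos t) v c" for t v c
  proof -
    have "period_class (det A) = period_class (b * minor t v)"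
      if A: "is_period_matrix X t A" for A
      using period_matrix_det[OF t v w0 A] period_class_rational_mult unfolding b_def by metis
    then show ?thesis
      unfolding deligne_period_def using ex_period_matrix[OF t] by auto
  qed
  ultimately show ?thesis by blast
qed

end

section \<open>Motives with Hodge numbers at most one\<close>

context realization
begin

abbreviation "w \<equiv> weight X"

lemma hodge_decomposition: "hodge_decomposition X"
  using pure by (simp add: pure_motive_def)

lemma hodge_weight: "p + q \<noteq> w \<Longrightarrow> hodge X p q = {0}"
  using hodge_decomposition unfolding hodge_decomposition_def by blast

lemma hodge_free: "\<exists>n. free_of_rank sU (hodge X p q) n"
  using hodge_decomposition unfolding hodge_decomposition_def by blast

lemma rho_hodge: "rho_complex X ` hodge X p q = hodge X q p"
  using hodge_decomposition unfolding hodge_decomposition_def by blast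

lemma subspace_hodge: "U.subspace (hodge X p q)"
proof -
  obtain n where "free_of_rank sU (hodge X p q) n" using hodge_free by blast
  then obtain D where "U.span D = hodge X p q"
    unfolding free_of_rank_def by (elim exE conjE) rule
  then show ?thesis using U.subspace_span[of D] by (simp only:)
qed

definition component :: "('b, complex) tensor \<Rightarrow> int \<Rightarrow> ('b, complex) tensor" where
  "component u = (THE f. finite {p. f p \<noteq> 0} \<and> (\<forall>p. f p \<in> hodge X p (w - p)) \<and>
     u = (\<Sum>p | f p \<noteq> 0. f p))"

lemma ex1_component:
  "\<exists>!f. finite {p. f p \<noteq> 0} \<and> (\<forall>p. f p \<in> hodge X p (w - p)) \<and> u = (\<Sum>p | f p \<noteq> 0. f p)"
  using hodge_decomposition unfolding hodge_decomposition_def by (elim conjE) (erule spec)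

lemma component:
  "finite {p. component u p \<noteq> 0} \<and> (\<forall>p. component u p \<in> hodge X p (w - p)) \<and>
    u = (\<Sum>p | component u p \<noteq> 0. component u p)"
  unfolding component_def by (rule theI'[OF ex1_component])

lemmas finite_component = component[THEN conjunct1]
  and component_in = component[THEN conjunct2, THEN conjunct1, THEN spec]
  and component_sum = component[THEN conjunct2, THEN conjunct2]

lemma component_eqI:
  assumes "finite S" "\<And>p. p \<notin> S \<Longrightarrow> f p = 0" "\<And>p. f p \<in> hodge X p (w - p)" "u = (\<Sum>p\<in>S. f p)"
  shows "component u = f"
  unfolding component_def
proof (rule the1_equality[OF ex1_component], intro conjI allI assms(3))
  have sub: "{p. f p \<noteq> 0} \<subseteq> S" using assms(2) by blast
  then show "finite {p. f p \<noteq> 0}" using assms(1) by (rule finite_subset)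
  show "u = (\<Sum>p | f p \<noteq> 0. f p)"
    unfolding assms(4) by (rule sum.mono_neutral_right) (use assms(1) sub in auto)
qed

lemma component_sum':
  assumes "finite S" "{p. component u p \<noteq> 0} \<subseteq> S"
  shows "u = (\<Sum>p\<in>S. component u p)"
  by (subst component_sum, rule sum.mono_neutral_left) (use assms in auto)

lemma component_add: "component (u + v) = (\<lambda>p. component u p + component v p)"
proof (rule component_eqI)
  let ?S = "{p. component u p \<noteq> 0} \<union> {p. component v p \<noteq> 0}"
  show S: "finite ?S" by (simp add: finite_component)
  show "u + v = (\<Sum>p\<in>?S. component u p + component v p)"
    using component_sum'[OF S, of u] component_sum'[OF S, of v] by (simp add: sum.distrib)
qed (auto intro: U.subspace_add[OF subspace_hodge] component_in)

lemma component_scale: "component (sU r u) = (\<lambda>p. sU r (component u p))"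
proof (rule component_eqI)
  show "sU r u = (\<Sum>p | component u p \<noteq> 0. sU r (component u p))"
    by (subst component_sum) (simp add: U.scale_sum_right)
qed (auto simp: finite_component intro: U.subspace_scale[OF subspace_hodge] component_in)

lemma component_hodge:
  assumes "u \<in> hodge X p (w - p)"
  shows "component u = (\<lambda>q. if q = p then u else 0)"
  by (rule component_eqI[of "{p}"]) (use assms U.subspace_0[OF subspace_hodge] in auto)

definition types :: "int set" where
  "types = {p. hodge X p (w - p) \<noteq> {0}}"

lemma component_eq_0: "p \<notin> types \<Longrightarrow> component u p = 0"
  using component_in[of u p] by (auto simp: types_def)

lemma types_nonzero:
  assumes "p \<in> types"
  obtains x where "x \<in> hodge X p (w - p)" "x \<noteq> 0"
proof -
  have "\<not> hodge X p (w - p) \<subseteq> {0}"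
    using assms U.subspace_0[OF subspace_hodge[of p "w - p"]] by (auto simp: types_def)
  then show ?thesis using that by blast
qed

lemma ex_basis:
  "\<exists>vs c. quotient_basis sB {0} {..<length vs} (nth vs) c \<and>
    quotient_basis sU {0} {..<length vs} (\<lambda>i. vs ! i \<otimes>\<^sub>t 1) (\<lambda>u i. cext c i u)"
proof -
  have "finite_dimensional sB" using pure by (simp add: pure_motive_def)
  moreover have "B.subspace {0}" by simp
  ultimately obtain vs c where c: "quotient_basis sB {0} {..<length vs} (nth vs) c"
    using ex_quotient_basis[OF B.vector_space_axioms _ _ B.subspace_UNIV] by (metis UNIV_I diff_self singletonI)
  have "subspace_complex sB {0} = {0}"
    by (simp add: subspace_complex_def betti_scale_complex_def[symmetric] pure_tensor_left.zero
        U.span_singleton image_constant_conv)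
  then show ?thesis
    using c quotient_basis_complex[OF c] unfolding betti_scale_complex_def by auto
qed

text \<open>Hodge components depend linearly on the vector, so only the types occurring in the
  finitely many basis vectors can occur at all.\<close>

lemma finite_types: "finite types"
proof -
  obtain vs c where V: "quotient_basis sU {0} {..<length vs} (\<lambda>i. vs ! i \<otimes>\<^sub>t 1)
      (\<lambda>u i. cext c i u)" using ex_basis by blast
  have expand: "u = (\<Sum>i<length vs. sU (cext c i u) (vs ! i \<otimes>\<^sub>t 1))" for u
    using quotient_basis.coord_approx[OF V, of u] by simp
  define S where "S = (\<Union>i<length vs. {p. component (vs ! i \<otimes>\<^sub>t 1) p \<noteq> 0})"
  have S: "finite S" by (simp add: S_def finite_component)
  have sum: "component (\<Sum>i\<in>J. g i) p = (\<Sum>i\<in>J. component (g i) p)"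
    if "finite J" for J p and g :: "nat \<Rightarrow> ('b, complex) tensor"
    using that
  proof (induction J)
    case empty
    have "component (sU 0 0) p = sU 0 (component 0 p)" by (simp only: component_scale)
    then show ?case by simp
  qed (simp add: component_add)
  have "component u p = 0" if "p \<notin> S" for u p
  proof -
    have "component u p =
      (\<Sum>i<length vs. sU (cext c i u) (component (vs ! i \<otimes>\<^sub>t 1) p))"
      by (subst expand) (simp add: sum component_scale)
    also have "\<dots> = 0" using that by (intro sum.neutral) (auto simp: S_def)
    finally show ?thesis .
  qed
  moreover have "\<exists>u. component u p \<noteq> 0" if "p \<in> types" for p
  proof -
    obtain u where "u \<in> hodge X p (w - p)" "u \<noteq> 0"
      using \<open>p \<in> types\<close> by (rule types_nonzero)
    then show ?thesis using component_hodge by (intro exI[of _ u]) simp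
  qed
  ultimately have "types \<subseteq> S" by blast
  then show ?thesis using S finite_subset by blast
qed

text \<open>Says that the Hodge piece is free of rank one on \<open>x\<close>. The second clause
  excludes annihilation by a zero divisor, which \<open>x\<close> being nonzero would not.\<close>

definition generator :: "int \<Rightarrow> ('b, complex) tensor \<Rightarrow> bool" where
  "generator p x \<longleftrightarrow> hodge X p (w - p) = range (\<lambda>k. sU k x) \<and> (\<forall>k. sU k x = 0 \<longrightarrow> k = 0)"

lemma generator_scale:
  assumes "generator p x" "r dvd 1"
  shows "generator p (sU r x)"
proof -
  obtain q where q: "q * r = 1" using assms(2) by (metis dvdE mult.commute)
  have "range (\<lambda>k. sU k (sU r x)) = range (\<lambda>k. sU k x)"
  proof (intro equalityI subsetI; elim rangeE)
    fix y k assume "y = sU k (sU r x)"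
    then show "y \<in> range (\<lambda>k. sU k x)" by simp
  next
    fix y k assume "y = sU k x"
    then have "y = sU (k * q) (sU r x)" using q by (simp add: mult.assoc)
    then show "y \<in> range (\<lambda>k. sU k (sU r x))" by blast
  qed
  moreover have "k = 0" if "sU k (sU r x) = 0" for k
  proof -
    have "k * r = 0" using that assms(1) by (simp add: generator_def)
    then have "q * (k * r) = 0" by simp
    then have "k * (q * r) = 0" by (simp only: mult.left_commute)
    then show ?thesis by (simp add: q)
  qed
  ultimately show ?thesis using assms(1) by (simp add: generator_def)
qed

lemma generator_rho:
  assumes "generator p x"
  shows "generator (w - p) (rho_complex X x)"
proof -
  have "hodge X (w - p) (w - (w - p)) = rho_complex X ` range (\<lambda>k. sU k x)"
    using assms rho_hodge[of p "w - p"] by (simp add: generator_def)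
  also have "\<dots> = range (\<lambda>k. sU k (rho_complex X x))"
    by (auto simp: rhoc.scale image_image)
  finally have "hodge X (w - p) (w - (w - p)) = range (\<lambda>k. sU k (rho_complex X x))" .
  moreover have "k = 0" if "sU k (rho_complex X x) = 0" for k
  proof -
    have "rho_complex X (sU k (rho_complex X x)) = 0" using that by (simp add: rhoc.zero)
    then have "sU k x = 0" by (simp add: rhoc.scale rho_complex_rho_complex)
    then show ?thesis using assms by (simp add: generator_def)
  qed
  ultimately show ?thesis by (simp add: generator_def)
qed

lemma generator_in: "generator p x \<Longrightarrow> x \<in> hodge X p (w - p)"
  by (auto simp: generator_def intro: range_eqI[of _ _ 1])

lemma types_symmetric: "p \<in> types \<Longrightarrow> w - p \<in> types"
proof -
  assume "p \<in> types"
  then obtain x where x: "x \<in> hodge X p (w - p)" "x \<noteq> 0" by (rule types_nonzero)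
  have "rho_complex X x \<in> hodge X (w - p) p" using x rho_hodge by blast
  moreover have "rho_complex X x \<noteq> 0" using x rho_complex_rho_complex[of x] by (auto simp: rhoc.zero)
  ultimately show ?thesis by (auto simp: types_def)
qed

lemma generator_ex:
  assumes one: "\<forall>p q. hodge_number X p q \<noteq> 0 \<longrightarrow> hodge_number X p q = 1" and p: "p \<in> types"
  shows "\<exists>x. generator p x"
proof -
  obtain n where n: "free_of_rank sU (hodge X p (w - p)) n" using hodge_free by blast
  have "hodge_number X p (w - p) = n"
    unfolding hodge_number_def by (rule free_rank_eq[OF U.module_axioms n])
  then have n01: "n = 0 \<or> n = 1" using one by blast
  obtain D where D: "finite D" "card D = n" "U.independent D" "U.span D = hodge X p (w - p)"
    using n unfolding free_of_rank_def by (elim exE conjE) (rule that)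
  have "n \<noteq> 0"
  proof
    assume "n = 0"
    then have "D = {}" using D by simp
    then have "hodge X p (w - p) = {0}" using D(4)[symmetric] by simp
    then show False using p by (simp add: types_def)
  qed
  then obtain x where x: "D = {x}" using n01 D(2) by (auto simp: card_1_singleton_iff)
  have "k = 0" if "sU k x = 0" for k
    using U.independentD[OF D(3), of D "\<lambda>_. k" x] x that by simp
  then show ?thesis using D(4) x by (auto simp: generator_def U.span_singleton intro!: exI[of _ x])
qed

lemma generator_basis:
  assumes e: "\<And>p. p \<in> types \<Longrightarrow> generator p (e p)"
  shows "\<exists>C. quotient_basis sU {0} types e C"
proof -
  have ex1: "\<exists>!r. component u p = sU r (e p)" if p: "p \<in> types" for u p
  proof -
    obtain r where r: "component u p = sU r (e p)"
      using e[OF p] component_in[of u p] by (auto simp: generator_def)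
    have "r' = r" if "component u p = sU r' (e p)" for r'
    proof -
      have "sU (r' - r) (e p) = 0" using r that by (simp add: U.scale_left_diff_distrib)
      then have "r' - r = 0" using e[OF p] by (simp only: generator_def)
      then show ?thesis by simp
    qed
    with r show ?thesis by blast
  qed
  define C where "C u p = (THE r. component u p = sU r (e p))" for u p
  have C: "component u p = sU (C u p) (e p)" if "p \<in> types" for u p
    unfolding C_def by (rule theI'[OF ex1[OF that]])
  have C_eq: "C u p = r" if "component u p = sU r (e p)" "p \<in> types" for u p r
    using ex1[OF that(2)] that C by blast
  have "quotient_basis sU {0} types e C"
  proof unfold_locales
    fix u
    have "u = (\<Sum>p\<in>types. component u p)"
      by (rule component_sum'[OF finite_types]) (use component_eq_0 in blast)
    also have "\<dots> = (\<Sum>p\<in>types. sU (C u p) (e p))" by (simp add: C)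
    finally show "u - (\<Sum>p\<in>types. sU (C u p) (e p)) \<in> {0}" by simp
  next
    fix p assume p: "p \<in> types"
    show "C (u + v) p = C u p + C v p" for u v
      by (rule C_eq[OF _ p]) (simp add: component_add U.scale_left_distrib C[OF p])
    show C_scale: "C (sU r u) p = r * C u p" for r u
      by (rule C_eq[OF _ p]) (simp add: component_scale C[OF p])
    show "C u p = 0" if "u \<in> {0}" for u
      using C_scale[of 0 u] that by simp
    show "C (e p) q = (if p = q then 1 else 0)" if q: "q \<in> types" for q
    proof (rule C_eq[OF _ q])
      have "e p \<in> hodge X p (w - p)"
        by (rule generator_in[OF e[OF p]])
      then show "component (e p) q = sU (if p = q then 1 else 0) (e q)"
        by (simp add: component_hodge)
    qed
  qed (rule finite_types)
  then show ?thesis by blast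
qed

lemma hodge_coord:
  assumes e: "\<And>p. p \<in> types \<Longrightarrow> generator p (e p)" and C: "quotient_basis sU {0} types e C"
    and x: "x \<in> hodge X p q" and h: "h \<in> types" "h \<noteq> p"
  shows "C x h = 0"
proof -
  interpret C: quotient_basis sU "{0}" types e C by (rule C)
  show ?thesis
  proof (cases "x = 0")
    case False
    then have q: "q = w - p" using hodge_weight[of p q] x by force
    then have p: "p \<in> types" using False x by (auto simp: types_def)
    then obtain k where "x = sU k (e p)"
      using e[OF p] x q by (auto simp: generator_def)
    then show ?thesis using h p by (simp add: C.coord_scale C.coord_basis)
  qed (simp add: C.coord_0 h)
qed

text \<open>The comparison isomorphism matches F^p with the span of the Hodge pieces of degree at
  least \<open>p\<close>, and each piece has a single coordinate.\<close>

lemma fil_complex_iff: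
  assumes e: "\<And>p. p \<in> types \<Longrightarrow> generator p (e p)" and C: "quotient_basis sU {0} types e C"
  shows "T u \<in> fil_complex X p \<longleftrightarrow> (\<forall>h\<in>types. h < p \<longrightarrow> C u h = 0)"
proof -
  interpret C: quotient_basis sU "{0}" types e C by (rule C)
  let ?S = "\<Union>p'\<in>{p..}. \<Union>q. hodge X p' q"
  have "fil_complex X p = T ` U.span ?S" using pure unfolding pure_motive_def by blast
  then have "T u \<in> fil_complex X p \<longleftrightarrow> u \<in> U.span ?S"
    using bij_comparison by (auto simp: bij_def inj_def)
  also have "\<dots> \<longleftrightarrow> (\<forall>h\<in>types. h < p \<longrightarrow> C u h = 0)"
  proof
    assume u: "u \<in> U.span ?S"
    have subspace: "U.subspace {u. \<forall>h\<in>types. h < p \<longrightarrow> C u h = 0}"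
      by (rule U.subspaceI) (auto simp: C.coord_0 C.coord_add C.coord_scale)
    have sub: "?S \<subseteq> {u. \<forall>h\<in>types. h < p \<longrightarrow> C u h = 0}"
    proof (clarify)
      fix p' q x h assume x: "p' \<ge> p" "x \<in> hodge X p' q" and h: "h \<in> types" "h < p"
      show "C x h = 0" by (rule hodge_coord[OF _ C x(2) h(1)]) (use e x(1) h(2) in auto)
    qed
    show "\<forall>h\<in>types. h < p \<longrightarrow> C u h = 0"
      using subsetD[OF U.span_minimal[OF sub subspace] u] by simp
  next
    assume u: "\<forall>h\<in>types. h < p \<longrightarrow> C u h = 0"
    have "sU (C u h) (e h) \<in> U.span ?S" if h: "h \<in> types" for h
    proof (cases "h < p")
      case True
      then show ?thesis using u h by (simp add: U.span_zero)
    next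
      case False
      have "e h \<in> hodge X h (w - h)"
        by (rule generator_in[OF e[OF h]])
      then show ?thesis using False by (intro U.span_scale U.span_base) auto
    qed
    then have "(\<Sum>h\<in>types. sU (C u h) (e h)) \<in> U.span ?S" by (rule U.span_sum)
    then show "u \<in> U.span ?S" using C.coord_approx[of u] by simp
  qed
  finally show ?thesis .
qed

end

section \<open>The middle Hodge type, its sign and its rational normalization\<close>

context realization
begin

lemma rank_eq: "rank X = betti_part_dim X 1 + betti_part_dim X (-1)"
proof -
  obtain vs c where v: "betti_basis 1 {..<length vs} (nth vs) c"
    using ex_betti_basis_nat[of 1] by auto
  obtain vs' c' where v': "betti_basis (-1) {..<length vs'} (nth vs') c'"
    using ex_betti_basis_nat[of "-1"] by auto
  have "rank X = card ({..<length vs} <+> {..<length vs'})"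
    unfolding rank_def by (rule dim_eq_card_index[OF betti_basis_sum[OF v v'] B.subspace_UNIV]) auto
  then show ?thesis
    using betti_part_dim_eq[OF _ v] betti_part_dim_eq[OF _ v'] by (simp add: card_Plus)
qed

text \<open>The reflection p -> w - p pairs off the types on the two sides of w / 2, so an odd
  number leaves one at the centre.\<close>

lemma odd_types_fixed:
  assumes "odd (card types)"
  shows "\<exists>m\<in>types. w = 2 * m"
proof (rule ccontr)
  assume neg: "\<not> (\<exists>m\<in>types. w = 2 * m)"
  let ?P = "{p \<in> types. w < 2 * p}" and ?N = "{p \<in> types. 2 * p < w}"
  have "types = ?P \<union> ?N" using neg by force
  then have "card types = card (?P \<union> ?N)" by simp
  also have "\<dots> = card ?P + card ?N"
    by (rule card_Un_disjoint) (use finite_types in auto)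
  also have "bij_betw (\<lambda>p. w - p) ?P ?N"
    by (rule bij_betw_byWitness[where f' = "\<lambda>p. w - p"]) (auto intro: types_symmetric)
  then have "card ?P = card ?N" by (rule bij_betw_same_card)
  finally show False using assms by simp
qed

text \<open>On the middle line \<rho> acts by some \<open>k\<close> with k * k = 1, an equation that
  may have more solutions than the signs. The other lines are interchanged in pairs and contribute
  nothing to the trace, so \<open>k\<close> is the trace of \<rho> and hence an integer.\<close>

lemma ex_sign:
  assumes e: "\<And>p. p \<in> types \<Longrightarrow> generator p (e p)" and m: "m \<in> types" "w = 2 * m"
  shows "\<exists>eps\<in>{1, -1}. rho_complex X (e m) = sU (of_int eps) (e m)"
proof -
  obtain C where C: "quotient_basis sU {0} types e C" using generator_basis[of e] e by blast
  interpret C: quotient_basis sU "{0}" types e C by (rule C)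
  have e_in: "e p \<in> hodge X p (w - p)" if "p \<in> types" for p
    by (rule generator_in[OF e[OF that]])
  have rho: "\<exists>k. rho_complex X (e p) = sU k (e (w - p))" if p: "p \<in> types" for p
  proof -
    have "rho_complex X (e p) \<in> hodge X (w - p) (w - (w - p))"
      using e_in[OF p] rho_hodge[of p "w - p"] by auto
    then show ?thesis using e[OF types_symmetric[OF p]] by (auto simp: generator_def)
  qed
  obtain k where k: "rho_complex X (e m) = sU k (e m)" using rho[OF m(1)] m(2) by auto
  have "C (rho_complex X (e p)) p = (if p = m then k else 0)" if p: "p \<in> types" for p
  proof -
    obtain r where r: "rho_complex X (e p) = sU r (e (w - p))" using rho[OF p] by blast
    show ?thesis
    proof (cases "p = m")
      case True
      then show ?thesis using m(1) by (simp add: k C.coord_scale C.coord_basis)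
    next
      case False
      then have "w - p \<noteq> p" using m(2) by auto
      then show ?thesis using False p types_symmetric[OF p]
        by (simp add: r C.coord_scale C.coord_basis)
    qed
  qed
  then have "(\<Sum>p\<in>types. C (rho_complex X (e p)) p) = k" using m finite_types by simp
  then obtain n :: int where n: "k = of_int n"
    using trace_rho[OF C] by (metis (no_types))
  have "e m = sU (of_int n) (sU (of_int n) (e m))"
    using rho_complex_rho_complex[of "e m"] unfolding k n by (simp add: rhoc.scale k n)
  then have "C (e m) m = of_int (n * n) * C (e m) m"
    using C.coord_scale[OF m(1)] by (metis mult.assoc of_int_mult)
  then have "of_int (n * n) = (of_int 1 :: 'e coeff)" by (simp add: C.coord_basis m(1))
  then have "n * n = 1" by (simp only: of_int_eq_iff)
  then have "n = 1 \<or> n = -1" by (metis zmult_eq_1_iff)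
  then show ?thesis using k n by auto
qed

text \<open>Modulo F^(m+1), a rational vector \<open>wm\<close> of F^m is congruent to
  \<open>r\<close> times the image of \<open>e m\<close>. A coordinate of \<open>wm\<close> that is
  nonzero in the coefficient field is then a multiple of \<open>r\<close>, which shows
  \<open>r\<close> to be a unit and allows \<open>e m\<close> to be rescaled.\<close>

lemma ex_rational_generator:
  assumes e: "\<And>p. p \<in> types \<Longrightarrow> generator p (e p)" and m: "m \<in> types"
  shows "\<exists>wm r. wm \<in> fil X m \<and> r dvd 1 \<and> T (sU r (e m)) - wm \<otimes>\<^sub>t 1 \<in> fil_complex X (m + 1)"
proof -
  obtain C where C: "quotient_basis sU {0} types e C" using generator_basis[of e] e by blast
  interpret C: quotient_basis sU "{0}" types e C by (rule C)
  have fil_iff: "T u \<in> fil_complex X p \<longleftrightarrow> (\<forall>h\<in>types. h < p \<longrightarrow> C u h = 0)" for u p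
    by (rule fil_complex_iff[OF _ C]) (rule e)
  have base: "x \<otimes>\<^sub>t 1 \<in> fil_complex X p" if "x \<in> fil X p" for x p
    unfolding fil_complex_def subspace_complex_def dr_scale_complex_def[symmetric]
    using that by (intro W.span_base imageI)
  \<comment> \<open>Otherwise the inclusion persists after extension of scalars, and the image of
    \<open>e m\<close> would lie in F^(m+1), against its coordinate one at \<open>m\<close>.\<close>
  have "\<not> fil X m \<subseteq> fil X (m + 1)"
  proof
    assume "fil X m \<subseteq> fil X (m + 1)"
    then have "fil_complex X m \<subseteq> fil_complex X (m + 1)"
      unfolding fil_complex_def subspace_complex_def dr_scale_complex_def[symmetric]
      by (intro W.span_mono image_mono)
    moreover have "T (e m) \<in> fil_complex X m"
      unfolding fil_iff using m by (auto simp: C.coord_basis)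
    ultimately have "T (e m) \<in> fil_complex X (m + 1)" by blast
    then have "C (e m) m = 0" unfolding fil_iff using m by simp
    then show False using m by (simp add: C.coord_basis)
  qed
  then obtain wm where wm: "wm \<in> fil X m" "wm \<notin> fil X (m + 1)" by blast
  define u where "u = inv_into UNIV T (wm \<otimes>\<^sub>t 1)"
  define r where "r = C u m"
  have Tu: "T u = wm \<otimes>\<^sub>t 1" by (simp add: u_def comparison_inv)
  have u_zero: "C u h = 0" if "h \<in> types" "h < m" for h
    using base[OF wm(1)] that unfolding Tu[symmetric] fil_iff by blast
  have diff: "T (u - sU r (e m)) \<in> fil_complex X (m + 1)"
    unfolding fil_iff
  proof (intro ballI impI)
    fix h assume h: "h \<in> types" "h < m + 1"
    then consider "h = m" | "h < m" by linarith
    then show "C (u - sU r (e m)) h = 0"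
      by cases (use h m u_zero in \<open>auto simp: C.coord_diff C.coord_scale C.coord_basis r_def\<close>)
  qed
  have "finite_dimensional sD" using pure by (simp add: pure_motive_def)
  obtain ws c where ws: "quotient_basis sD (fil X (m + 1)) {..<length ws} (nth ws) c"
    using ex_quotient_basis[OF D.vector_space_axioms \<open>finite_dimensional sD\<close> subspace_fil
        D.subspace_UNIV, of "m + 1"] D.subspace_0[OF subspace_fil] by (metis UNIV_I diff_self)
  interpret ws: quotient_basis sD "fil X (m + 1)" "{..<length ws}" "nth ws" c by (rule ws)
  obtain i where i: "i \<in> {..<length ws}" "c wm i \<noteq> 0" using wm(2) ws.mem_iff by blast
  have W: "quotient_basis sW (fil_complex X (m + 1)) {..<length ws} (\<lambda>i. ws ! i \<otimes>\<^sub>t 1)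
      (\<lambda>u i. cext c i u)"
    unfolding dr_scale_complex_def fil_complex_def by (rule quotient_basis_complex[OF ws])
  interpret W: quotient_basis sW "fil_complex X (m + 1)" "{..<length ws}" "\<lambda>i. ws ! i \<otimes>\<^sub>t 1"
    "\<lambda>u i. cext c i u" by (rule W)
  let ?c = "cext c i"
  interpret c: Modules.module_hom sW "(*)" ?c by (rule W.coord_hom[OF i(1)])
  have "?c (T (u - sU r (e m))) = 0" by (rule W.coord_vanish[OF i(1) diff])
  then have "?c (wm \<otimes>\<^sub>t 1) = r * ?c (T (e m))"
    unfolding T.diff T.scale c.diff c.scale Tu by (simp only: right_minus_eq)
  moreover have "?c (wm \<otimes>\<^sub>t 1) = c wm i \<otimes>\<^sub>t (1 :: complex)"
    by (subst tensor_map_pure[OF additive_module_hom[OF ws.coord_hom[OF i(1)]] additive_id]) simp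
  ultimately have "c wm i \<otimes>\<^sub>t (1 :: complex) = r * ?c (T (e m))" by (simp only:)
  then have "r dvd c wm i \<otimes>\<^sub>t (1 :: complex)" by (rule dvdI)
  then have "r dvd 1" using pure_tensor_one_dvd_one[OF i(2)] dvd_trans by blast
  moreover have "T (sU r (e m)) - wm \<otimes>\<^sub>t 1 = - T (u - sU r (e m))"
    by (simp add: T.diff Tu)
  then have "T (sU r (e m)) - wm \<otimes>\<^sub>t 1 \<in> fil_complex X (m + 1)"
    using diff unfolding fil_complex_def subspace_complex_def dr_scale_complex_def[symmetric]
    by (simp only: W.span_neg)
  ultimately show ?thesis using wm(1) by blast
qed

lemma middle_sign_eq:
  assumes g: "generator m x" and w: "w = 2 * m" and eps: "eps \<in> {1, -1}"
    and rho: "rho_complex X x = sU (of_int eps) x"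
  shows "middle_sign X = eps"
  unfolding middle_sign_def
proof (rule the_equality)
  have hodge: "hodge X m m = range (\<lambda>k. sU k x)" using g w by (simp add: generator_def)
  show "eps \<in> {1, - 1} \<and> (\<forall>p. 2 * p = w \<longrightarrow> (\<forall>x\<in>hodge X p p. rho_complex X x = sU (of_int eps) x))"
    using eps w by (auto simp: hodge rhoc.scale rho mult.commute)
  fix s assume s: "s \<in> {1, - 1} \<and> (\<forall>p. 2 * p = w \<longrightarrow> (\<forall>x\<in>hodge X p p. rho_complex X x = sU (of_int s) x))"
  have "x \<in> hodge X m m" using generator_in[OF g] w by simp
  then have "rho_complex X x = sU (of_int s) x" using s w by simp
  then have "sU (of_int s - of_int eps) x = 0" using rho by (simp add: U.scale_left_diff_distrib)
  then have "of_int s - (of_int eps :: 'e coeff) = 0" using g by (simp only: generator_def)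
  then show "s = eps" by simp
qed

lemma ex_hodge_basis:
  assumes odd: "odd (rank X)"
    and one: "\<forall>p q. hodge_number X p q \<noteq> 0 \<longrightarrow> hodge_number X p q = 1"
  shows "\<exists>e C m eps wm. critical_hodge_basis X types (\<lambda>h. h) (\<lambda>h. w - h) e C m m eps wm \<and>
    w = 2 * m \<and> (\<forall>p\<in>types. generator p (e p)) \<and> middle_sign X = eps"
proof -
  have "\<forall>p\<in>types. \<exists>x. generator p x" using generator_ex[OF one] by blast
  then obtain b where b: "\<And>p. p \<in> types \<Longrightarrow> generator p (b p)" using bchoice by metis
  obtain Cb where Cb: "quotient_basis sU {0} types b Cb" using generator_basis[of b] b by blast
  have "odd (card types)" using odd card_basis[OF Cb] by (simp add: rank_eq)
  then obtain m where m: "m \<in> types" "w = 2 * m" using odd_types_fixed by blast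
  obtain eps where eps: "eps \<in> {1, -1}" "rho_complex X (b m) = sU (of_int eps) (b m)"
    using ex_sign[of b, OF b m] by blast
  obtain wm r where wm: "wm \<in> fil X m" "r dvd 1"
      "T (sU r (b m)) - wm \<otimes>\<^sub>t 1 \<in> fil_complex X (m + 1)"
    using ex_rational_generator[of b, OF b m(1)] by blast
  \<comment> \<open>Generators above the middle are arbitrary, those below are images of these under
    eps \<rho>, and the middle one is rescaled. This gives \<rho> the same factor \<open>eps\<close>
    in every degree, including the middle.\<close>
  define e where "e h = (if h = m then sU r (b m) else if m < h then b h
    else sU (of_int eps) (rho_complex X (b (w - h))))" for h
  have eps_unit: "(of_int eps :: 'e coeff) dvd 1" using eps(1) by auto
  have epseps: "of_int eps * of_int eps = (1 :: 'e coeff)" using eps(1) by auto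
  have gen: "generator h (e h)" if h: "h \<in> types" for h
  proof -
    have "generator (w - (w - h)) (rho_complex X (b (w - h)))"
      by (rule generator_rho[OF b[OF types_symmetric[OF h]]])
    then show ?thesis
      using h m(1) wm(2) eps_unit by (auto simp: e_def intro: generator_scale b)
  qed
  obtain C where C: "quotient_basis sU {0} types e C" using generator_basis[of e] gen by blast
  have rho: "rho_complex X (e h) = sU (of_int eps) (e (w - h))" for h
  proof -
    consider "h = m" | "m < h" | "h < m" by linarith
    then show ?thesis
    proof cases
      case 1
      then show ?thesis using m by (simp add: e_def rhoc.scale eps(2) mult.commute)
    next
      case 2
      then show ?thesis using m by (simp add: e_def epseps)
    next
      case 3
      then show ?thesis using m by (simp add: e_def rhoc.scale rho_complex_rho_complex)
    qed
  qed
  have "critical_hodge_basis X types (\<lambda>h. h) (\<lambda>h. w - h) e C m m eps wm"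
  proof (intro critical_hodge_basis.intro hodge_basis.intro hodge_basis_axioms.intro
      critical_hodge_basis_axioms.intro realization_axioms C)
    show "T u \<in> fil_complex X p \<longleftrightarrow> (\<forall>h\<in>types. h < p \<longrightarrow> C u h = 0)" for u p
      by (rule fil_complex_iff[OF _ C]) (rule gen)
    show "T (e m) - wm \<otimes>\<^sub>t 1 \<in> fil_complex X (m + 1)" using wm(3) by (simp add: e_def)
    show "w - h \<in> types" if "h \<in> types" for h using that by (rule types_symmetric)
    show "rho_complex X (e h) = sU (of_int eps) (e (w - h))" for h by (rule rho)
  qed (use m eps(1) wm(1) in auto)
  moreover have "middle_sign X = eps"
    using middle_sign_eq[OF gen[OF m(1)] m(2) eps(1)] rho[of m] m(2) by simp
  ultimately show ?thesis using m(2) gen by blast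
qed

end

section \<open>The tensor product motive\<close>

locale tensor_motive =
  M: critical_hodge_basis M "realization.types M" "\<lambda>h. h" "\<lambda>h. weight M - h" e C m m eps wm +
  M': critical_hodge_basis M' "realization.types M'" "\<lambda>h. h" "\<lambda>h. weight M' - h" e' C' m' m' eps' wm' +
  N: realization N
  for M :: "('e :: field_char_0, 'b :: ab_group_add, 'r :: ab_group_add) motive"
    and M' :: "('e, 'b' :: ab_group_add, 'r' :: ab_group_add) motive"
    and N :: "('e, 'b'' :: ab_group_add, 'r'' :: ab_group_add) motive"
    and e C m eps wm e' C' m' eps' wm' +
  fixes \<beta> :: "'b \<Rightarrow> 'b' \<Rightarrow> 'b''" and \<delta> :: "'r \<Rightarrow> 'r' \<Rightarrow> 'r''"
  assumes gen: "p \<in> M.types \<Longrightarrow> M.generator p (e p)"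
    and gen': "p \<in> M'.types \<Longrightarrow> M'.generator p (e' p)"
    and weight: "weight M = 2 * m" "weight M' = 2 * m'"
    and weight_N: "weight N = weight M + weight M'"
    and \<beta>: "is_tensor_product (betti_scale M) (betti_scale M') (betti_scale N) \<beta>"
    and \<delta>: "is_tensor_product (dr_scale M) (dr_scale M') (dr_scale N) \<delta>"
    and rho_N: "rho N (\<beta> x y) = \<beta> (rho M x) (rho M' y)"
    and hodge_N: "hodge N p q = Modules.module.span (betti_scale_complex N)
      {tensor_map2 \<beta> (*) x y | x y a b. x \<in> hodge M a b \<and> y \<in> hodge M' (p - a) (q - b)}"
    and fil_N: "fil N p = Modules.module.span (dr_scale N)
      {\<delta> x y | x y a. x \<in> fil M a \<and> y \<in> fil M' (p - a)}"
    and comparison_N: "comparison N (tensor_map2 \<beta> (*) u v) =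
      tensor_map2 \<delta> (*) (comparison M u) (comparison M' v)"
begin

abbreviation "\<beta>c \<equiv> tensor_map2 \<beta> ((*) :: complex \<Rightarrow> _)"
abbreviation "\<delta>c \<equiv> tensor_map2 \<delta> ((*) :: complex \<Rightarrow> _)"

lemma biadditive_\<beta>: "biadditive \<beta>" and biadditive_\<delta>: "biadditive \<delta>"
  using \<beta> \<delta> by (simp_all add: is_tensor_product_def)

lemma \<beta>_scale: "\<beta> (M.sB r x) y = N.sB r (\<beta> x y)" "\<beta> x (M'.sB r y) = N.sB r (\<beta> x y)"
  using \<beta> by (simp_all add: is_tensor_product_def)

lemma biadditive_\<beta>c: "biadditive \<beta>c" and biadditive_\<delta>c: "biadditive \<delta>c"
  by (intro biadditive_tensor_map2 biadditive_\<beta> biadditive_\<delta> biadditive_mult)+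

lemma \<beta>c_pure: "\<beta>c (a \<otimes>\<^sub>t z) (b \<otimes>\<^sub>t z') = \<beta> a b \<otimes>\<^sub>t (z * z')"
  by (intro tensor_map2_pure biadditive_\<beta> biadditive_mult)

lemma \<delta>c_pure: "\<delta>c (a \<otimes>\<^sub>t z) (b \<otimes>\<^sub>t z') = \<delta> a b \<otimes>\<^sub>t (z * z')"
  by (intro tensor_map2_pure biadditive_\<delta> biadditive_mult)

lemma \<beta>c_scale:
  "\<beta>c (M.sU r x) y = N.sU r (\<beta>c x y)" "\<beta>c x (M'.sU r y) = N.sU r (\<beta>c x y)"
  unfolding betti_scale_complex_def
  by (rule tensor_map2_scale[of "betti_scale M" "betti_scale M'" "betti_scale N" \<beta>];
      rule M.module_B M'.module_B N.module_B biadditive_\<beta> \<beta>_scale)+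

interpretation \<beta>c_left: additive "\<lambda>x. \<beta>c x y" for y
  by (rule additive_biadditive(2)[OF biadditive_\<beta>c])

interpretation \<beta>c_right: additive "\<beta>c x" for x
  by (rule additive_biadditive(1)[OF biadditive_\<beta>c])

lemma betti_complex_ext:
  assumes f: "additive f" and g: "additive g" and fg: "\<And>x y. f (\<beta>c x y) = g (\<beta>c x y)"
  shows "f u = g u"
proof (rule tensor_ext[OF f g])
  fix t :: 'b'' and z :: complex
  show "f (t \<otimes>\<^sub>t z) = g (t \<otimes>\<^sub>t z)"
  proof (rule tensor_product_ext[OF \<beta>, of "\<lambda>t. f (t \<otimes>\<^sub>t z)" "\<lambda>t. g (t \<otimes>\<^sub>t z)"])
    show "additive (\<lambda>t. f (t \<otimes>\<^sub>t z))" "additive (\<lambda>t. g (t \<otimes>\<^sub>t z))"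
      by (auto simp: additive_def pure_tensor_add_left additive.add[OF f] additive.add[OF g])
    show "f (\<beta> x y \<otimes>\<^sub>t z) = g (\<beta> x y \<otimes>\<^sub>t z)" for x y
      using fg[of "x \<otimes>\<^sub>t z" "y \<otimes>\<^sub>t 1"] by (simp add: \<beta>c_pure)
  qed
qed

lemma rho_complex_N: "rho_complex N (\<beta>c x y) = \<beta>c (rho_complex M x) (rho_complex M' y)"
proof (induction x rule: tensor_induct)
  case (pure a z)
  show ?case
    by (induction y rule: tensor_induct)
      (simp_all add: \<beta>c_pure N.rho_complex_pure M.rho_complex_pure M'.rho_complex_pure rho_N
        \<beta>c_right.diff N.rhoc.diff M'.rhoc.diff)
qed (simp add: \<beta>c_left.diff N.rhoc.diff M.rhoc.diff)

text \<open>Products of functionals are available only over the coefficient field, while Hodge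
  coordinates exist only over E \<otimes> \<complex>. So the coordinates of rational bases are
  multiplied and extended, and then recombined through the Hodge coordinates of the rational basis
  vectors.\<close>

lemma ex_coord:
  "\<exists>C''. (\<forall>h h'. Modules.module_hom N.sU (*) (\<lambda>u. C'' u (h, h'))) \<and>
    (\<forall>x y. \<forall>h\<in>M.types. \<forall>h'\<in>M'.types. C'' (\<beta>c x y) (h, h') = C x h * C' y h')"
proof -
  obtain vs c where v: "quotient_basis M.sB {0} {..<length vs} (nth vs) c"
    and vc: "quotient_basis M.sU {0} {..<length vs} (\<lambda>i. vs ! i \<otimes>\<^sub>t 1) (\<lambda>u i. cext c i u)"
    using M.ex_basis by blast
  obtain vs' c' where v': "quotient_basis M'.sB {0} {..<length vs'} (nth vs') c'"
    and vc': "quotient_basis M'.sU {0} {..<length vs'} (\<lambda>i. vs' ! i \<otimes>\<^sub>t 1) (\<lambda>u i. cext c' i u)"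
    using M'.ex_basis by blast
  let ?I = "{..<length vs}" and ?J = "{..<length vs'}"
  let ?c = "\<lambda>i. cext c i"
  let ?c' = "\<lambda>j. cext c' j"
  have "\<forall>i\<in>?I. \<forall>j\<in>?J. \<exists>h. Modules.module_hom N.sB (*) h \<and> (\<forall>x y. h (\<beta> x y) = c x i * c' y j)"
    using tensor_product_functional[OF \<beta> N.module_B] quotient_basis.coord_hom[OF v]
      quotient_basis.coord_hom[OF v'] by blast
  then obtain g where g: "\<And>i j. i \<in> ?I \<Longrightarrow> j \<in> ?J \<Longrightarrow> Modules.module_hom N.sB (*) (g i j)"
    and g_\<beta>: "\<And>i j x y. i \<in> ?I \<Longrightarrow> j \<in> ?J \<Longrightarrow> g i j (\<beta> x y) = c x i * c' y j"
    by metis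
  define G where "G i j = tensor_map (g i j) (id :: complex \<Rightarrow> complex)" for i j
  have G: "Modules.module_hom N.sU (*) (G i j)" if "i \<in> ?I" "j \<in> ?J" for i j
    unfolding G_def betti_scale_complex_def using module_hom_tensor_map[OF g[OF that]] by simp
  have G_\<beta>: "G i j (\<beta>c x y) = ?c i x * ?c' j y" if ij: "i \<in> ?I" "j \<in> ?J" for i j x y
  proof -
    interpret G: Modules.module_hom N.sU "(*)" "G i j" by (rule G[OF ij])
    interpret c: Modules.module_hom M.sU "(*)" "?c i" by (rule quotient_basis.coord_hom[OF vc ij(1)])
    interpret c': Modules.module_hom M'.sU "(*)" "?c' j" by (rule quotient_basis.coord_hom[OF vc' ij(2)])
    have G_pure: "G i j (t \<otimes>\<^sub>t z) = g i j t \<otimes>\<^sub>t z" for t z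
      unfolding G_def
      by (subst tensor_map_pure[OF additive_module_hom[OF g[OF ij]] additive_id]) simp
    have c_pure: "?c i (t \<otimes>\<^sub>t z) = c t i \<otimes>\<^sub>t z" for t z
      by (subst tensor_map_pure[OF additive_module_hom[OF quotient_basis.coord_hom[OF v ij(1)]] additive_id])
        simp
    have c'_pure: "?c' j (t \<otimes>\<^sub>t z) = c' t j \<otimes>\<^sub>t z" for t z
      by (subst tensor_map_pure[OF additive_module_hom[OF quotient_basis.coord_hom[OF v' ij(2)]] additive_id])
        simp
    show ?thesis
    proof (induction x rule: tensor_induct)
      case x: (pure a z)
      show ?case
      proof (induction y rule: tensor_induct)
        case (pure b z')
        show ?case
          unfolding \<beta>c_pure G_pure c_pure c'_pure g_\<beta>[OF ij] times_pure_tensor ..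
      next
        case (diff y y')
        then show ?case by (simp only: \<beta>c_right.diff G.diff c'.diff right_diff_distrib)
      qed
    next
      case (diff x x')
      then show ?case by (simp only: \<beta>c_left.diff G.diff c.diff left_diff_distrib)
    qed
  qed
  define C'' where "C'' u h = (\<Sum>i\<in>?I. \<Sum>j\<in>?J.
    G i j u * (C (vs ! i \<otimes>\<^sub>t 1) (fst h) * C' (vs' ! j \<otimes>\<^sub>t 1) (snd h)))" for u h
  have "Modules.module_hom N.sU (*) (\<lambda>u. C'' u (h, h'))" for h h'
  proof (intro module_hom.intro module_hom_axioms.intro module_mult N.U.module_axioms)
    show "C'' (u + v) (h, h') = C'' u (h, h') + C'' v (h, h')" for u v
      by (simp add: C''_def module_hom.add[OF G] distrib_right sum.distrib)
    show "C'' (N.sU r u) (h, h') = r * C'' u (h, h')" for r u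
      by (simp add: C''_def module_hom.scale[OF G] sum_distrib_left mult.assoc)
  qed
  moreover have "C'' (\<beta>c x y) (h, h') = C x h * C' y h'" if h: "h \<in> M.types" "h' \<in> M'.types" for x y h h'
  proof -
    have 1: "C x h = (\<Sum>i\<in>?I. ?c i x * C (vs ! i \<otimes>\<^sub>t 1) h)"
      by (rule quotient_basis.coord_expand[OF vc _ M.E.coord_hom[OF h(1)]])
        (simp add: M.E.coord_0 h)
    have 2: "C' y h' = (\<Sum>j\<in>?J. ?c' j y * C' (vs' ! j \<otimes>\<^sub>t 1) h')"
      by (rule quotient_basis.coord_expand[OF vc' _ M'.E.coord_hom[OF h(2)]])
        (simp add: M'.E.coord_0 h)
    show ?thesis
      unfolding 1 2 sum_product C''_def fst_conv snd_conv
      by (intro sum.cong refl) (simp only: G_\<beta> mult_ac)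
  qed
  ultimately show ?thesis by blast
qed

definition C'' :: "('b'', complex) tensor \<Rightarrow> int \<times> int \<Rightarrow> 'e coeff" where
  "C'' = (SOME C''. (\<forall>h h'. Modules.module_hom N.sU (*) (\<lambda>u. C'' u (h, h'))) \<and>
    (\<forall>x y. \<forall>h\<in>M.types. \<forall>h'\<in>M'.types. C'' (\<beta>c x y) (h, h') = C x h * C' y h'))"

lemma C'': "(\<forall>h h'. Modules.module_hom N.sU (*) (\<lambda>u. C'' u (h, h'))) \<and>
    (\<forall>x y. \<forall>h\<in>M.types. \<forall>h'\<in>M'.types. C'' (\<beta>c x y) (h, h') = C x h * C' y h')"
  unfolding C''_def by (rule someI_ex[OF ex_coord])

lemmas C''_hom = C''[THEN conjunct1, rule_format]
  and C''_\<beta>c = C''[THEN conjunct2, rule_format]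

definition e'' :: "int \<times> int \<Rightarrow> ('b'', complex) tensor" where
  "e'' h = \<beta>c (e (fst h)) (e' (snd h))"

lemma basis_N: "quotient_basis N.sU {0} (M.types \<times> M'.types) e'' C''"
proof unfold_locales
  let ?H = "M.types \<times> M'.types"
  fix u
  have "(\<Sum>h\<in>?H. N.sU (C'' u h) (e'' h)) = u"
  proof (rule betti_complex_ext[where g = "\<lambda>u. u"])
    show "additive (\<lambda>u. \<Sum>h\<in>?H. N.sU (C'' u h) (e'' h))"
      by standard (auto simp: module_hom.add[OF C''_hom] N.U.scale_left_distrib
          sum.distrib[symmetric] intro!: sum.cong)
    show "additive (\<lambda>u :: ('b'', complex) tensor. u)" by standard simp
    fix x y
    have "\<beta>c x y = \<beta>c (\<Sum>h\<in>M.types. M.sU (C x h) (e h)) (\<Sum>h'\<in>M'.types. M'.sU (C' y h') (e' h'))"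
      using M.expand[of x] M'.expand[of y] by simp
    also have "\<dots> = (\<Sum>h\<in>M.types. \<Sum>h'\<in>M'.types. N.sU (C x h * C' y h') (\<beta>c (e h) (e' h')))"
      unfolding \<beta>c_left.sum \<beta>c_scale(1)
      by (simp add: \<beta>c_right.sum \<beta>c_scale(2) N.U.scale_sum_right)
    also have "\<dots> = (\<Sum>h\<in>?H. N.sU (C'' (\<beta>c x y) h) (e'' h))"
      unfolding sum.cartesian_product
      by (intro sum.cong refl) (auto simp: C''_\<beta>c e''_def)
    finally show "(\<Sum>h\<in>?H. N.sU (C'' (\<beta>c x y) h) (e'' h)) = \<beta>c x y" by simp
  qed
  then show "u - (\<Sum>h\<in>?H. N.sU (C'' u h) (e'' h)) \<in> {0}" by simp
next
  fix h k assume "h \<in> M.types \<times> M'.types" "k \<in> M.types \<times> M'.types"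
  then show "C'' (e'' h) k = (if h = k then 1 else 0)"
    by (cases h; cases k) (auto simp: e''_def C''_\<beta>c M.E.coord_basis M'.E.coord_basis)
next
  fix h assume "h \<in> M.types \<times> M'.types"
  show "C'' (u + v) h = C'' u h + C'' v h" for u v
    by (cases h) (simp add: module_hom.add[OF C''_hom])
  show "C'' (N.sU r u) h = r * C'' u h" for r u
    by (cases h) (simp add: module_hom.scale[OF C''_hom])
  show "C'' u h = 0" if "u \<in> {0}" for u
    using that by (cases h) (simp add: module_hom.zero[OF C''_hom])
qed (simp add: M.finite_types M'.finite_types)

text \<open>Hodge degrees add: a product from degrees a and p' - a can have a nonzero coordinate
  only at (a, p' - a), and each \<open>e'' h\<close> lies in the piece whose degree is the sum of
  the two entries.\<close>

lemma fil_complex_N_iff: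
  "comparison N u \<in> fil_complex N p \<longleftrightarrow>
    (\<forall>h\<in>M.types \<times> M'.types. fst h + snd h < p \<longrightarrow> C'' u h = 0)"
proof -
  interpret E: quotient_basis N.sU "{0}" "M.types \<times> M'.types" e'' C'' by (rule basis_N)
  let ?S = "\<Union>p'\<in>{p..}. \<Union>q. hodge N p' q"
  let ?K = "{u. \<forall>h\<in>M.types \<times> M'.types. fst h + snd h < p \<longrightarrow> C'' u h = 0}"
  have K: "N.U.subspace ?K"
    by (rule N.U.subspaceI) (auto simp: E.coord_0 E.coord_add E.coord_scale)
  have "fil_complex N p = N.T ` N.U.span ?S" using N.pure unfolding pure_motive_def by blast
  then have "N.T u \<in> fil_complex N p \<longleftrightarrow> u \<in> N.U.span ?S"
    using N.bij_comparison by (auto simp: bij_def inj_def)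
  also have "\<dots> \<longleftrightarrow> u \<in> ?K"
  proof
    have "hodge N p' q \<subseteq> ?K" if "p \<le> p'" for p' q
      unfolding hodge_N
    proof (rule N.U.span_minimal[OF _ K], clarify)
      fix x y a b h h'
      assume x: "x \<in> hodge M a b" and y: "y \<in> hodge M' (p' - a) (q - b)"
        and h: "h \<in> M.types" "h' \<in> M'.types" "fst (h, h') + snd (h, h') < p"
      have "h \<noteq> a \<or> h' \<noteq> p' - a" using h that by auto
      then have "C x h = 0 \<or> C' y h' = 0"
        using M.hodge_coord[OF gen M.basis x h(1)] M'.hodge_coord[OF gen' M'.basis y h(2)] by blast
      then show "C'' (\<beta>c x y) (h, h') = 0" using h by (auto simp: C''_\<beta>c)
    qed
    then have "?S \<subseteq> ?K" by blast
    then show "u \<in> N.U.span ?S \<Longrightarrow> u \<in> ?K" using N.U.span_minimal[OF _ K] by blast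
  next
    assume u: "u \<in> ?K"
    have "N.sU (C'' u h) (e'' h) \<in> N.U.span ?S" if h: "h \<in> M.types \<times> M'.types" for h
    proof (cases "fst h + snd h < p")
      case True
      then have "C'' u h = 0" using u h by blast
      then show ?thesis by (simp add: N.U.span_zero)
    next
      case False
      have e: "e (fst h) \<in> hodge M (fst h) (weight M - fst h)"
        using h by (intro M.generator_in gen) auto
      have e': "e' (snd h) \<in> hodge M' (snd h) (weight M' - snd h)"
        using h by (intro M'.generator_in gen') auto
      have "e'' h \<in> hodge N (fst h + snd h) (weight N - (fst h + snd h))"
        unfolding hodge_N e''_def
      proof (rule N.U.span_base, rule CollectI, intro exI conjI)
        show "e' (snd h) \<in> hodge M' (fst h + snd h - fst h)
            (weight N - (fst h + snd h) - (weight M - fst h))"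
          using e' by (simp add: weight_N)
      qed (rule refl e)+
      then show ?thesis using False by (intro N.U.span_scale N.U.span_base) auto
    qed
    then have "(\<Sum>h\<in>M.types \<times> M'.types. N.sU (C'' u h) (e'' h)) \<in> N.U.span ?S"
      by (rule N.U.span_sum)
    then show "u \<in> N.U.span ?S" using E.coord_approx[of u] by simp
  qed
  finally show ?thesis by simp
qed

lemma middle_N:
  "comparison N (e'' (m, m')) - \<delta> wm wm' \<otimes>\<^sub>t 1 \<in> fil_complex N (m + m' + 1)"
proof -
  interpret \<delta>c_left: additive "\<lambda>x. \<delta>c x y" for y
    by (rule additive_biadditive(2)[OF biadditive_\<delta>c])
  interpret \<delta>c_right: additive "\<delta>c x" for x
    by (rule additive_biadditive(1)[OF biadditive_\<delta>c])
  define x where "x = inv_into UNIV M.T (M.T (e m) - wm \<otimes>\<^sub>t 1)"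
  define x' where "x' = inv_into UNIV M'.T (M'.T (e' m') - wm' \<otimes>\<^sub>t 1)"
  have Tx: "M.T x = M.T (e m) - wm \<otimes>\<^sub>t 1" by (simp add: x_def M.comparison_inv)
  have Tx': "M'.T x' = M'.T (e' m') - wm' \<otimes>\<^sub>t 1" by (simp add: x'_def M'.comparison_inv)
  have x: "C x h = 0" if "h \<in> M.types" "h < m + 1" for h
    using M.wm that unfolding Tx[symmetric] M.fil_iff by blast
  have x': "C' x' h = 0" if "h \<in> M'.types" "h < m' + 1" for h
    using M'.wm that unfolding Tx'[symmetric] M'.fil_iff by blast
  \<comment> \<open>\<open>e m - x\<close> and \<open>e' m' - x'\<close> map to \<open>wm\<close>
    and \<open>wm'\<close>, so \<open>u\<close> maps to the required difference. In degrees up to m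
    + m', either one index is below its middle and both terms vanish, or both are middle and the
    terms cancel.\<close>
  define u where "u = \<beta>c (e m) (e' m') - \<beta>c (e m - x) (e' m' - x')"
  have "M.T (e m - x) = wm \<otimes>\<^sub>t 1" "M'.T (e' m' - x') = wm' \<otimes>\<^sub>t 1"
    by (simp_all add: M.T.diff Tx M'.T.diff Tx')
  then have "N.T u = N.T (e'' (m, m')) - \<delta> wm wm' \<otimes>\<^sub>t 1"
    unfolding u_def N.T.diff comparison_N by (simp add: \<delta>c_pure e''_def comparison_N)
  moreover have "N.T u \<in> fil_complex N (m + m' + 1)"
    unfolding fil_complex_N_iff
  proof (clarify)
    fix h h' assume h: "h \<in> M.types" "h' \<in> M'.types" "fst (h, h') + snd (h, h') < m + m' + 1"
    have "C'' u (h, h') = C (e m) h * C' (e' m') h' - C (e m - x) h * C' (e' m' - x') h'"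
      using h by (simp add: u_def module_hom.diff[OF C''_hom] C''_\<beta>c)
    also have "\<dots> = 0"
    proof -
      consider "h < m" | "h' < m'" | "h = m" "h' = m'" using h(3) by fastforce
      then show ?thesis
      proof cases
        case 1
        then show ?thesis using h x[of h] M.mid_in
          by (simp add: M.E.coord_diff M.E.coord_basis)
      next
        case 2
        then show ?thesis using h x'[of h'] M'.mid_in
          by (simp add: M'.E.coord_diff M'.E.coord_basis)
      next
        case 3
        then show ?thesis using h x[of h] x'[of h']
          by (simp add: M.E.coord_diff M'.E.coord_diff)
      qed
    qed
    finally show "C'' u (h, h') = 0" .
  qed
  ultimately show ?thesis by simp
qed

text \<open>Other pairs than (m, m') may still have degree m + m'; only the fixed point of the
  product involution is known to be unique at this stage.\<close>

lemma hodge_basis_N: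
  "hodge_basis N (M.types \<times> M'.types) (\<lambda>h. fst h + snd h) (\<lambda>h. (weight M - fst h, weight M' - snd h))
     e'' C'' (m, m') (m + m') (eps * eps') (\<delta> wm wm')"
proof (intro hodge_basis.intro hodge_basis_axioms.intro N.realization_axioms basis_N fil_complex_N_iff middle_N)
  fix h assume h: "h \<in> M.types \<times> M'.types"
  show "rho_complex N (e'' h) = N.sU (of_int (eps * eps')) (e'' (weight M - fst h, weight M' - snd h))"
    using h by (auto simp: e''_def rho_complex_N M.rho_basis M'.rho_basis \<beta>c_scale mult.commute)
  show "(weight M - fst h, weight M' - snd h) \<in> M.types \<times> M'.types"
    using h by (auto intro: M.types_symmetric M'.types_symmetric)
next
  show "\<delta> wm wm' \<in> fil N (m + m')"
    unfolding fil_N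
  proof (rule N.D.span_base, rule CollectI, intro exI conjI)
    show "wm \<in> fil M m" by (rule M.wm_in)
    show "wm' \<in> fil M' (m + m' - m)" using M'.wm_in by simp
  qed (rule refl)
  show "eps * eps' \<in> {1, -1}" using M.eps M'.eps by auto
  show "(m, m') \<in> M.types \<times> M'.types" using M.mid_in M'.mid_in by simp
qed (use weight in auto)

end

section \<open>Eigenvectors of complex conjugation in coordinates\<close>

context realization
begin

lemma betti_basis_coord_rho:
  assumes t: "t \<in> {1, -1}" and v: "betti_basis t I v c" and i: "i \<in> I"
  shows "c (rho X x) i = of_int t * c x i"
proof -
  interpret quotient_basis sB "betti_part X (- t)" I v c using v by (simp add: betti_basis_def)
  obtain y where y: "y \<in> betti_part X t" "x - y \<in> betti_part X (- t)"
    using betti_part_sum[OF t, of x] by blast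
  have "c x i = c y i" using coord_vanish[OF i y(2)] i by (simp add: coord_diff)
  moreover have "rho X x = sB (of_int t) y - sB (of_int t) (x - y)"
    using y rho.add[of y "x - y"] by (simp add: betti_part_def)
  then have "c (rho X x) i = of_int t * c y i"
    using coord_vanish[OF i y(2)] i by (simp only: coord_diff coord_scale) simp
  ultimately show ?thesis by simp
qed

end

context critical_hodge_basis
begin

text \<open>Coefficients expressing the coordinate at \<open>h\<close> of a vector of H_B^t through
  those at \<open>Pos t\<close>. They are integers and do not depend on the vector, so they can be
  split off as a matrix factor.\<close>

definition fold_sign :: "int \<Rightarrow> 'i \<Rightarrow> 'i \<Rightarrow> int" where
  "fold_sign t h g = (if h = g then 1 else if \<iota> h = g then t * eps else 0)"

text \<open>Outside \<open>Pos t\<close> there are two cases. Either \<iota> h lies in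
  \<open>Pos t\<close> and carries the coordinate up to the sign t * eps, or h = mid and t = - eps.
  In the latter case the coordinate is its own negative and vanishes, in accordance with a zero row
  of \<open>fold_sign\<close>.\<close>

lemma coord_fold:
  assumes t: "t \<in> {1, -1}" and x: "x \<in> betti_part X t" and h: "h \<in> H"
  shows "C (x \<otimes>\<^sub>t 1) h = (\<Sum>g\<in>Pos t. of_int (fold_sign t h g) * C (x \<otimes>\<^sub>t 1) g)"
proof -
  have eq: "C (x \<otimes>\<^sub>t 1) h = of_int (t * eps) * C (x \<otimes>\<^sub>t 1) (\<iota> h)"
    using coord_betti_part[OF \<iota>_in[OF h] x] by (simp add: \<iota>_\<iota>[OF h])
  have single: "(\<Sum>g\<in>Pos t. of_int (fold_sign t h g) * C (x \<otimes>\<^sub>t 1) g) =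
      of_int (fold_sign t h k) * C (x \<otimes>\<^sub>t 1) k"
    if "k \<in> Pos t" "\<And>g. g \<in> Pos t \<Longrightarrow> g \<noteq> k \<Longrightarrow> fold_sign t h g = 0" for k
  proof -
    have "(\<Sum>g\<in>Pos t. of_int (fold_sign t h g) * C (x \<otimes>\<^sub>t 1) g) =
      (\<Sum>g\<in>Pos t. if g = k then of_int (fold_sign t h k) * C (x \<otimes>\<^sub>t 1) k else 0)"
      using that(2) by (intro sum.cong refl) auto
    then show ?thesis using that(1) finite_Pos by simp
  qed
  consider "h \<in> Pos t" | "h \<notin> Pos t" "\<iota> h \<in> Pos t" | "h \<notin> Pos t" "\<iota> h \<notin> Pos t" by blast
  then show ?thesis
  proof cases
    case 1
    have "fold_sign t h g = 0" if g: "g \<in> Pos t" "g \<noteq> h" for g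
    proof -
      have "\<iota> h \<noteq> g"
        using 1 g h \<iota>_mid dg_\<iota>[OF h] dg_mid
        by (auto simp: Pos_def positive_def split: if_splits)
      then show ?thesis using g by (simp add: fold_sign_def)
    qed
    then show ?thesis using single[OF 1] by (simp add: fold_sign_def)
  next
    case 2
    then have "h \<noteq> \<iota> h" by auto
    have "fold_sign t h g = 0" if "g \<in> Pos t" "g \<noteq> \<iota> h" for g
      using that 2 by (auto simp: fold_sign_def)
    then show ?thesis using single[OF 2(2)] eq \<open>h \<noteq> \<iota> h\<close> by (simp add: fold_sign_def)
  next
    case 3
    have "dg h = m"
    proof (rule ccontr)
      assume "dg h \<noteq> m"
      then have "m < dg h \<or> m < dg (\<iota> h)" using dg_\<iota>[OF h] by linarith
      then show False using 3 h \<iota>_in[OF h] by (auto simp: Pos_def positive_def split: if_splits)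
    qed
    then have mid: "h = mid" by (rule middle[OF h])
    then have "t \<noteq> eps" using 3 by (auto simp: Pos_def)
    then have "t * eps = -1" using t eps by auto
    then have "C (x \<otimes>\<^sub>t 1) h = - C (x \<otimes>\<^sub>t 1) h" using eq mid \<iota>_mid by simp
    then have "C (x \<otimes>\<^sub>t 1) h + C (x \<otimes>\<^sub>t 1) h = 0" by (metis add.left_inverse)
    then have "C (x \<otimes>\<^sub>t 1) h = 0" by (rule coeff_module_double_eq_0[OF module_mult])
    moreover have "(\<Sum>g\<in>Pos t. of_int (fold_sign t h g) * C (x \<otimes>\<^sub>t 1) g) = 0"
      using 3 by (intro sum.neutral) (auto simp: fold_sign_def)
    ultimately show ?thesis by simp
  qed
qed

end

section \<open>Rational bases and minors of the tensor product\<close>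

locale critical_tensor_motive = tensor_motive M M' N e C m eps wm e' C' m' eps' wm' \<beta> \<delta>
  for M :: "('e :: field_char_0, 'b :: ab_group_add, 'r :: ab_group_add) motive"
    and M' :: "('e, 'b' :: ab_group_add, 'r' :: ab_group_add) motive"
    and N :: "('e, 'b'' :: ab_group_add, 'r'' :: ab_group_add) motive"
    and e C m eps wm e' C' m' eps' wm' \<beta> \<delta> +
  assumes critical_N: "critical N"
begin

sublocale K: critical_hodge_basis N "M.types \<times> M'.types" "\<lambda>h. fst h + snd h"
  "\<lambda>h. (weight M - fst h, weight M' - snd h)" e'' C'' "(m, m')" "m + m'" "eps * eps'" "\<delta> wm wm'"
proof (intro critical_hodge_basis.intro critical_hodge_basis_axioms.intro hodge_basis_N)
  fix h assume "h \<in> M.types \<times> M'.types" "fst h + snd h = m + m'"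
  then show "h = (m, m')" by (rule hodge_basis.critical_imp_middle[OF hodge_basis_N critical_N])
qed

text \<open>A triple (s, i, j) labels the product of the vector of sign s at i with the vector of
  sign t * s at j; since s is a sign, t * s is the complementary one with product t.\<close>

definition D :: "int \<Rightarrow> (int \<times> int \<times> int) set" where
  "D t = Sigma {1, -1} (\<lambda>s. M.Pos s \<times> M'.Pos (t * s))"

lemma finite_D: "finite (D t)"
  by (simp add: D_def M.finite_Pos M'.finite_Pos)

lemma sum_D: "(\<Sum>d\<in>D t. f d) = (\<Sum>s\<in>{1, -1}. \<Sum>i\<in>M.Pos s. \<Sum>j\<in>M'.Pos (t * s). f (s, i, j))"
proof -
  have "(\<Sum>d\<in>D t. f d) = (\<Sum>s\<in>{1, -1}. \<Sum>p\<in>M.Pos s \<times> M'.Pos (t * s). f (s, p))"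
    unfolding D_def by (subst sum.Sigma) (auto simp: M.finite_Pos M'.finite_Pos)
  also have "\<dots> = (\<Sum>s\<in>{1, -1}. \<Sum>i\<in>M.Pos s. \<Sum>j\<in>M'.Pos (t * s). f (s, i, j))"
    by (intro sum.cong refl) (simp add: sum.cartesian_product)
  finally show ?thesis .
qed

definition product_family :: "(int \<Rightarrow> int \<Rightarrow> 'b) \<Rightarrow> (int \<Rightarrow> int \<Rightarrow> 'b') \<Rightarrow> int \<Rightarrow> int \<times> int \<times> int \<Rightarrow> 'b''" where
  "product_family v v' t d = \<beta> (v (fst d) (fst (snd d))) (v' (t * fst d) (snd (snd d)))"

interpretation \<beta>_left: additive "\<lambda>x. \<beta> x y" for y
  by (rule additive_biadditive(2)[OF biadditive_\<beta>])

interpretation \<beta>_right: additive "\<beta> x" for x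
  by (rule additive_biadditive(1)[OF biadditive_\<beta>])

lemma \<beta>_betti_part:
  assumes "x \<in> betti_part M s" "y \<in> betti_part M' t"
  shows "\<beta> x y \<in> betti_part N (s * t)"
  using assms by (simp add: betti_part_def rho_N \<beta>_scale)

text \<open>The coordinates are products of coordinate functions of the factors. Such a functional g
  satisfies g (\<rho> x) = t g x, so it vanishes on the eigenspace of sign - t. That the remainder
  lies in this eigenspace is tested on products \<beta> x y.\<close>

lemma product_betti_basis:
  assumes t: "t \<in> {1, -1}"
    and v: "\<And>s. s \<in> {1, -1} \<Longrightarrow> M.betti_basis s (M.Pos s) (v s) (c s)"
    and v': "\<And>s. s \<in> {1, -1} \<Longrightarrow> M'.betti_basis s (M'.Pos s) (v' s) (c' s)"
  shows "\<exists>c''. N.betti_basis t (D t) (product_family v v' t) c''"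
proof -
  have ts: "t * s \<in> {1, -1}" if "s \<in> {1, -1}" for s using t that by auto
  have qv: "quotient_basis M.sB (betti_part M (- s)) (M.Pos s) (v s) (c s)"
    and v_in: "i \<in> M.Pos s \<Longrightarrow> v s i \<in> betti_part M s" if "s \<in> {1, -1}" for s i
    using v[OF that] by (auto simp: M.betti_basis_def)
  have qv': "quotient_basis M'.sB (betti_part M' (- s)) (M'.Pos s) (v' s) (c' s)"
    and v'_in: "i \<in> M'.Pos s \<Longrightarrow> v' s i \<in> betti_part M' s" if "s \<in> {1, -1}" for s i
    using v'[OF that] by (auto simp: M'.betti_basis_def)
  have "\<forall>d\<in>D t. \<exists>h. Modules.module_hom N.sB (*) h \<and>
      (\<forall>x y. h (\<beta> x y) = c (fst d) x (fst (snd d)) * c' (t * fst d) y (snd (snd d)))"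
  proof
    fix d assume "d \<in> D t"
    then have s: "fst d \<in> {1, -1}" and i: "fst (snd d) \<in> M.Pos (fst d)"
      and j: "snd (snd d) \<in> M'.Pos (t * fst d)" by (auto simp: D_def)
    show "\<exists>h. Modules.module_hom N.sB (*) h \<and>
      (\<forall>x y. h (\<beta> x y) = c (fst d) x (fst (snd d)) * c' (t * fst d) y (snd (snd d)))"
      by (rule tensor_product_functional[OF \<beta> N.module_B quotient_basis.coord_hom[OF qv[OF s] i]
            quotient_basis.coord_hom[OF qv'[OF ts[OF s]] j]])
  qed
  then obtain g where g: "\<And>d. d \<in> D t \<Longrightarrow> Modules.module_hom N.sB (*) (g d)"
    and g_\<beta>: "\<And>d x y. d \<in> D t \<Longrightarrow> g d (\<beta> x y) = c (fst d) x (fst (snd d)) * c' (t * fst d) y (snd (snd d))"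
    by metis
  let ?v = "product_family v v' t"
  have g_rho: "g d (rho N x) = of_int t * g d x" if d: "d \<in> D t" for d x
  proof (rule tensor_product_ext[OF \<beta>, of "\<lambda>x. g d (rho N x)" "\<lambda>x. of_int t * g d x"])
    interpret g: Modules.module_hom N.sB "(*)" "g d" by (rule g[OF d])
    show "additive (\<lambda>x. g d (rho N x))" "additive (\<lambda>x. of_int t * g d x)"
      by (auto simp: additive_def N.rho.add g.add distrib_left)
    fix x y
    have s: "fst d \<in> {1, -1}" and i: "fst (snd d) \<in> M.Pos (fst d)"
      and j: "snd (snd d) \<in> M'.Pos (t * fst d)" using d by (auto simp: D_def)
    have "(of_int (fst d) * of_int (t * fst d) :: 'e) = of_int t" using s by auto
    then show "g d (rho N (\<beta> x y)) = of_int t * g d (\<beta> x y)"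
      unfolding rho_N g_\<beta>[OF d] M.betti_basis_coord_rho[OF s v[OF s] i]
        M'.betti_basis_coord_rho[OF ts[OF s] v'[OF ts[OF s]] j]
      by (metis (no_types, lifting) mult.assoc mult.left_commute)
  qed
  have v_mem: "?v d \<in> betti_part N t" if "d \<in> D t" for d
  proof -
    have s: "fst d \<in> {1, -1}" and i: "fst (snd d) \<in> M.Pos (fst d)"
      and j: "snd (snd d) \<in> M'.Pos (t * fst d)" using that by (auto simp: D_def)
    have "fst d * (t * fst d) = t" using s by auto
    then show ?thesis
      using \<beta>_betti_part[OF v_in[OF s i] v'_in[OF ts[OF s] j]] by (simp only: product_family_def)
  qed
  have "quotient_basis N.sB (betti_part N (- t)) (D t) ?v (\<lambda>x d. g d x)"
  proof unfold_locales
    show "finite (D t)" by (rule finite_D)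
    fix d assume d: "d \<in> D t"
    interpret g: Modules.module_hom N.sB "(*)" "g d" by (rule g[OF d])
    show "g d (x + y) = g d x + g d y" and "g d (N.sB r x) = r * g d x" for x y r
      by (rule g.add g.scale)+
    show "g d x = 0" if "x \<in> betti_part N (- t)" for x
    proof -
      have "g d (rho N x) = - of_int t * g d x" using that by (simp add: betti_part_def g.scale g.neg)
      then show ?thesis using g_rho[OF d, of x] t by auto
    qed
  next
    fix k d assume k: "k \<in> D t" and d: "d \<in> D t"
    obtain s i j where k': "k = (s, i, j)" "s \<in> {1, -1}" "i \<in> M.Pos s" "j \<in> M'.Pos (t * s)"
      using k by (auto simp: D_def)
    obtain r a b where d': "d = (r, a, b)" "r \<in> {1, -1}" "a \<in> M.Pos r" "b \<in> M'.Pos (t * r)"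
      using d by (auto simp: D_def)
    have g_eq: "g d (?v k) = c r (v s i) a * c' (t * r) (v' (t * s) j) b"
      using g_\<beta>[OF d] by (simp add: product_family_def k' d')
    show "g d (?v k) = (if k = d then 1 else 0)"
    proof (cases "r = s")
      case True
      then show ?thesis
        unfolding g_eq using k' d' quotient_basis.coord_basis[OF qv[OF k'(2)] k'(3), of a]
          quotient_basis.coord_basis[OF qv'[OF ts[OF k'(2)]] k'(4), of b] by auto
    next
      case False
      then have "s = - r" using k' d' by auto
      then have "c r (v s i) a = 0"
        using v_in[OF k'(2,3)] quotient_basis.coord_vanish[OF qv[OF d'(2)] d'(3)] by simp
      then show ?thesis unfolding g_eq using False k' d' by simp
    qed
  next
    fix x
    define P where "P x = x - (\<Sum>d\<in>D t. N.sB (g d x) (?v d))" for x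
    have P_add: "P (x + y) = P x + P y" for x y
      by (simp add: P_def module_hom.add[OF g] N.B.scale_left_distrib sum.distrib cong: sum.cong)
    have "rho N (P x) = N.sB (of_int (- t)) (P x)"
    proof (rule tensor_product_ext[OF \<beta>, of "\<lambda>x. rho N (P x)" "\<lambda>x. N.sB (of_int (- t)) (P x)"])
      show "additive (\<lambda>x. rho N (P x))" "additive (\<lambda>x. N.sB (of_int (- t)) (P x))"
        by (auto simp: additive_def P_add N.rho.add N.B.scale_right_distrib)
      fix x y
      define xs where "xs s = (\<Sum>i\<in>M.Pos s. M.sB (c s x i) (v s i))" for s
      define ys where "ys s = (\<Sum>j\<in>M'.Pos s. M'.sB (c' s y j) (v' s j))" for s
      have xs: "xs s \<in> betti_part M s" if "s \<in> {1, -1}" for s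
        unfolding xs_def using that
        by (intro M.B.subspace_sum M.B.subspace_scale M.subspace_betti_part v_in)
      have ys: "ys s \<in> betti_part M' s" if "s \<in> {1, -1}" for s
        unfolding ys_def using that
        by (intro M'.B.subspace_sum M'.B.subspace_scale M'.subspace_betti_part v'_in)
      have x_eq: "x = xs 1 + xs (-1)"
        using quotient_basis.coord_approx[OF M.betti_basis_sum[OF v[of 1] v[of "-1"]], of x]
        by (simp add: xs_def sum.Plus M.finite_Pos)
      have y_eq: "y = ys 1 + ys (-1)"
        using quotient_basis.coord_approx[OF M'.betti_basis_sum[OF v'[of 1] v'[of "-1"]], of y]
        by (simp add: ys_def sum.Plus M'.finite_Pos)
      have xs_ys: "\<beta> (xs s) (ys r) = (\<Sum>i\<in>M.Pos s. \<Sum>j\<in>M'.Pos r.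
          N.sB (c s x i * c' r y j) (\<beta> (v s i) (v' r j)))" for s r
        unfolding xs_def \<beta>_left.sum \<beta>_scale(1)
        by (simp add: ys_def \<beta>_right.sum \<beta>_scale(2) N.B.scale_sum_right)
      have "(\<Sum>d\<in>D t. N.sB (g d (\<beta> x y)) (?v d)) =
          (\<Sum>d\<in>D t. N.sB (c (fst d) x (fst (snd d)) * c' (t * fst d) y (snd (snd d))) (?v d))"
        by (intro sum.cong refl) (simp only: g_\<beta>)
      also have "\<dots> = (\<Sum>s\<in>{1, -1}. \<beta> (xs s) (ys (t * s)))"
        unfolding sum_D xs_ys product_family_def fst_conv snd_conv ..
      finally have "P (\<beta> x y) = \<beta> x y - (\<beta> (xs 1) (ys t) + \<beta> (xs (-1)) (ys (- t)))"
        by (simp add: P_def)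
      \<comment> \<open>Of the four products of eigencomponents, the two of sign t have been
        removed; the other two have sign - t.\<close>
      also have "\<dots> = \<beta> (xs 1) (ys (- t)) + \<beta> (xs (-1)) (ys t)"
        using t unfolding x_eq y_eq by (auto simp: \<beta>_left.add \<beta>_right.add)
      also have "\<dots> \<in> betti_part N (- t)"
        using \<beta>_betti_part[OF xs[of 1] ys[of "- t"]] \<beta>_betti_part[OF xs[of "-1"] ys[of t]] t
        by (intro N.B.subspace_add N.subspace_betti_part) auto
      finally show "rho N (P (\<beta> x y)) = N.sB (of_int (- t)) (P (\<beta> x y))"
        by (simp add: betti_part_def)
    qed
    then show "x - (\<Sum>d\<in>D t. N.sB (g d x) (?v d)) \<in> betti_part N (- t)"
      by (simp add: P_def betti_part_def)
  qed
  then show ?thesis using v_mem unfolding N.betti_basis_def by blast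
qed

end

context critical_tensor_motive
begin

lemma D_eq: "D t = Pair eps ` (M.Pos eps \<times> M'.Pos (t * eps)) \<union>
    Pair (- eps) ` (M.Pos (- eps) \<times> M'.Pos (- (t * eps)))"
  using M.eps unfolding D_def by auto

lemma det_on_Pair:
  assumes "finite A"
  shows "det_on (Pair s ` A) f = det_on A (\<lambda>p q. f (s, p) (s, q))"
  by (rule det_on_reindex) (auto simp: bij_betw_def inj_on_def assms)

text \<open>Folding the two factors separately writes the matrix as \<open>G\<close> times
  \<open>L\<close>. \<open>L\<close> vanishes between different signs of the first factor, and its
  diagonal blocks are Kronecker products. The integer matrix \<open>G\<close> is not evaluated: its
  determinant divides the minor, which is a unit, and this makes it a rational unit.\<close>

lemma product_minor:
  assumes t: "t \<in> {1, -1}"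
    and v: "\<And>s. s \<in> {1, -1} \<Longrightarrow> M.betti_basis s (M.Pos s) (v s) (c s)"
    and v': "\<And>s. s \<in> {1, -1} \<Longrightarrow> M'.betti_basis s (M'.Pos s) (v' s) (c' s)"
  shows "\<exists>x c'' r. N.betti_basis t (K.Pos t) x c'' \<and> r \<in> rational_units \<and> K.minor t x = r *
    (M.minor eps (v eps) ^ card (M'.Pos (t * eps)) * M'.minor (t * eps) (v' (t * eps)) ^ card (M.Pos eps) *
     (M.minor (- eps) (v (- eps)) ^ card (M'.Pos (- (t * eps))) *
      M'.minor (- (t * eps)) (v' (- (t * eps))) ^ card (M.Pos (- eps))))"
proof -
  obtain c'' where c'': "N.betti_basis t (D t) (product_family v v' t) c''"
    using product_betti_basis[OF t v v'] by blast
  have "card (K.Pos t) = card (D t)"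
    using N.betti_part_dim_eq[OF t c''] K.card_Pos[OF t] by simp
  \<comment> \<open>Both index sets have as many elements as the eigenspace has dimensions. Any
    bijection serves, since it only affects \<open>x\<close> and the rational factor.\<close>
  then obtain \<phi> where \<phi>: "bij_betw \<phi> (K.Pos t) (D t)"
    using finite_same_card_bij[OF K.finite_Pos finite_D] by blast
  define \<psi> where "\<psi> = inv_into (K.Pos t) \<phi>"
  have \<psi>\<phi>: "\<psi> (\<phi> h) = h" if "h \<in> K.Pos t" for h
    unfolding \<psi>_def using \<phi> that by (simp add: bij_betw_def)
  have \<psi>: "\<psi> d \<in> K.Pos t" if "d \<in> D t" for d
    using bij_betw_inv_into[OF \<phi>] that by (auto simp: \<psi>_def bij_betw_def)
  define x where "x h = product_family v v' t (\<phi> h)" for h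
  have x: "N.betti_basis t (K.Pos t) x (\<lambda>y h. c'' y (\<phi> h))"
    unfolding x_def by (rule N.betti_basis_reindex[OF c'' \<phi>])
  define G where "G d k = M.fold_sign (fst k) (fst (\<psi> d)) (fst (snd k)) *
    M'.fold_sign (t * fst k) (snd (\<psi> d)) (snd (snd k))" for d k :: "int \<times> int \<times> int"
  define L where "L k d = (if fst k = fst d
    then C (v (fst k) (fst (snd d)) \<otimes>\<^sub>t 1) (fst (snd k)) *
      C' (v' (t * fst k) (snd (snd d)) \<otimes>\<^sub>t 1) (snd (snd k)) else 0)" for k d :: "int \<times> int \<times> int"
  have entry: "C'' (product_family v v' t d' \<otimes>\<^sub>t 1) (\<psi> d) = (\<Sum>k\<in>D t. (of_int (G d k) \<otimes>\<^sub>t 1) * L k d')"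
    if d: "d \<in> D t" and d': "d' \<in> D t" for d d'
  proof -
    obtain s i j where k: "d' = (s, i, j)" "s \<in> {1, -1}" "i \<in> M.Pos s" "j \<in> M'.Pos (t * s)"
      using d' by (auto simp: D_def)
    have ts: "t * s \<in> {1, -1}" using t k by auto
    obtain h h' where h: "\<psi> d = (h, h')" "h \<in> M.types" "h' \<in> M'.types"
      using \<psi>[OF d] K.Pos_subset by (cases "\<psi> d") auto
    have vi: "v s i \<in> betti_part M s" using v[OF k(2)] k(3) by (auto simp: M.betti_basis_def)
    have v'j: "v' (t * s) j \<in> betti_part M' (t * s)"
      using v'[OF ts] k(4) by (auto simp: M'.betti_basis_def)
    have "\<beta> (v s i) (v' (t * s) j) \<otimes>\<^sub>t 1 = \<beta>c (v s i \<otimes>\<^sub>t 1) (v' (t * s) j \<otimes>\<^sub>t 1)"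
      by (simp add: \<beta>c_pure)
    then have "C'' (product_family v v' t d' \<otimes>\<^sub>t 1) (\<psi> d) =
        C (v s i \<otimes>\<^sub>t 1) h * C' (v' (t * s) j \<otimes>\<^sub>t 1) h'"
      by (simp add: product_family_def k(1) h C''_\<beta>c)
    also have "\<dots> = (\<Sum>g\<in>M.Pos s. of_int (M.fold_sign s h g) * C (v s i \<otimes>\<^sub>t 1) g) *
        (\<Sum>g'\<in>M'.Pos (t * s). of_int (M'.fold_sign (t * s) h' g') * C' (v' (t * s) j \<otimes>\<^sub>t 1) g')"
      by (simp only: M.coord_fold[OF k(2) vi h(2)] M'.coord_fold[OF ts v'j h(3)])
    also have "\<dots> = (\<Sum>g\<in>M.Pos s. \<Sum>g'\<in>M'.Pos (t * s). (of_int (G d (s, g, g')) \<otimes>\<^sub>t 1) * L (s, g, g') d')"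
      unfolding sum_product of_int_tensor[symmetric]
      by (intro sum.cong refl) (simp add: G_def L_def h(1) k(1) mult_ac)
    also have "\<dots> = (\<Sum>r\<in>{1, -1}. if r = s then
        (\<Sum>g\<in>M.Pos s. \<Sum>g'\<in>M'.Pos (t * s). (of_int (G d (s, g, g')) \<otimes>\<^sub>t 1) * L (s, g, g') d') else 0)"
      using k(2) by auto
    also have "\<dots> = (\<Sum>k\<in>D t. (of_int (G d k) \<otimes>\<^sub>t 1) * L k d')"
      unfolding sum_D by (intro sum.cong refl) (auto simp: L_def k(1))
    finally show ?thesis .
  qed
  have "K.minor t x = det_on (K.Pos t) (\<lambda>h h'. C'' (product_family v v' t (\<phi> h') \<otimes>\<^sub>t 1) (\<psi> (\<phi> h)))"
    unfolding K.minor_def x_def by (intro det_on_cong K.finite_Pos) (simp only: \<psi>\<phi>)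
  also have "\<dots> = det_on (D t) (\<lambda>d d'. C'' (product_family v v' t d' \<otimes>\<^sub>t 1) (\<psi> d))"
    by (rule det_on_reindex[OF \<phi> K.finite_Pos, symmetric])
  also have "\<dots> = det_on (D t) (\<lambda>d d'. \<Sum>k\<in>D t. (of_int (G d k) \<otimes>\<^sub>t 1) * L k d')"
    by (intro det_on_cong finite_D entry)
  also have "\<dots> = det_on (D t) (\<lambda>d k. of_int (G d k) \<otimes>\<^sub>t 1) * det_on (D t) L"
    by (rule det_on_mult[OF finite_D])
  finally have minor: "K.minor t x = det_on (D t) (\<lambda>d k. of_int (G d k) \<otimes>\<^sub>t 1) * det_on (D t) L" .
  have "K.minor t x dvd 1" by (rule K.minor_dvd_one[OF t x])
  then have "det_on (D t) (\<lambda>d k. of_int (G d k) \<otimes>\<^sub>t (1 :: complex)) dvd (1 :: 'e coeff)"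
    unfolding minor by (rule dvd_mult_left)
  then have G: "det_on (D t) (\<lambda>d k. of_int (G d k) \<otimes>\<^sub>t (1 :: complex)) \<in> (rational_units :: 'e coeff set)"
    by (rule det_on_base_unit[OF finite_D])
  have L_block: "det_on (Pair s ` (M.Pos s \<times> M'.Pos (t * s))) L =
      M.minor s (v s) ^ card (M'.Pos (t * s)) * M'.minor (t * s) (v' (t * s)) ^ card (M.Pos s)" for s
    unfolding det_on_Pair[OF finite_cartesian_product[OF M.finite_Pos M'.finite_Pos]]
      M.minor_def M'.minor_def det_on_kronecker[OF M.finite_Pos M'.finite_Pos, symmetric]
    by (simp add: L_def)
  have "det_on (D t) L = det_on (Pair eps ` (M.Pos eps \<times> M'.Pos (t * eps))) L *
      det_on (Pair (- eps) ` (M.Pos (- eps) \<times> M'.Pos (t * - eps))) L"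
    unfolding D_eq mult_minus_right
    by (rule det_on_union) (use M.eps in \<open>auto simp: M.finite_Pos M'.finite_Pos L_def\<close>)
  then have "K.minor t x = det_on (D t) (\<lambda>d k. of_int (G d k) \<otimes>\<^sub>t 1) *
    (M.minor eps (v eps) ^ card (M'.Pos (t * eps)) * M'.minor (t * eps) (v' (t * eps)) ^ card (M.Pos eps) *
     (M.minor (- eps) (v (- eps)) ^ card (M'.Pos (- (t * eps))) *
      M'.minor (- (t * eps)) (v' (- (t * eps))) ^ card (M.Pos (- eps))))"
    unfolding minor L_block by simp
  then show ?thesis using x G by blast
qed

text \<open>
  Write \<open>c\<^sub>1\<close> and \<open>c\<^sub>0\<close> for the periods of sign \<open>eps\<close> and \<open>- eps\<close>. In terms of these,
  the exponents disappear: the ratio \<open>c\<^sub>1 / c\<^sub>0\<close> is multiplicative.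
\<close>

lemma deligne_period_ratio:
  obtains a1 a0 b1 b0 n1 n0 r where
    "a1 dvd 1" "a0 dvd 1" "b1 dvd 1" "b0 dvd 1" "n1 dvd 1" "n0 dvd 1" "r \<in> rational_units"
    "deligne_period M eps = period_class a1"
    "deligne_period M (- eps) = period_class a0"
    "deligne_period M' eps' = period_class b1"
    "deligne_period M' (- eps') = period_class b0"
    "deligne_period N (eps * eps') = period_class n1"
    "deligne_period N (- (eps * eps')) = period_class n0"
    "n1 * (a0 * b0) = r * (n0 * (a1 * b1))"
proof -
  have sgn: "eps \<in> {1, -1}" "- eps \<in> {1, -1}" "eps' \<in> {1, -1}" "- eps' \<in> {1, -1}"
    using M.eps M'.eps by auto
  have sgn_N: "eps * eps' \<in> {1, -1}" "- (eps * eps') \<in> {1, -1}"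
    using M.eps M'.eps by auto
  \<comment> \<open>For the sign eps * eps' the partner of eps is eps', so both middle indices fall
    into the same block; for the opposite sign the partner is - eps'.\<close>
  have epseps: "eps * eps' * eps = eps'" "- (eps * eps') * eps = - eps'" using M.eps by auto
  have "\<forall>s\<in>{1, -1}. \<exists>v c. M.betti_basis s (M.Pos s) v c"
    using M.ex_betti_basis M.finite_Pos M.card_Pos by blast
  then obtain v c where v: "\<And>s. s \<in> {1, -1} \<Longrightarrow> M.betti_basis s (M.Pos s) (v s) (c s)" by metis
  have "\<forall>s\<in>{1, -1}. \<exists>v c. M'.betti_basis s (M'.Pos s) v c"
    using M'.ex_betti_basis M'.finite_Pos M'.card_Pos by blast
  then obtain v' c' where v': "\<And>s. s \<in> {1, -1} \<Longrightarrow> M'.betti_basis s (M'.Pos s) (v' s) (c' s)" by metis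
  define p1 p0 q1 q0 where "p1 = M.minor eps (v eps)" and "p0 = M.minor (- eps) (v (- eps))"
    and "q1 = M'.minor eps' (v' eps')" and "q0 = M'.minor (- eps') (v' (- eps'))"
  define k where "k = card (M.Pos (- eps))"
  define k' where "k' = card (M'.Pos (- eps'))"
  have k: "card (M.Pos eps) = Suc k" "card (M'.Pos eps') = Suc k'"
    using sgn M.dim_eps M'.dim_eps by (simp_all add: k_def k'_def M.card_Pos M'.card_Pos)
  obtain x1 c1 r1 where x1: "N.betti_basis (eps * eps') (K.Pos (eps * eps')) x1 c1" "r1 \<in> rational_units"
      "K.minor (eps * eps') x1 = r1 * (p1 ^ Suc k' * q1 ^ Suc k * (p0 ^ k' * q0 ^ k))"
    using product_minor[OF sgn_N(1) v v'] unfolding epseps p1_def p0_def q1_def q0_def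
      k k_def[symmetric] k'_def[symmetric] by blast
  obtain x0 c0 r0 where x0: "N.betti_basis (- (eps * eps')) (K.Pos (- (eps * eps'))) x0 c0" "r0 \<in> rational_units"
      "K.minor (- (eps * eps')) x0 = r0 * (p1 ^ k' * q0 ^ Suc k * (p0 ^ Suc k' * q1 ^ k))"
    using product_minor[OF sgn_N(2) v v'] unfolding epseps minus_minus p1_def p0_def q1_def q0_def
      k k_def[symmetric] k'_def[symmetric] by blast
  obtain b where b: "b dvd 1" "\<And>t v c. t \<in> {1, -1} \<Longrightarrow> M.betti_basis t (M.Pos t) v c \<Longrightarrow>
      deligne_period M t = period_class (b * M.minor t v)"
    using M.deligne_period_eq by blast
  obtain b' where b': "b' dvd 1" "\<And>t v c. t \<in> {1, -1} \<Longrightarrow> M'.betti_basis t (M'.Pos t) v c \<Longrightarrow>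
      deligne_period M' t = period_class (b' * M'.minor t v)"
    using M'.deligne_period_eq by blast
  obtain b'' where b'': "b'' dvd 1" "\<And>t v c. t \<in> {1, -1} \<Longrightarrow> N.betti_basis t (K.Pos t) v c \<Longrightarrow>
      deligne_period N t = period_class (b'' * K.minor t v)"
    using K.deligne_period_eq by blast
  obtain a0 where a0: "r0 = a0 \<otimes>\<^sub>t 1" "a0 \<noteq> 0" using x0(2) by (auto simp: rational_units_def)
  define q where "q = inverse a0 \<otimes>\<^sub>t (1 :: complex)"
  have q: "q \<in> rational_units" "q * r0 = 1"
    using a0 by (auto simp: q_def rational_units_def times_pure_tensor one_tensor_def)
  have rq: "r1 * q \<in> rational_units" using x1 q by (intro rational_units_mult)
  have r1: "r1 = r1 * q * r0" by (simp only: mult.assoc q mult_1_right)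
  have unit: "x * y dvd 1" if "x dvd 1" "y dvd 1" for x y :: "'e coeff"
    using mult_dvd_mono[OF that] by simp
  \<comment> \<open>Apart from the rational factors and the units b, b', b'', both sides equal (p1
    p0)^(k'+1) (q1 q0)^(k+1). The minors differ by shifting exactly one power from each factor,
    because each eigenspace of sign eps is larger by one dimension.\<close>
  have "b'' * K.minor (eps * eps') x1 * (b * p0 * (b' * q0)) =
      r1 * q * (b'' * K.minor (- (eps * eps')) x0 * (b * p1 * (b' * q1)))"
    unfolding x1(3) x0(3) by (subst r1) (simp only: power_Suc mult_ac)
  moreover note rq
    b(2)[OF sgn(1) v[OF sgn(1)], folded p1_def] b(2)[OF sgn(2) v[OF sgn(2)], folded p0_def]
    b'(2)[OF sgn(3) v'[OF sgn(3)], folded q1_def] b'(2)[OF sgn(4) v'[OF sgn(4)], folded q0_def]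
    b''(2)[OF sgn_N(1) x1(1)] b''(2)[OF sgn_N(2) x0(1)]
    unit[OF b(1) M.minor_dvd_one[OF sgn(1) v[OF sgn(1)]], folded p1_def]
    unit[OF b(1) M.minor_dvd_one[OF sgn(2) v[OF sgn(2)]], folded p0_def]
    unit[OF b'(1) M'.minor_dvd_one[OF sgn(3) v'[OF sgn(3)]], folded q1_def]
    unit[OF b'(1) M'.minor_dvd_one[OF sgn(4) v'[OF sgn(4)]], folded q0_def]
    unit[OF b''(1) K.minor_dvd_one[OF sgn_N(1) x1(1)]]
    unit[OF b''(1) K.minor_dvd_one[OF sgn_N(2) x0(1)]]
  ultimately show thesis
    by - (rule that[of "b * p1" "b * p0" "b' * q1" "b' * q0" "b'' * K.minor (eps * eps') x1"
          "b'' * K.minor (- (eps * eps')) x0" "r1 * q"]; assumption)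
qed

end

section \<open>The ratio of the periods\<close>

lemma comm_group_coeff_units: "comm_group (coeff_units :: 'e :: field_char_0 coeff monoid)"
proof (rule comm_groupI)
  let ?G = "coeff_units :: 'e coeff monoid"
  show "x \<otimes>\<^bsub>?G\<^esub> y \<in> carrier ?G" if "x \<in> carrier ?G" "y \<in> carrier ?G" for x y
    using that mult_dvd_mono[of x 1 y 1] by (simp add: coeff_units_def)
  show "\<exists>y\<in>carrier ?G. y \<otimes>\<^bsub>?G\<^esub> x = \<one>\<^bsub>?G\<^esub>" if x: "x \<in> carrier ?G" for x
  proof -
    obtain y where "1 = x * y" using x by (auto simp: coeff_units_def elim: dvdE)
    then have "y \<in> carrier ?G" "y \<otimes>\<^bsub>?G\<^esub> x = \<one>\<^bsub>?G\<^esub>"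
      by (simp_all add: coeff_units_def mult.commute)
        (metis dvd_triv_right)
    then show ?thesis by blast
  qed
qed (auto simp: coeff_units_def mult_ac)

lemma subgroup_rational_units: "subgroup rational_units (coeff_units :: 'e :: field_char_0 coeff monoid)"
proof -
  interpret comm_group "coeff_units :: 'e coeff monoid" by (rule comm_group_coeff_units)
  show ?thesis
  proof (rule subgroupI)
    show "rational_units \<subseteq> carrier (coeff_units :: 'e coeff monoid)"
      using rational_units_dvd_one by (auto simp: coeff_units_def)
    show "(rational_units :: 'e coeff set) \<noteq> {}" using of_int_rational_unit[of 1] by auto
    show "a \<otimes>\<^bsub>coeff_units\<^esub> b \<in> rational_units"
      if "a \<in> rational_units" "b \<in> rational_units" for a b :: "'e coeff"
      using that by (simp add: coeff_units_def rational_units_mult)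
    show "inv\<^bsub>coeff_units\<^esub> a \<in> rational_units" if a: "a \<in> rational_units" for a :: "'e coeff"
    proof -
      obtain x where x: "a = x \<otimes>\<^sub>t 1" "x \<noteq> 0" using a by (auto simp: rational_units_def)
      have y: "inverse x \<otimes>\<^sub>t (1 :: complex) \<in> rational_units" using x by (auto simp: rational_units_def)
      have "inv\<^bsub>coeff_units\<^esub> a = inverse x \<otimes>\<^sub>t 1"
      proof (rule inv_equality)
        show "(inverse x \<otimes>\<^sub>t 1) \<otimes>\<^bsub>coeff_units\<^esub> a = \<one>\<^bsub>coeff_units\<^esub>"
          using x by (simp add: coeff_units_def times_pure_tensor one_tensor_def)
      qed (use a y rational_units_dvd_one in \<open>auto simp: coeff_units_def\<close>)
      then show ?thesis using y by simp
    qed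
  qed
qed

lemma normal_rational_units: "rational_units \<lhd> (coeff_units :: 'e :: field_char_0 coeff monoid)"
  by (rule comm_group.subgroup_imp_normal[OF comm_group_coeff_units subgroup_rational_units])

lemma comm_group_period_group: "comm_group (period_group :: 'e :: field_char_0 coeff set monoid)"
  unfolding period_group_def
  by (rule comm_group.abelian_FactGroup[OF comm_group_coeff_units subgroup_rational_units])

lemma coset_in_period_group:
  "x dvd 1 \<Longrightarrow> period_class x \<in> carrier (period_group :: 'e :: field_char_0 coeff set monoid)"
  by (auto simp: period_group_def carrier_FactGroup coeff_units_def)

lemma coset_mult:
  fixes x y :: "'e :: field_char_0 coeff"
  assumes "x dvd 1" "y dvd 1"
  shows "(period_class x) \<otimes>\<^bsub>period_group\<^esub> (period_class y) =
    period_class (x * y)"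
  using normal.rcos_sum[OF normal_rational_units, of x y] assms
  by (simp add: period_group_def coeff_units_def)

lemma (in comm_group) ratio_identity:
  assumes c: "a1 \<in> carrier G" "a0 \<in> carrier G" "b1 \<in> carrier G" "b0 \<in> carrier G"
      "n1 \<in> carrier G" "n0 \<in> carrier G"
    and eq: "n1 \<otimes> (a0 \<otimes> b0) = n0 \<otimes> (a1 \<otimes> b1)"
  shows "n1 \<otimes> inv n0 = (a1 \<otimes> inv a0) \<otimes> (b1 \<otimes> inv b0)"
proof -
  have "n1 = n0 \<otimes> (a1 \<otimes> b1) \<otimes> inv (a0 \<otimes> b0)"
    using c eq by (metis inv_solve_right m_closed)
  then have "n1 = ((a1 \<otimes> inv a0) \<otimes> (b1 \<otimes> inv b0)) \<otimes> n0"
    using c by (simp add: inv_mult m_ac)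
  then show ?thesis using c by (subst inv_solve_right') auto
qed

text \<open>Let A, B, Q be the ratios of the values at 1 and -1 of \<open>a\<close>,
  \<open>b\<close>, \<open>n\<close>. Changing the sign inverts a ratio, so the hypothesis says Q^(s
  s') = A^s B^s'. Raising this to the power s s' interchanges the exponents on the right, since s
  and s' square to one.\<close>

lemma (in comm_group) signed_ratio_identity:
  fixes s s' :: int and a b n :: "int \<Rightarrow> 'a"
  assumes s: "s \<in> {1, -1}" "s' \<in> {1, -1}"
    and c: "\<And>t. t \<in> {1, -1} \<Longrightarrow> a t \<in> carrier G \<and> b t \<in> carrier G \<and> n t \<in> carrier G"
    and eq: "n (s * s') \<otimes> (a (- s) \<otimes> b (- s')) = n (- (s * s')) \<otimes> (a s \<otimes> b s')"
  shows "n 1 \<otimes> inv n (-1) = (a 1 \<otimes> inv a (-1)) [^] s' \<otimes> (b 1 \<otimes> inv b (-1)) [^] s"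
proof -
  have c': "a 1 \<in> carrier G" "a (-1) \<in> carrier G" "b 1 \<in> carrier G" "b (-1) \<in> carrier G"
    "n 1 \<in> carrier G" "n (-1) \<in> carrier G" using c[of 1] c[of "-1"] by auto
  have inv_ratio: "inv (x \<otimes> inv y) = y \<otimes> inv x" if "x \<in> carrier G" "y \<in> carrier G" for x y
    using that by (simp add: inv_mult_group m_comm)
  have pow: "x [^] (1 :: int) = x" "x [^] (-1 :: int) = inv x" if "x \<in> carrier G" for x
    using that by (simp_all add: int_pow_neg)
  consider "s = 1" "s' = 1" | "s = 1" "s' = -1" | "s = -1" "s' = 1" | "s = -1" "s' = -1"
    using s by auto
  then show ?thesis
  proof cases
    case 1
    then show ?thesis
      using ratio_identity[of "a 1" "a (-1)" "b 1" "b (-1)" "n 1" "n (-1)"] c' eq by (simp add: pow)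
  next
    case 2
    then have "n (-1) \<otimes> inv n 1 = (a 1 \<otimes> inv a (-1)) \<otimes> (b (-1) \<otimes> inv b 1)"
      using c' eq by (intro ratio_identity) simp_all
    then have "inv (n (-1) \<otimes> inv n 1) = inv (a 1 \<otimes> inv a (-1)) \<otimes> inv (b (-1) \<otimes> inv b 1)"
      using c' by (simp add: inv_mult)
    then show ?thesis using 2 c' by (simp add: inv_ratio pow)
  next
    case 3
    then have "n (-1) \<otimes> inv n 1 = (a (-1) \<otimes> inv a 1) \<otimes> (b 1 \<otimes> inv b (-1))"
      using c' eq by (intro ratio_identity) simp_all
    then have "inv (n (-1) \<otimes> inv n 1) = inv (a (-1) \<otimes> inv a 1) \<otimes> inv (b 1 \<otimes> inv b (-1))"
      using c' by (simp add: inv_mult)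
    then show ?thesis using 3 c' by (simp add: inv_ratio pow)
  next
    case 4
    then have "n 1 \<otimes> inv n (-1) = (a (-1) \<otimes> inv a 1) \<otimes> (b (-1) \<otimes> inv b 1)"
      using c' eq by (intro ratio_identity) simp_all
    then show ?thesis using 4 c' by (simp add: inv_ratio pow)
  qed
qed

theorem theorem5p2:
  fixes M :: "('e :: field_char_0, 'b :: ab_group_add, 'r :: ab_group_add) motive"
    and M' :: "('e, 'b' :: ab_group_add, 'r' :: ab_group_add) motive"
    and N :: "('e, 'b'' :: ab_group_add, 'r'' :: ab_group_add) motive"
  assumes "number_field TYPE('e)"
    and "pure_motive M" and "pure_motive M'"
    and "is_tensor_motive M M' N"
    and "odd (rank M)" and "odd (rank M')"
    and "\<forall>p q. hodge_number M p q \<noteq> 0 \<longrightarrow> hodge_number M p q = 1"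
    and "\<forall>p q. hodge_number M' p q \<noteq> 0 \<longrightarrow> hodge_number M' p q = 1"
    and "critical N"
  shows "deligne_period N 1 \<otimes>\<^bsub>period_group\<^esub> inv\<^bsub>period_group\<^esub> deligne_period N (-1) =
    (deligne_period M 1 \<otimes>\<^bsub>period_group\<^esub> inv\<^bsub>period_group\<^esub> deligne_period M (-1)) [^]\<^bsub>period_group\<^esub> middle_sign M' \<otimes>\<^bsub>period_group\<^esub>
    (deligne_period M' 1 \<otimes>\<^bsub>period_group\<^esub> inv\<^bsub>period_group\<^esub> deligne_period M' (-1)) [^]\<^bsub>period_group\<^esub> middle_sign M"
proof -
  interpret RM: realization M by unfold_locales (rule assms(2))
  interpret RM': realization M' by unfold_locales (rule assms(3))
  obtain e C m eps wm where
    M: "critical_hodge_basis M RM.types (\<lambda>h. h) (\<lambda>h. weight M - h) e C m m eps wm"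
    and "weight M = 2 * m" and Mg: "\<forall>p\<in>RM.types. RM.generator p (e p)"
    and Meps: "middle_sign M = eps"
    using RM.ex_hodge_basis[OF assms(5,7)] by blast
  obtain e' C' m' eps' wm' where
    M': "critical_hodge_basis M' RM'.types (\<lambda>h. h) (\<lambda>h. weight M' - h) e' C' m' m' eps' wm'"
    and "weight M' = 2 * m'" and Mg': "\<forall>p\<in>RM'.types. RM'.generator p (e' p)"
    and Meps': "middle_sign M' = eps'"
    using RM'.ex_hodge_basis[OF assms(6,8)] by blast
  have N: "realization N"
    using assms(4) by (simp add: is_tensor_motive_def realization_def)
  have "weight N = weight M + weight M'"
    using assms(4) by (simp add: is_tensor_motive_def)
  obtain \<beta> \<delta> where tensor:
    "is_tensor_product (betti_scale M) (betti_scale M') (betti_scale N) \<beta> \<and>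
     is_tensor_product (dr_scale M) (dr_scale M') (dr_scale N) \<delta> \<and>
     (\<forall>x y. rho N (\<beta> x y) = \<beta> (rho M x) (rho M' y)) \<and>
     (\<forall>p q. hodge N p q = Modules.module.span (betti_scale_complex N)
       {tensor_map2 \<beta> (*) x y | x y a b. x \<in> hodge M a b \<and> y \<in> hodge M' (p - a) (q - b)}) \<and>
     (\<forall>p. fil N p = Modules.module.span (dr_scale N)
       {\<delta> x y | x y a. x \<in> fil M a \<and> y \<in> fil M' (p - a)}) \<and>
     (\<forall>x y. comparison N (tensor_map2 \<beta> (*) x y) =
       tensor_map2 \<delta> (*) (comparison M x) (comparison M' y))"
    using assms(4)[unfolded is_tensor_motive_def, THEN conjunct2, THEN conjunct2]
    by (elim exE) (rule that)
  note tensor_simps = tensor[THEN conjunct2, THEN conjunct2, THEN conjunct1, rule_format]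
    tensor[THEN conjunct2, THEN conjunct2, THEN conjunct2, THEN conjunct1, rule_format]
    tensor[THEN conjunct2, THEN conjunct2, THEN conjunct2, THEN conjunct2, THEN conjunct1, rule_format]
    tensor[THEN conjunct2, THEN conjunct2, THEN conjunct2, THEN conjunct2, THEN conjunct2, rule_format]
  have "tensor_motive M M' N e C m eps wm e' C' m' eps' wm' \<beta> \<delta>"
  proof (rule tensor_motive.intro[OF M M' N], rule tensor_motive_axioms.intro)
    show "RM.generator p (e p)" if "p \<in> RM.types" for p using Mg that by blast
    show "RM'.generator p (e' p)" if "p \<in> RM'.types" for p using Mg' that by blast
    show "weight M = 2 * m" "weight M' = 2 * m'" "weight N = weight M + weight M'" by fact+
    show "is_tensor_product (betti_scale M) (betti_scale M') (betti_scale N) \<beta>"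
      "is_tensor_product (dr_scale M) (dr_scale M') (dr_scale N) \<delta>"
      by (rule tensor[THEN conjunct1] tensor[THEN conjunct2, THEN conjunct1])+
  qed (rule tensor_simps)+
  then have X: "critical_tensor_motive M M' N e C m eps wm e' C' m' eps' wm' \<beta> \<delta>"
    by (rule critical_tensor_motive.intro) (rule critical_tensor_motive_axioms.intro, rule assms(9))
  have eps: "eps \<in> {1, -1}" and eps': "eps' \<in> {1, -1}"
    by (rule hodge_basis.eps[OF critical_hodge_basis.axioms(1)[OF M]])
      (rule hodge_basis.eps[OF critical_hodge_basis.axioms(1)[OF M']])
  obtain a1 a0 b1 b0 n1 n0 r where
    unit: "a1 dvd 1" "a0 dvd 1" "b1 dvd 1" "b0 dvd 1" "n1 dvd 1" "n0 dvd 1" and r: "r \<in> rational_units"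
    and period: "deligne_period M eps = period_class a1"
      "deligne_period M (- eps) = period_class a0"
      "deligne_period M' eps' = period_class b1"
      "deligne_period M' (- eps') = period_class b0"
      "deligne_period N (eps * eps') = period_class n1"
      "deligne_period N (- (eps * eps')) = period_class n0"
    and eq: "n1 * (a0 * b0) = r * (n0 * (a1 * b1))"
    by (rule critical_tensor_motive.deligne_period_ratio[OF X])
  have mult: "x * y dvd 1" if "x dvd 1" "y dvd 1" for x y :: "'e coeff"
    using mult_dvd_mono[OF that] by simp
  show ?thesis
    unfolding Meps Meps'
  proof (rule comm_group.signed_ratio_identity[OF comm_group_period_group eps eps'])
    fix t :: int assume "t \<in> {1, -1}"
    \<comment> \<open>For each motive the two signs for which the period is known as the class of a
      unit exhaust 1 and -1.\<close>
    then have "t = eps \<or> t = - eps" "t = eps' \<or> t = - eps'" "t = eps * eps' \<or> t = - (eps * eps')"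
      using eps eps' by auto
    then show "deligne_period M t \<in> carrier period_group \<and> deligne_period M' t \<in> carrier period_group \<and>
        deligne_period N t \<in> carrier period_group"
      using period unit coset_in_period_group by metis
  next
    show "deligne_period N (eps * eps') \<otimes>\<^bsub>period_group\<^esub>
          (deligne_period M (- eps) \<otimes>\<^bsub>period_group\<^esub> deligne_period M' (- eps')) =
        deligne_period N (- (eps * eps')) \<otimes>\<^bsub>period_group\<^esub>
          (deligne_period M eps \<otimes>\<^bsub>period_group\<^esub> deligne_period M' eps')"
      unfolding period
      by (simp only: coset_mult unit mult eq period_class_rational_mult[OF r])
  qed
qed

end
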